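(* Let $\alpha>-1$. The modified projection operator $\widetilde P_\alpha$ is a bounded projection from $L^\infty(T_B)$ to $\widetilde{\mathcal B}$.
   Context: Let $n$ be a positive integer. For $z=x+iy\in\mathbb C^n$ write $z'=(z_1,\dots,z_{n-1})$, $y'=(y_1,\dots,y_{n-1})$. The tubular domain is $T_B=\{z=x+iy\in\mathbb C^n:|y'|^2<y_n\}$; $\mathbf i=(0',i)\in T_B$ with $0'=(0,\dots,0)\in\mathbb R^{n-1}$. Put $\rho(z,w)=\frac14\big(\sum_{j=1}^{n-1}(z_j-\overline{w_j})^2-2i(z_n-\overline{w_n})\big)$ (positive real part on $T_B\times T_B$; powers are principal branches) and $\rho(z)=\rho(z,z)=y_n-|y'|^2$. For $\alpha>-1$, $dV_\alpha(z)=\rho(z)^\alpha dV(z)$ with $dV$ Lebesgue measure on $\mathbb C^n$, and the Bergman kernel is $K_\alpha(z,w)=\frac{\Gamma(n+1+\alpha)}{2^{n+1}\pi^n\Gamma(\alpha+1)}\rho(z,w)^{-(n+1+\alpha)}$. The modified kernel and modified projection operator are $$\widetilde K_\alpha(z,w)=K_\alpha(z,w)-K_\alpha(\mathbf i,w),\qquad \widetilde P_\alpha f(z)=\int_{T_B}\widetilde K_\alpha(z,w)f(w)\,dV_\alpha(w).$$ For $f$ holomorphic on $T_B$, $$|\widetilde\nabla f(z)|^2=4\rho(z)\Big(2\rho(z)\Big|\frac{\partial f}{\partial z_n}(z)\Big|^2+\sum_{j=1}^{n-1}\Big|\frac{\partial f}{\partial z_j}(z)+2y_j\frac{\partial f}{\partial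 z_n}(z)\Big|^2\Big).$$ The Bloch space $\mathcal B$ is the set of holomorphic $f$ on $T_B$ with $\|f\|_{\mathcal B}:=\sup_{z\in T_B}|\widetilde\nabla f(z)|<\infty$, and $\widetilde{\mathcal B}=\{f\in\mathcal B:f(\mathbf i)=0\}$, with norm $\|\cdot\|_{\mathcal B}$. $L^\infty(T_B)$ is the space of essentially bounded measurable functions on $T_B$ with the essential supremum norm. *)

theory Defs
  imports "HOL-Analysis.Analysis" "HOL-Probability.Essential_Supremum"
begin

text \<open>
  The space of $n$ complex variables is \<^typ>\<open>complex ^ 'n\<close> for a finite, linearly ordered index type
  \<^typ>\<open>'n\<close> with $n$ elements. The last coordinate is the one with the largest index; unlike a
  splitting into $n - 1$ coordinates and one more, this includes the case $n = 1$.
\<close>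

definition last_idx :: "'n::{finite,linorder}" where
  "last_idx = Max UNIV"

definition tube :: "(complex ^ 'n::{finite,linorder}) set" where
  "tube = {z. (\<Sum>j\<in>{..<last_idx}. (Im (z $ j))\<^sup>2) < Im (z $ last_idx)}"

definition base_pt :: "complex ^ 'n::{finite,linorder}" where
  "base_pt = axis last_idx \<i>"

definition rho2 :: "complex ^ 'n::{finite,linorder} \<Rightarrow> complex ^ 'n::{finite,linorder} \<Rightarrow> complex" where
  "rho2 z w = 1 / 4 * ((\<Sum>j\<in>{..<last_idx}. (z $ j - cnj (w $ j))\<^sup>2)
                        - 2 * \<i> * (z $ last_idx - cnj (w $ last_idx)))"

definition rho :: "complex ^ 'n::{finite,linorder} \<Rightarrow> real" where
  "rho z = Im (z $ last_idx) - (\<Sum>j\<in>{..<last_idx}. (Im (z $ j))\<^sup>2)"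

lemma rho2_diag: "rho2 z z = complex_of_real (rho z)"
proof -
  have d: "u - cnj u = 2 * \<i> * complex_of_real (Im u)" for u
    by (simp add: complex_eq_iff)
  have e: "2 * \<i> * (2 * \<i> * complex_of_real (Im u)) = - (4 * complex_of_real (Im u))" for u
    by (simp add: complex_eq_iff)
  show ?thesis
    unfolding rho2_def rho_def d e
    by (simp add: power_mult_distrib sum_negf sum_distrib_left [symmetric] algebra_simps)
qed

definition vol :: "real \<Rightarrow> (complex ^ 'n::{finite,linorder}) measure" where
  "vol \<alpha> = density (lebesgue_on tube) (\<lambda>z. ennreal (rho z powr \<alpha>))"

definition bergman_kernel :: "real \<Rightarrow> complex ^ 'n::{finite,linorder} \<Rightarrow> complex ^ 'n::{finite,linorder} \<Rightarrow> complex" where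
  "bergman_kernel \<alpha> z w =
     complex_of_real (Gamma (real CARD('n) + 1 + \<alpha>) / (2 ^ (CARD('n) + 1) * pi ^ CARD('n) * Gamma (\<alpha> + 1)))
     * rho2 z w powr complex_of_real (- (real CARD('n) + 1 + \<alpha>))"

definition mod_kernel :: "real \<Rightarrow> complex ^ 'n::{finite,linorder} \<Rightarrow> complex ^ 'n::{finite,linorder} \<Rightarrow> complex" where
  "mod_kernel \<alpha> z w = bergman_kernel \<alpha> z w - bergman_kernel \<alpha> base_pt w"

definition mod_proj :: "real \<Rightarrow> (complex ^ 'n::{finite,linorder} \<Rightarrow> complex) \<Rightarrow> complex ^ 'n::{finite,linorder} \<Rightarrow> complex" where
  "mod_proj \<alpha> f z = (LINT w|vol \<alpha>. mod_kernel \<alpha> z w * f w)"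

definition holomorphic_several :: "(complex ^ 'n::finite \<Rightarrow> complex) \<Rightarrow> (complex ^ 'n::finite) set \<Rightarrow> bool" where
  "holomorphic_several f S \<longleftrightarrow>
     (\<forall>z\<in>S. \<exists>D. (f has_derivative D) (at z) \<and> (\<forall>c v. D (c *s v) = c * D v))"

definition pd :: "'n::finite \<Rightarrow> (complex ^ 'n::finite \<Rightarrow> complex) \<Rightarrow> complex ^ 'n::finite \<Rightarrow> complex" where
  "pd j f z = deriv (\<lambda>t. f (z + axis j t)) 0"

definition inv_grad :: "(complex ^ 'n::{finite,linorder} \<Rightarrow> complex) \<Rightarrow> complex ^ 'n::{finite,linorder} \<Rightarrow> real" where
  "inv_grad f z =
     sqrt (4 * rho z * (2 * rho z * (cmod (pd last_idx f z))\<^sup>2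
       + (\<Sum>j\<in>{..<last_idx}. (cmod (pd j f z + 2 * complex_of_real (Im (z $ j)) * pd last_idx f z))\<^sup>2)))"

text \<open>
  Functions on the tube are represented by total functions whose values outside the tube are
  irrelevant; elements of $L^\infty$ are represented by functions instead of classes.
\<close>

definition bloch :: "(complex ^ 'n::{finite,linorder} \<Rightarrow> complex) set" where
  "bloch = {f. holomorphic_several f tube \<and> bdd_above (inv_grad f ` tube)}"

definition bloch_norm :: "(complex ^ 'n::{finite,linorder} \<Rightarrow> complex) \<Rightarrow> real" where
  "bloch_norm f = (SUP z\<in>tube. inv_grad f z)"

definition bloch0 :: "(complex ^ 'n::{finite,linorder} \<Rightarrow> complex) set" where
  "bloch0 = {f \<in> bloch. f base_pt = 0}"

definition Linf :: "(complex ^ 'n::{finite,linorder} \<Rightarrow> complex) set" where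
  "Linf = {f \<in> borel_measurable (lebesgue_on tube).
             esssup (lebesgue_on tube) (\<lambda>z. ereal (cmod (f z))) < \<infinity>}"

definition Linf_norm :: "(complex ^ 'n::{finite,linorder} \<Rightarrow> complex) \<Rightarrow> real" where
  "Linf_norm f = real_of_ereal (esssup (lebesgue_on tube) (\<lambda>z. ereal (cmod (f z))))"

end

theory Submission
  imports Defs "HOL-Complex_Analysis.Complex_Analysis" "HOL-Probability.Sinc_Integral"
begin

no_notation fps_nth (infixl "$" 75)

text \<open>
  The tube is the Siegel domain in coordinates adapted to real translations. A volume-preserving
  change of variables centred at \<open>z\<close> makes the kernel depend on the last coordinate only; averaging
  a holomorphic function over the rotations of the remaining coordinates then reduces the reproducing
  formula of \<open>K\<^sub>\<alpha>\<close> to a weighted Cauchy formula on the upper half-plane, first for functions with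
  \<open>|F| \<le> C \<rho>\<^sup>-\<^sup>a\<close>, \<open>0 < a < \<alpha> + 1\<close>.

  Boundedness follows by differentiating under the integral and the estimate
  \<open>\<integral> \<rho>(w)\<^sup>\<alpha> |\<rho>(z,w)|\<^sup>-\<^sup>s dV(w) \<le> C \<rho>(z)\<^sup>n\<^sup>+\<^sup>1\<^sup>+\<^sup>\<alpha>\<^sup>-\<^sup>s\<close>. A Bloch function \<open>g\<close> grows slower than any negative
  power of \<open>\<rho>\<close>, up to a polynomial factor that is removed by dividing by \<open>1 + \<delta> \<rho>(\<cdot>, \<i>)\<close>; hence
  \<open>g(z) - g(\<i>)\<close> is reproduced by the modified kernel. For surjectivity, the bounded function
  \<open>f = 2 / (\<i> (\<alpha> + 1)) \<rho> \<partial>\<^sub>n g\<close> has a projection with the same \<open>z\<^sub>n\<close>-derivative as \<open>g\<close>, and a Bloch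
  function whose \<open>z\<^sub>n\<close>-derivative vanishes is constant, since its oscillation on compact sets tends to
  0 as they are pushed to infinite height.
\<close>

subsection \<open>Lebesgue measure on complex vectors\<close>

text \<open>The kernel sits at a critical exponent: the integral estimate for
  \<open>|rho2 z w| powr (- N)\<close> against the weight \<alpha> requires N > n + 1 + \<alpha>,
  and the kernel has N = n + 1 + \<alpha>. Subtracting its value at the base point supplies decay: a
  derivative in z raises N by 1 at the price of a factor of order |rho2|^(1/2), a net gain of 1/2.
  This pays for bounded functions and for the small growth of Bloch functions. In the reproducing
  formula the plain kernel is used, and there the growth \<open>rho w powr (- a)\<close> of the
  function supplies the excess: it lowers the weight to \<alpha> - a while the exponent stays. Bloch
  functions may be unbounded, so the projection property is expressed as the identity on the Bloch
  space, with convergence of the integrals there, and as surjectivity from bounded functions. For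
  surjectivity the z_n-derivative of a Bloch function grows like 1 / rho. Growth exponent 1 is
  admissible for the weight \<alpha> only if \<alpha> > 0, but always for \<alpha> + 1. The factor
  rho in the bounded preimage raises the weight to \<alpha> + 1, and differentiating the kernel in
  z_n raises its index to match.\<close>

lemma nn_integral_lborel_translate:
  fixes f :: "'a::euclidean_space \<Rightarrow> ennreal"
  assumes [measurable]: "f \<in> borel_measurable borel"
  shows "(\<integral>\<^sup>+x. f (x + c) \<partial>lborel) = (\<integral>\<^sup>+x. f x \<partial>lborel)"
proof -
  have "(\<integral>\<^sup>+x. f x \<partial>lborel) = (\<integral>\<^sup>+x. f x \<partial>distr lborel borel ((+) c))"
    by (simp add: lborel_distr_plus)
  also have "\<dots> = (\<integral>\<^sup>+x. f (c + x) \<partial>lborel)"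
    by (subst nn_integral_distr) auto
  finally show ?thesis by (simp add: add.commute)
qed

lemma nn_integral_lborel_reflect:
  fixes f :: "'a::euclidean_space \<Rightarrow> ennreal"
  assumes [measurable]: "f \<in> borel_measurable borel"
  shows "(\<integral>\<^sup>+x. f (c - x) \<partial>lborel) = (\<integral>\<^sup>+x. f x \<partial>lborel)"
proof -
  have "(\<integral>\<^sup>+x. f x \<partial>lborel) = (\<integral>\<^sup>+x. f x \<partial>density (distr lborel borel (\<lambda>x. c + (-1) *\<^sub>R x)) (\<lambda>_. ennreal (\<bar>-1\<bar> ^ DIM('a))))"
    by (subst lborel_affine[of "-1" c]) auto
  also have "\<dots> = (\<integral>\<^sup>+x. f (c - x) \<partial>lborel)"
    by (simp add: nn_integral_density nn_integral_distr)
  finally show ?thesis by simp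
qed

text \<open>Both sides of the computation below are invariant measures, and Tonelli's theorem applied to
  \<open>1\<^sub>A (R x) 1\<^sub>B (y - R x)\<close> with \<open>B\<close> the unit ball compares them.\<close>

lemma lborel_distr_isometry:
  fixes R :: "'a::euclidean_space \<Rightarrow> 'a"
  assumes lin: "linear R" and iso: "\<And>x. norm (R x) = norm x"
  shows "distr lborel borel R = lborel"
proof (rule measure_eqI)
  have inj: "inj R" using iso lin by (metis linear_injective_0 norm_eq_zero)
  hence "surj R" using lin linear_inj_imp_surj by blast
  have [measurable]: "R \<in> borel_measurable borel"
    using lin linear_continuous_on linear_conv_bounded_linear by (intro borel_measurable_continuous_onI) blast
  fix A assume "A \<in> sets (distr lborel borel R)"
  hence A[measurable]: "A \<in> sets borel" by simp
  define B where "B = ball (0::'a) 1"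
  have B[measurable]: "B \<in> sets borel" by (simp add: B_def)
  have emR: "emeasure (distr lborel borel R) C = (\<integral>\<^sup>+x. indicator C (R x) \<partial>lborel)" if [measurable]: "C \<in> sets borel" for C
  proof -
    have "emeasure (distr lborel borel R) C = (\<integral>\<^sup>+x. indicator C x \<partial>distr lborel borel R)"
      by (subst nn_integral_indicator) (use that in auto)
    thus ?thesis by (subst (asm) nn_integral_distr) auto
  qed
  have em1: "(\<integral>\<^sup>+y. indicator C (y - c) \<partial>lborel) = emeasure lborel C" if [measurable]: "C \<in> sets borel" for C and c :: 'a
    using nn_integral_lborel_translate[of "indicator C" "-c"] by simp
  have "emeasure (distr lborel borel R) A * emeasure lborel B
      = (\<integral>\<^sup>+x. indicator A (R x) * (\<integral>\<^sup>+y. indicator B (y - R x) \<partial>lborel) \<partial>lborel)"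
    by (simp add: emR em1 nn_integral_multc)
  also have "\<dots> = (\<integral>\<^sup>+x. (\<integral>\<^sup>+y. indicator A (R x) * indicator B (y - R x) \<partial>lborel) \<partial>lborel)"
    by (simp add: nn_integral_cmult)
  also have "\<dots> = (\<integral>\<^sup>+y. (\<integral>\<^sup>+x. indicator A (R x) * indicator B (y - R x) \<partial>lborel) \<partial>lborel)"
    by (rule lborel_pair.Fubini') simp
  also have "\<dots> = (\<integral>\<^sup>+y. (\<integral>\<^sup>+x. indicator A (y - R x) * indicator B (R x) \<partial>lborel) \<partial>lborel)"
  proof (rule nn_integral_cong)
    \<comment> \<open>Reflecting x to c - x, where \<open>R c = y\<close>, interchanges
      \<open>R x\<close> and \<open>y - R x\<close>, and with them the roles of A and B.\<close>
    fix y obtain c where c: "R c = y" using \<open>surj R\<close> by (metis surjD)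
    have "(\<integral>\<^sup>+x. indicator A (R x) * indicator B (y - R x) \<partial>lborel)
       = (\<integral>\<^sup>+x. indicator A (R (c - x)) * indicator B (y - R (c - x)) \<partial>lborel)"
      by (rule nn_integral_lborel_reflect[symmetric]) simp
    thus "(\<integral>\<^sup>+x. indicator A (R x) * indicator B (y - R x) \<partial>lborel)
      = (\<integral>\<^sup>+x. indicator A (y - R x) * indicator B (R x) \<partial>lborel)"
      by (simp add: linear_diff[OF lin] c)
  qed
  also have "\<dots> = (\<integral>\<^sup>+x. (\<integral>\<^sup>+y. indicator A (y - R x) * indicator B (R x) \<partial>lborel) \<partial>lborel)"
    by (rule lborel_pair.Fubini') simp
  also have "\<dots> = emeasure lborel A * emeasure (distr lborel borel R) B"
    by (simp add: emR em1 nn_integral_multc nn_integral_cmult)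
  also have "emeasure (distr lborel borel R) B = emeasure lborel B"
  proof -
    have "R -` B = B" using iso by (auto simp: B_def)
    thus ?thesis by (simp add: emeasure_distr)
  qed
  finally have *: "emeasure (distr lborel borel R) A * emeasure lborel B = emeasure lborel A * emeasure lborel B" .
  \<comment> \<open>The ball is the reference set: \<open>R\<close> fixes it, and its measure is
    neither 0 nor infinite, so it cancels.\<close>
  have "emeasure lborel B \<noteq> 0" "emeasure lborel B \<noteq> \<infinity>"
    using emeasure_lborel_ball_finite[of "0::'a" 1] content_ball_pos[of 1 "0::'a"]
    by (auto simp: B_def measure_def less_top)
  with * show "emeasure (distr lborel borel R) A = emeasure lborel A"
    by (auto simp: mult.commute[of _ "emeasure lborel B"] ennreal_mult_cancel_left)
qed auto

lemma measurable_vec_lambda [measurable]: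
  "vec_lambda \<in> (\<Pi>\<^sub>M i\<in>(UNIV::'n::finite set). (borel :: 'a::euclidean_space measure)) \<rightarrow>\<^sub>M (borel :: ('a^'n) measure)"
proof (subst borel_measurable_euclidean_space, intro ballI)
  fix b :: "'a^'n" assume "b \<in> Basis"
  then obtain i c where b: "b = axis i c" by (auto simp: Basis_vec_def)
  show "(\<lambda>x. vec_lambda x \<bullet> b) \<in> borel_measurable (\<Pi>\<^sub>M i\<in>(UNIV::'n set). (borel :: 'a measure))"
    unfolding b inner_axis by simp
qed

text \<open>\<open>lborel\<close> is determined by the content of boxes, and the vectors
  \<open>axis i c\<close> with c in \<open>Basis\<close> enumerate the basis of the vector type, so
  that content is an iterated product. The Fubini rules for finite product measures become available
  for vectors.\<close>

lemma lborel_vec: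
  "(lborel :: ('a::euclidean_space^'n::finite) measure) = distr (\<Pi>\<^sub>M i\<in>UNIV. lborel) borel vec_lambda"
proof (rule lborel_eqI)
  interpret product_sigma_finite "\<lambda>i::'n. (lborel :: 'a measure)" ..
  interpret finite_product_sigma_finite "\<lambda>i::'n. (lborel :: 'a measure)" UNIV by standard simp
  fix l u :: "'a^'n" assume lu: "\<And>b. b \<in> Basis \<Longrightarrow> l \<bullet> b \<le> u \<bullet> b"
  have m: "vec_lambda \<in> (\<Pi>\<^sub>M i\<in>(UNIV::'n set). (lborel :: 'a measure)) \<rightarrow>\<^sub>M (borel :: ('a^'n) measure)"
    using measurable_vec_lambda[where 'a='a and 'n='n] by (simp add: measurable_def space_PiM sets_PiM_cong[OF refl, of UNIV "\<lambda>_. lborel" "\<lambda>_. borel"])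
  have le: "l $ i \<bullet> c \<le> u $ i \<bullet> c" if "c \<in> Basis" for i c
    using lu[of "axis i c"] that by (simp add: inner_axis axis_in_Basis_iff)
  have "vec_lambda -` box l u \<inter> space (\<Pi>\<^sub>M i\<in>(UNIV::'n set). (lborel :: 'a measure)) = (\<Pi>\<^sub>E i\<in>UNIV. box (l $ i) (u $ i))"
    by (auto simp: space_PiM mem_box Basis_vec_def inner_axis PiE_def Pi_def; blast?)
  hence "emeasure (distr (\<Pi>\<^sub>M i\<in>UNIV. lborel) borel vec_lambda) (box l u) = (\<Prod>i\<in>(UNIV::'n set). emeasure lborel (box (l $ i) (u $ i)))"
    by (subst emeasure_distr[OF m]) (simp_all add: measure_times)
  also have "\<dots> = (\<Prod>i\<in>(UNIV::'n set). ennreal (\<Prod>c\<in>Basis. (u $ i - l $ i) \<bullet> c))"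
    using le by (intro prod.cong refl) (simp add: emeasure_lborel_box)
  also have "\<dots> = ennreal (\<Prod>i\<in>(UNIV::'n set). \<Prod>c\<in>Basis. (u $ i - l $ i) \<bullet> c)"
    by (rule prod_ennreal) (intro prod_nonneg, auto simp: inner_diff_left le)
  also have "(\<Prod>i\<in>(UNIV::'n set). \<Prod>c\<in>Basis. (u $ i - l $ i) \<bullet> c) = (\<Prod>b\<in>Basis. (u - l) \<bullet> b)"
  proof -
    have B: "(Basis::('a^'n) set) = (\<lambda>(i,c). axis i c) ` (UNIV \<times> Basis)" by (auto simp: Basis_vec_def)
    have "inj_on (\<lambda>(i::'n,c::'a). axis i c) (UNIV \<times> Basis)"
      by (auto simp: inj_on_def axis_eq_axis nonzero_Basis)
    hence "(\<Prod>b\<in>(Basis::('a^'n) set). (u - l) \<bullet> b) = (\<Prod>(i,c)\<in>UNIV\<times>Basis. (u - l) \<bullet> axis i c)"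
      unfolding B by (subst prod.reindex) (auto simp: case_prod_beta o_def)
    thus ?thesis by (simp add: prod.cartesian_product inner_axis)
  qed
  finally show "emeasure (distr (\<Pi>\<^sub>M i\<in>UNIV. lborel) borel vec_lambda) (box l u) = (\<Prod>b\<in>Basis. (u - l) \<bullet> b)" by simp
qed simp

lemma sets_PiM_lborel: "sets (\<Pi>\<^sub>M i\<in>I. (lborel :: 'a::euclidean_space measure)) = sets (\<Pi>\<^sub>M i\<in>I. borel)"
  by (rule sets_PiM_cong) auto

text \<open>\<open>lborel\<close> and \<open>borel\<close> are different measures with the same
  sets; normalising to \<open>borel\<close> lets the measurability facts for \<open>borel\<close>
  apply inside product integrals.\<close>

lemma measurable_PiM_lborel [simp]:
  "measurable (\<Pi>\<^sub>M i\<in>I. (lborel :: 'a::euclidean_space measure)) N = measurable (\<Pi>\<^sub>M i\<in>I. borel) N"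
  by (rule measurable_cong_sets) (auto simp: sets_PiM_lborel)

lemma vec_lambda_upd_measurable:
  fixes f :: "'a::euclidean_space^'n::finite \<Rightarrow> ennreal"
  assumes [measurable]: "f \<in> borel_measurable borel"
  shows "(\<lambda>p. f (vec_lambda p)) \<in> borel_measurable (\<Pi>\<^sub>M j\<in>insert i (UNIV - {i}). lborel)"
proof -
  have "insert i (UNIV - {i}) = UNIV" by auto
  thus ?thesis by simp
qed

text \<open>Both orders occur: with coordinate i inside for shears and for the kernel estimate, with
  coordinate i outside to push a density forward to that coordinate.\<close>

lemma nn_integral_vec_split:
  fixes f :: "'a::euclidean_space^'n::finite \<Rightarrow> ennreal"
  assumes [measurable]: "f \<in> borel_measurable borel"
  shows "(\<integral>\<^sup>+w. f w \<partial>lborel) = (\<integral>\<^sup>+p. (\<integral>\<^sup>+t. f (vec_lambda (p(i := t))) \<partial>lborel) \<partial>(\<Pi>\<^sub>M j\<in>UNIV - {i}. lborel))"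
    and "(\<integral>\<^sup>+w. f w \<partial>lborel) = (\<integral>\<^sup>+t. (\<integral>\<^sup>+p. f (vec_lambda (p(i := t))) \<partial>(\<Pi>\<^sub>M j\<in>UNIV - {i}. lborel)) \<partial>lborel)"
proof -
  interpret product_sigma_finite "\<lambda>i::'n. (lborel :: 'a measure)" ..
  have U: "insert i (UNIV - {i}) = UNIV" by auto
  have *: "(\<integral>\<^sup>+w. f w \<partial>lborel) = (\<integral>\<^sup>+p. f (vec_lambda p) \<partial>(\<Pi>\<^sub>M j\<in>insert i (UNIV - {i}). lborel))"
    unfolding U by (subst lborel_vec, subst nn_integral_distr) auto
  show "(\<integral>\<^sup>+w. f w \<partial>lborel) = (\<integral>\<^sup>+p. (\<integral>\<^sup>+t. f (vec_lambda (p(i := t))) \<partial>lborel) \<partial>(\<Pi>\<^sub>M j\<in>UNIV - {i}. lborel))"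
    unfolding * by (rule product_nn_integral_insert) (use vec_lambda_upd_measurable[OF assms] in auto)
  show "(\<integral>\<^sup>+w. f w \<partial>lborel) = (\<integral>\<^sup>+t. (\<integral>\<^sup>+p. f (vec_lambda (p(i := t))) \<partial>(\<Pi>\<^sub>M j\<in>UNIV - {i}. lborel)) \<partial>lborel)"
    unfolding * by (rule product_nn_integral_insert_rev) (use vec_lambda_upd_measurable[OF assms] in auto)
qed

lemma vec_lambda_upd_add: "vec_lambda (p(i := s + t)) = vec_lambda (p(i := s)) + axis i (t::'a::euclidean_space)"
  by (simp add: vec_eq_iff axis_def)

lemma axis_measurable [measurable]: "axis i \<in> (borel :: 'a::euclidean_space measure) \<rightarrow>\<^sub>M (borel :: ('a^'n::finite) measure)"
proof (rule borel_measurable_continuous_onI, rule linear_continuous_on)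
  have "linear (axis i :: 'a \<Rightarrow> 'a^'n)" by (rule linearI) (auto simp: axis_def vec_eq_iff)
  thus "bounded_linear (axis i :: 'a \<Rightarrow> 'a^'n)" by (simp add: linear_conv_bounded_linear)
qed

lemma vec_nth_measurable [measurable (raw)]:
  fixes f :: "'b \<Rightarrow> 'a::euclidean_space^'n::finite"
  assumes "f \<in> borel_measurable M"
  shows "(\<lambda>x. f x $ i) \<in> borel_measurable M"
  by (rule measurable_compose[OF assms borel_measurable_continuous_onI]) (intro continuous_intros)

text \<open>For fixed values of the other coordinates the map translates coordinate i by a constant,
  so Fubini and translation invariance suffice. No Jacobian is computed, and \<open>q\<close> need
  only be measurable.\<close>

lemma lborel_distr_shear:
  fixes q :: "'a::euclidean_space^'n::finite \<Rightarrow> 'a"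
  assumes [measurable]: "q \<in> borel_measurable borel" and q: "\<And>w t. q (w + axis i t) = q w"
  shows "distr lborel borel (\<lambda>w. w + axis i (q w)) = lborel"
proof (rule measure_eqI)
  fix A assume "A \<in> sets (distr lborel borel (\<lambda>w. w + axis i (q w)))"
  hence A[measurable]: "A \<in> sets borel" by simp
  have "emeasure (distr lborel borel (\<lambda>w. w + axis i (q w))) A = (\<integral>\<^sup>+w. indicator A w \<partial>distr lborel borel (\<lambda>w. w + axis i (q w)))"
    by (subst nn_integral_indicator) auto
  also have "\<dots> = (\<integral>\<^sup>+w. indicator A (w + axis i (q w)) \<partial>lborel)"
    by (subst nn_integral_distr) auto
  also have "\<dots> = (\<integral>\<^sup>+p. (\<integral>\<^sup>+t. indicator A (vec_lambda (p(i := t)) + axis i (q (vec_lambda (p(i := t))))) \<partial>lborel) \<partial>(\<Pi>\<^sub>M j\<in>UNIV - {i}. lborel))"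
    by (rule nn_integral_vec_split) measurable
  also have "\<dots> = (\<integral>\<^sup>+p. (\<integral>\<^sup>+t. indicator A (vec_lambda (p(i := t))) \<partial>lborel) \<partial>(\<Pi>\<^sub>M j\<in>UNIV - {i}. lborel))"
  proof (rule nn_integral_cong)
    fix p :: "'n \<Rightarrow> 'a"
    define c where "c = q (vec_lambda (p(i := 0)))"
    have e: "vec_lambda (p(i := t)) = vec_lambda (p(i := 0)) + axis i t" for t
      using vec_lambda_upd_add[of p i 0 t] by simp
    have "q (vec_lambda (p(i := t))) = c" for t
      unfolding c_def by (subst e) (rule q)
    hence "(\<integral>\<^sup>+t. indicator A (vec_lambda (p(i := t)) + axis i (q (vec_lambda (p(i := t))))) \<partial>lborel)
        = (\<integral>\<^sup>+t. indicator A (vec_lambda (p(i := 0)) + axis i (t + c)) \<partial>lborel)"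
      by (intro nn_integral_cong) (metis e vec_lambda_upd_add)
    also have "\<dots> = (\<integral>\<^sup>+t. indicator A (vec_lambda (p(i := 0)) + axis i t) \<partial>lborel)"
      by (rule nn_integral_lborel_translate) measurable
    finally show "(\<integral>\<^sup>+t. indicator A (vec_lambda (p(i := t)) + axis i (q (vec_lambda (p(i := t))))) \<partial>lborel)
       = (\<integral>\<^sup>+t. indicator A (vec_lambda (p(i := t))) \<partial>lborel)" by (simp flip: e)
  qed
  also have "\<dots> = (\<integral>\<^sup>+w. indicator A w \<partial>lborel)"
    by (rule nn_integral_vec_split[symmetric]) measurable
  finally show "emeasure (distr lborel borel (\<lambda>w. w + axis i (q w))) A = emeasure lborel A" by simp
qed simp

section \<open>Integrating out complex variables against powers of a positive part\<close>

lemma distr_norm_square_complex: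
  "distr lborel borel (\<lambda>w::complex. (cmod w)\<^sup>2) = density lborel (\<lambda>t. ennreal pi * indicator {0..} t)" (is "?M = ?N")
proof (rule measure_eqI_generator_eq[where E = "range atMost" and \<Omega> = UNIV and A = "\<lambda>i. {..real i}"])
  show "Int_stable (range (atMost :: real \<Rightarrow> real set))" by (auto simp: Int_stable_def)
  \<comment> \<open>A disc of radius sqrt a has area pi a, so the distribution function of |w|^2 is
    linear on the positive half-line.\<close>
  have M: "emeasure ?M {..a} = ennreal (pi * max 0 a)" for a
  proof (cases "a \<ge> 0")
    case True
    have "(\<lambda>w::complex. (cmod w)\<^sup>2) -` {..a} = cball 0 (sqrt a)"
      using True by (auto simp: real_le_rsqrt) (metis norm_ge_zero power_mono real_sqrt_pow2)
    hence "emeasure ?M {..a} = emeasure lborel (cball (0::complex) (sqrt a))" by (simp add: emeasure_distr)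
    also have "\<dots> = ennreal (pi * sqrt a ^ 2)"
      using True by (subst emeasure_cball) (auto simp: unit_ball_vol_2)
    finally show ?thesis using True by simp
  next
    case False
    hence "(\<lambda>w::complex. (cmod w)\<^sup>2) -` {..a} = {}" by (auto simp: not_le) (smt (verit) zero_le_power2)
    thus ?thesis using False by (simp add: emeasure_distr)
  qed
  have N: "emeasure ?N {..a} = ennreal (pi * max 0 a)" for a
  proof -
    have "emeasure ?N {..a} = (\<integral>\<^sup>+t. ennreal pi * indicator {0..a} t \<partial>lborel)"
      by (subst emeasure_density) (auto intro!: nn_integral_cong split: split_indicator)
    hence "emeasure ?N {..a} = ennreal pi * emeasure lborel {0..a}"
      by (simp add: nn_integral_cmult)
    thus ?thesis by (auto simp: ennreal_mult max_def)
  qed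
  show "emeasure ?M X = emeasure ?N X" if "X \<in> range atMost" for X using that M N by auto
  show "emeasure ?M {..real i} \<noteq> \<infinity>" for i using M by simp
  show "(\<Union>i. {..real i}) = UNIV" by (auto simp: real_arch_simple)
  show "sets ?M = sigma_sets UNIV (range atMost)" by (simp add: borel_eq_atMost image_def)
  show "sets ?N = sigma_sets UNIV (range atMost)" by (simp add: borel_eq_atMost image_def)
qed auto

text \<open>The powers of the positive part; at negative arguments \<^const>\<open>powr\<close> would not vanish.\<close>

definition pos_powr :: "real \<Rightarrow> real \<Rightarrow> real" where
  "pos_powr x b = (if x > 0 then x powr b else 0)"

lemma pos_powr_nonneg [simp]: "pos_powr x b \<ge> 0" by (simp add: pos_powr_def)

lemma pos_powr_measurable [measurable]: "(\<lambda>x. pos_powr x b) \<in> borel_measurable borel"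
  unfolding pos_powr_def by measurable

lemma nn_integral_powr_0_b:
  assumes "b > -1" "Y \<ge> 0"
  shows "(\<integral>\<^sup>+s. ennreal (indicator {..Y} s * pos_powr s b) \<partial>lborel) = ennreal (Y powr (b + 1) / (b + 1))"
proof -
  have "((\<lambda>s. s powr b) has_integral (Y powr (b + 1) / (b + 1))) {0..Y}"
    using has_integral_powr_from_0[of b Y] assms by simp
  hence "((\<lambda>s. pos_powr s b) has_integral (Y powr (b + 1) / (b + 1))) {0..Y}"
    by (rule has_integral_spike[OF negligible_sing[of 0], rotated]) (auto simp: pos_powr_def)
  from nn_integral_has_integral_lebesgue[OF _ this]
  have "(\<integral>\<^sup>+s. ennreal (indicator {0..Y} s * pos_powr s b) \<partial>lborel) = ennreal (Y powr (b + 1) / (b + 1))" by simp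
  moreover have "indicator {0..Y} s * pos_powr s b = indicator {..Y} s * pos_powr s b" for s
    by (auto simp: pos_powr_def split: split_indicator)
  ultimately show ?thesis by simp
qed

text \<open>The factor pi is the density of |w|^2, the factor 2 comes from the substitution t = 2 Y
  - 2 s. Each complex variable that is integrated out raises the exponent by one.\<close>

lemma nn_integral_complex_pos_powr:
  assumes b: "b > -1"
  shows "(\<integral>\<^sup>+w. ennreal (pos_powr (Y - (cmod w)\<^sup>2 / 2) b) \<partial>lborel) = ennreal (2 * pi / (b + 1) * pos_powr Y (b + 1))"
proof -
  have "(\<integral>\<^sup>+w. ennreal (pos_powr (Y - (cmod w)\<^sup>2 / 2) b) \<partial>lborel)
     = (\<integral>\<^sup>+t. ennreal (pos_powr (Y - t / 2) b) \<partial>distr lborel borel (\<lambda>w::complex. (cmod w)\<^sup>2))"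
    by (subst nn_integral_distr) auto
  also have "\<dots> = (\<integral>\<^sup>+t. ennreal pi * ennreal (indicator {0..} t * pos_powr (Y - t / 2) b) \<partial>lborel)"
    by (subst distr_norm_square_complex, subst nn_integral_density)
       (auto intro!: nn_integral_cong split: split_indicator)
  also have "\<dots> = ennreal pi * (\<integral>\<^sup>+t. ennreal (indicator {0..} t * pos_powr (Y - t / 2) b) \<partial>lborel)"
    by (rule nn_integral_cmult) auto
  also have "(\<integral>\<^sup>+t. ennreal (indicator {0..} t * pos_powr (Y - t / 2) b) \<partial>lborel)
      = 2 * (\<integral>\<^sup>+s. ennreal (indicator {0..} (2 * Y + (-2) * s) * pos_powr (Y - (2 * Y + (-2) * s) / 2) b) \<partial>lborel)"
    by (subst nn_integral_real_affine[where c = "-2" and t = "2 * Y"]) auto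
  also have "(\<lambda>s. ennreal (indicator {0..} (2 * Y + (-2) * s) * pos_powr (Y - (2 * Y + (-2) * s) / 2) b))
      = (\<lambda>s. ennreal (indicator {..Y} s * pos_powr s b))"
    by (auto simp: fun_eq_iff diff_divide_distrib split: split_indicator)
  finally have *: "(\<integral>\<^sup>+w. ennreal (pos_powr (Y - (cmod w)\<^sup>2 / 2) b) \<partial>lborel)
      = ennreal pi * (2 * (\<integral>\<^sup>+s. ennreal (indicator {..Y} s * pos_powr s b) \<partial>lborel))" .
  show ?thesis
  proof (cases "Y > 0")
    case True
    thus ?thesis unfolding * using b
      by (subst nn_integral_powr_0_b) (auto simp: pos_powr_def ennreal_mult'[symmetric] ennreal_numeral[symmetric] simp del: ennreal_numeral)
  next
    case False
    hence "(\<lambda>s. ennreal (indicator {..Y} s * pos_powr s b)) = (\<lambda>_. 0)"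
      by (auto simp: pos_powr_def split: split_indicator)
    thus ?thesis unfolding * using False by (simp add: pos_powr_def)
  qed
qed

text \<open>One variable at a time: the factors 2 pi / (b + 1), 2 pi / (b + 2), ... combine to the
  quotient of Gamma values. Since each step moves b to b + 1, the induction has to be for arbitrary
  b.\<close>

lemma nn_integral_PiM_pos_powr:
  fixes I :: "'i set"
  assumes "finite I" "b > -1"
  shows "(\<integral>\<^sup>+p. ennreal (pos_powr (Y - (\<Sum>i\<in>I. (cmod (p i))\<^sup>2) / 2) b) \<partial>(\<Pi>\<^sub>M i\<in>I. lborel))
     = ennreal ((2 * pi) ^ card I * Gamma (b + 1) / Gamma (b + 1 + card I) * pos_powr Y (b + card I))"
  using assms
proof (induction I arbitrary: b rule: finite_induct)
  case empty
  hence "b + 1 > 0" by simp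
  hence "Gamma (b + 1) \<noteq> 0" using Gamma_real_pos[of "b + 1"] by linarith
  thus ?case by (simp add: PiM_empty nn_integral_count_space_finite)
next
  case (insert i I)
  interpret product_sigma_finite "\<lambda>i::'i. (lborel :: complex measure)" ..
  have "(\<integral>\<^sup>+p. ennreal (pos_powr (Y - (\<Sum>j\<in>insert i I. (cmod (p j))\<^sup>2) / 2) b) \<partial>(\<Pi>\<^sub>M i\<in>insert i I. lborel))
    = (\<integral>\<^sup>+p. (\<integral>\<^sup>+w. ennreal (pos_powr (Y - (\<Sum>j\<in>insert i I. (cmod ((p(i := w)) j))\<^sup>2) / 2) b) \<partial>lborel) \<partial>(\<Pi>\<^sub>M i\<in>I. lborel))"
    using insert by (intro product_nn_integral_insert) (auto simp del: sum.insert)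
  also have "\<dots> = (\<integral>\<^sup>+p. ennreal (2 * pi / (b + 1)) * ennreal (pos_powr (Y - (\<Sum>j\<in>I. (cmod (p j))\<^sup>2) / 2) (b + 1)) \<partial>(\<Pi>\<^sub>M i\<in>I. lborel))"
  proof (rule nn_integral_cong)
    fix p :: "'i \<Rightarrow> complex"
    have "(\<Sum>j\<in>insert i I. (cmod ((p(i := w)) j))\<^sup>2) = (cmod w)\<^sup>2 + (\<Sum>j\<in>I. (cmod (p j))\<^sup>2)" for w
      using insert by (auto intro!: sum.cong)
    hence "(\<integral>\<^sup>+w. ennreal (pos_powr (Y - (\<Sum>j\<in>insert i I. (cmod ((p(i := w)) j))\<^sup>2) / 2) b) \<partial>lborel)
      = (\<integral>\<^sup>+w. ennreal (pos_powr ((Y - (\<Sum>j\<in>I. (cmod (p j))\<^sup>2) / 2) - (cmod w)\<^sup>2 / 2) b) \<partial>lborel)"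
      by (simp add: add_divide_distrib algebra_simps)
    thus "(\<integral>\<^sup>+w. ennreal (pos_powr (Y - (\<Sum>j\<in>insert i I. (cmod ((p(i := w)) j))\<^sup>2) / 2) b) \<partial>lborel)
      = ennreal (2 * pi / (b + 1)) * ennreal (pos_powr (Y - (\<Sum>j\<in>I. (cmod (p j))\<^sup>2) / 2) (b + 1))"
      using insert.prems nn_integral_complex_pos_powr[of b] by (simp add: ennreal_mult'[symmetric])
  qed
  also have "\<dots> = ennreal (2 * pi / (b + 1)) * (\<integral>\<^sup>+p. ennreal (pos_powr (Y - (\<Sum>j\<in>I. (cmod (p j))\<^sup>2) / 2) (b + 1)) \<partial>(\<Pi>\<^sub>M i\<in>I. lborel))"
    by (rule nn_integral_cmult) auto
  also have "\<dots> = ennreal (2 * pi / (b + 1)) * ennreal ((2 * pi) ^ card I * Gamma (b + 2) / Gamma (b + 2 + card I) * pos_powr Y (b + 1 + card I))"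
    using insert.IH[of "b + 1"] insert.prems by (simp add: add.assoc)
  also have "\<dots> = ennreal ((2 * pi) ^ card (insert i I) * Gamma (b + 1) / Gamma (b + 1 + card (insert i I)) * pos_powr Y (b + card (insert i I)))"
  proof -
    have G: "Gamma (b + 2) = (b + 1) * Gamma (b + 1)"
      using Gamma_plus1[of "b + 1"] insert.prems by (simp add: nonpos_Ints_def add.commute)
    show ?thesis using insert.prems insert.hyps
      by (subst ennreal_mult'[symmetric]) (auto simp: G add_ac)
  qed
  finally show ?case .
qed

text \<open>The fibre over t contributes the integral just computed, with Y = Im t. Thus the weight
  with exponent b on the Siegel domain becomes the weight with exponent b + m on the half-plane,
  which is how the reproducing formula in n variables is reduced to one variable.\<close>

lemma distr_density_pos_powr:
  fixes i :: "'n::finite"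
  assumes b: "b > -1"
  defines "m \<equiv> card (UNIV - {i})"
  shows "distr (density lborel (\<lambda>w::complex^'n. ennreal (pos_powr (Im (w $ i) - (\<Sum>j\<in>UNIV - {i}. (cmod (w $ j))\<^sup>2) / 2) b))) borel (\<lambda>w. w $ i)
     = density lborel (\<lambda>t. ennreal ((2 * pi) ^ m * Gamma (b + 1) / Gamma (b + 1 + m) * pos_powr (Im t) (b + m)))"
    (is "distr (density lborel ?d) borel _ = density lborel ?e")
proof (rule measure_eqI)
  fix A assume "A \<in> sets (distr (density lborel ?d) borel (\<lambda>w. w $ i))"
  hence A[measurable]: "A \<in> sets borel" by simp
  have "emeasure (distr (density lborel ?d) borel (\<lambda>w. w $ i)) A = (\<integral>\<^sup>+w. indicator A w \<partial>distr (density lborel ?d) borel (\<lambda>w. w $ i))"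
    by (subst nn_integral_indicator) auto
  also have "\<dots> = (\<integral>\<^sup>+w. ?d w * indicator A (w $ i) \<partial>lborel)"
    by (subst nn_integral_distr) (auto simp: nn_integral_density)
  also have "\<dots> = (\<integral>\<^sup>+t. (\<integral>\<^sup>+p. ?d (vec_lambda (p(i := t))) * indicator A (vec_lambda (p(i := t)) $ i) \<partial>(\<Pi>\<^sub>M j\<in>UNIV - {i}. lborel)) \<partial>lborel)"
    by (rule nn_integral_vec_split) measurable
  also have "\<dots> = (\<integral>\<^sup>+t. ?e t * indicator A t \<partial>lborel)"
  proof (rule nn_integral_cong)
    fix t :: complex
    have "(\<Sum>j\<in>UNIV - {i}. (cmod (vec_lambda (p(i := t)) $ j))\<^sup>2) = (\<Sum>j\<in>UNIV - {i}. (cmod (p j))\<^sup>2)" for p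
      by (rule sum.cong) auto
    hence "(\<integral>\<^sup>+p. ?d (vec_lambda (p(i := t))) * indicator A (vec_lambda (p(i := t)) $ i) \<partial>(\<Pi>\<^sub>M j\<in>UNIV - {i}. lborel))
       = (\<integral>\<^sup>+p. ennreal (pos_powr (Im t - (\<Sum>j\<in>UNIV - {i}. (cmod (p j))\<^sup>2) / 2) b) * indicator A t \<partial>(\<Pi>\<^sub>M j\<in>UNIV - {i}. lborel))"
      by simp
    also have "\<dots> = (\<integral>\<^sup>+p. ennreal (pos_powr (Im t - (\<Sum>j\<in>UNIV - {i}. (cmod (p j))\<^sup>2) / 2) b) \<partial>(\<Pi>\<^sub>M j\<in>UNIV - {i}. lborel)) * indicator A t"
      by (rule nn_integral_multc) auto
    finally show "(\<integral>\<^sup>+p. ?d (vec_lambda (p(i := t))) * indicator A (vec_lambda (p(i := t)) $ i) \<partial>(\<Pi>\<^sub>M j\<in>UNIV - {i}. lborel)) = ?e t * indicator A t"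
      using nn_integral_PiM_pos_powr[of "UNIV - {i}" b "Im t"] b by (simp add: m_def)
  qed
  also have "\<dots> = emeasure (density lborel ?e) A"
    by (subst emeasure_density) auto
  finally show "emeasure (distr (density lborel ?d) borel (\<lambda>w. w $ i)) A = emeasure (density lborel ?e) A" .
qed simp

section \<open>Fubini for real and imaginary parts\<close>

lemma Complex_measurable [measurable]: "(\<lambda>(x, y). Complex x y) \<in> borel_measurable borel"
  unfolding borel_prod[symmetric] Complex_eq case_prod_beta by measurable

lemma Complex_measurable' [measurable (raw)]:
  assumes "f \<in> borel_measurable M" "g \<in> borel_measurable M"
  shows "(\<lambda>x. Complex (f x) (g x)) \<in> borel_measurable M"
  unfolding Complex_eq using assms by measurable

lemma lborel_complex: "(lborel :: complex measure) = distr (lborel \<Otimes>\<^sub>M lborel) borel (\<lambda>(x, y). Complex x y)"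
proof (rule lborel_eqI)
  fix l u :: complex assume lu: "\<And>b. b \<in> Basis \<Longrightarrow> l \<bullet> b \<le> u \<bullet> b"
  have le: "Re l \<le> Re u" "Im l \<le> Im u" using lu[of 1] lu[of \<i>] by (auto simp: Basis_complex_def)
  have m: "(\<lambda>(x, y). Complex x y) \<in> borel_measurable (lborel \<Otimes>\<^sub>M lborel)"
    by (simp add: lborel_prod)
  have "(\<lambda>(x, y). Complex x y) -` box l u = {Re l<..<Re u} \<times> {Im l<..<Im u}"
    by (auto simp: mem_box Basis_complex_def)
  hence "emeasure (distr (lborel \<Otimes>\<^sub>M lborel) borel (\<lambda>(x, y). Complex x y)) (box l u)
      = ennreal (Re u - Re l) * ennreal (Im u - Im l)"
    using le by (subst emeasure_distr[OF m]) (auto simp: space_pair_measure lborel.emeasure_pair_measure_Times)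
  thus "emeasure (distr (lborel \<Otimes>\<^sub>M lborel) borel (\<lambda>(x, y). Complex x y)) (box l u) = ennreal (\<Prod>b\<in>Basis. (u - l) \<bullet> b)"
    using le by (simp add: Basis_complex_def ennreal_mult inner_diff_left)
qed simp

lemma nn_integral_complex_split:
  fixes f :: "complex \<Rightarrow> ennreal"
  assumes [measurable]: "f \<in> borel_measurable borel"
  shows "(\<integral>\<^sup>+w. f w \<partial>lborel) = (\<integral>\<^sup>+x. (\<integral>\<^sup>+y. f (Complex x y) \<partial>lborel) \<partial>lborel)"
proof -
  have "(\<integral>\<^sup>+w. f w \<partial>lborel) = (\<integral>\<^sup>+z. f (Complex (fst z) (snd z)) \<partial>(lborel \<Otimes>\<^sub>M lborel))"
    by (subst lborel_complex, subst nn_integral_distr) (auto simp: lborel_prod case_prod_beta)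
  also have "\<dots> = (\<integral>\<^sup>+x. (\<integral>\<^sup>+y. f (Complex x y) \<partial>lborel) \<partial>lborel)"
    by (subst lborel.nn_integral_fst[symmetric]) auto
  finally show ?thesis .
qed

subsection \<open>Integrals of powers of the kernel\<close>

lemma nn_integral_abs_powr:
  fixes r p m :: real
  assumes r: "r > 0" and p: "p > 1"
  shows "(\<integral>\<^sup>+x. ennreal ((r + \<bar>x - m\<bar>) powr (- p)) \<partial>lborel) \<le> ennreal (2 / (p - 1) * r powr (1 - p))"
proof -
  define F where "F x = - ((r + x) powr (1 - p)) / (p - 1)" for x
  have half: "(\<integral>\<^sup>+x. ennreal ((r + \<bar>x\<bar>) powr (- p)) * indicator {0..} x \<partial>lborel) = ennreal (r powr (1 - p) / (p - 1))"
  proof -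
    have "(F \<longlongrightarrow> 0) at_top"
    proof -
      have "((\<lambda>x. (r + x) powr (1 - p)) \<longlongrightarrow> 0) at_top"
        using p by (intro tendsto_neg_powr filterlim_tendsto_add_at_top[OF tendsto_const] filterlim_ident) auto
      from tendsto_divide[OF tendsto_minus[OF this] tendsto_const[of "p - 1"]] show ?thesis
        using p by (simp add: F_def[abs_def])
    qed
    moreover have "DERIV F x :> (r + x) powr (- p)" if "0 \<le> x" for x
    proof -
      have "((\<lambda>x. (r + x) powr (1 - p)) has_real_derivative (1 - p) * (r + x) powr (- p)) (at x)"
        using p r that by (auto intro!: derivative_eq_intros)
      from DERIV_cmult[OF this, of "- 1 / (p - 1)"] have "DERIV F x :> - 1 / (p - 1) * ((1 - p) * (r + x) powr (- p))"
        by (simp add: F_def[abs_def])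
      also have "- 1 / (p - 1) * ((1 - p) * (r + x) powr (- p)) = (r + x) powr (- p)"
        using p by (simp add: field_simps)
      finally show ?thesis .
    qed
    ultimately have "(\<integral>\<^sup>+x. ennreal ((r + x) powr (- p)) * indicator {0..} x \<partial>lborel) = ennreal (0 - F 0)"
      by (intro nn_integral_FTC_atLeast) auto
    also have "(\<integral>\<^sup>+x. ennreal ((r + x) powr (- p)) * indicator {0..} x \<partial>lborel)
       = (\<integral>\<^sup>+x. ennreal ((r + \<bar>x\<bar>) powr (- p)) * indicator {0..} x \<partial>lborel)"
      by (rule nn_integral_cong) (auto split: split_indicator)
    finally show ?thesis by (simp add: F_def)
  qed
  define f where "f x = ennreal ((r + \<bar>x\<bar>) powr (- p))" for x
  have [measurable]: "f \<in> borel_measurable borel" by (simp add: f_def[abs_def])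
  have "(\<integral>\<^sup>+x. ennreal ((r + \<bar>x - m\<bar>) powr (- p)) \<partial>lborel) = (\<integral>\<^sup>+x. f x \<partial>lborel)"
    using nn_integral_lborel_translate[of f "- m"] by (simp add: f_def)
  \<comment> \<open>The two closed half-lines share the point 0, hence an inequality; it is all that
    is needed.\<close>
  also have "\<dots> \<le> (\<integral>\<^sup>+x. f x * indicator {0..} x + f (0 - x) * indicator {0..} (0 - x) \<partial>lborel)"
    by (rule nn_integral_mono) (auto simp: f_def split: split_indicator)
  also have "\<dots> = (\<integral>\<^sup>+x. f x * indicator {0..} x \<partial>lborel) + (\<integral>\<^sup>+x. f (0 - x) * indicator {0..} (0 - x) \<partial>lborel)"
    by (rule nn_integral_add) auto
  also have "(\<integral>\<^sup>+x. f (0 - x) * indicator {0..} (0 - x) \<partial>lborel) = (\<integral>\<^sup>+x. f x * indicator {0..} x \<partial>lborel)"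
    by (rule nn_integral_lborel_reflect[where f = "\<lambda>x. f x * indicator {0..} x"]) auto
  also have "(\<integral>\<^sup>+x. f x * indicator {0..} x \<partial>lborel) = ennreal (r powr (1 - p) / (p - 1))"
    using half by (simp add: f_def)
  finally show ?thesis using p by (simp add: ennreal_plus[symmetric] del: ennreal_plus)
qed

text \<open>After translation the integral is cut at t = r: below r the factor
  \<open>(r + t) powr (- q)\<close> is at most \<open>r powr (- q)\<close>, above it is at most
  \<open>t powr (- q)\<close>. Convergence at 0 is a > -1, convergence at infinity is q > a +
  1.\<close>

lemma nn_integral_pos_powr_powr:
  fixes r a q s :: real
  assumes r: "r > 0" and a: "a > -1" and q: "q > a + 1"
  shows "(\<integral>\<^sup>+t. ennreal (pos_powr (t - s) a * (r + (t - s)) powr (- q)) \<partial>lborel)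
     \<le> ennreal ((1 / (a + 1) + 1 / (q - a - 1)) * r powr (a + 1 - q))"
proof -
  define f where "f t = ennreal (pos_powr t a * (r + t) powr (- q))" for t
  have [measurable]: "f \<in> borel_measurable borel" by (simp add: f_def[abs_def])
  have tail: "(\<integral>\<^sup>+t. ennreal (t powr (a - q)) * indicator {r..} t \<partial>lborel) = ennreal (r powr (a + 1 - q) / (q - a - 1))"
  proof -
    define F where "F x = - (x powr (a - q + 1)) / (q - a - 1)" for x :: real
    have "(F \<longlongrightarrow> 0) at_top"
    proof -
      have "((\<lambda>x::real. x powr (a - q + 1)) \<longlongrightarrow> 0) at_top"
        using q by (intro tendsto_neg_powr filterlim_ident) auto
      from tendsto_divide[OF tendsto_minus[OF this] tendsto_const[of "q - a - 1"]] show ?thesis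
        using q by (simp add: F_def[abs_def])
    qed
    moreover have "DERIV F x :> x powr (a - q)" if "r \<le> x" for x
    proof -
      have "((\<lambda>x. x powr (a - q + 1)) has_real_derivative (a - q + 1) * x powr (a - q)) (at x)"
        using q r that by (auto intro!: derivative_eq_intros)
      from DERIV_cmult[OF this, of "- 1 / (q - a - 1)"] have "DERIV F x :> - 1 / (q - a - 1) * ((a - q + 1) * x powr (a - q))"
        by (simp add: F_def[abs_def])
      also have "- 1 / (q - a - 1) * ((a - q + 1) * x powr (a - q)) = x powr (a - q)"
        using q by (simp add: field_simps)
      finally show ?thesis .
    qed
    ultimately have "(\<integral>\<^sup>+t. ennreal (t powr (a - q)) * indicator {r..} t \<partial>lborel) = ennreal (0 - F r)"
      by (intro nn_integral_FTC_atLeast) auto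
    thus ?thesis by (simp add: F_def algebra_simps)
  qed
  have "(\<integral>\<^sup>+t. ennreal (pos_powr (t - s) a * (r + (t - s)) powr (- q)) \<partial>lborel) = (\<integral>\<^sup>+t. f t \<partial>lborel)"
    using nn_integral_lborel_translate[of f "- s"] by (simp add: f_def)
  also have "\<dots> \<le> (\<integral>\<^sup>+t. ennreal (r powr (- q)) * ennreal (indicator {..r} t * pos_powr t a) + ennreal (t powr (a - q)) * indicator {r..} t \<partial>lborel)"
  proof (rule nn_integral_mono)
    fix t :: real
    consider "t \<le> 0" | "0 < t" "t \<le> r" | "t > r" by linarith
    thus "f t \<le> ennreal (r powr (- q)) * ennreal (indicator {..r} t * pos_powr t a) + ennreal (t powr (a - q)) * indicator {r..} t"
    proof cases
      case 1 thus ?thesis by (simp add: f_def pos_powr_def)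
    next
      case 2
      have "pos_powr t a * (r + t) powr (- q) \<le> r powr (- q) * pos_powr t a"
        using 2 r a q by (subst mult.commute, intro mult_right_mono) (auto intro!: powr_mono2')
      hence "f t \<le> ennreal (r powr (- q)) * ennreal (indicator {..r} t * pos_powr t a)"
        using 2 by (simp add: f_def ennreal_mult'[symmetric])
      thus ?thesis by (simp add: add_increasing2)
    next
      case 3
      hence "pos_powr t a * (r + t) powr (- q) \<le> t powr a * t powr (- q)"
        using r a q by (intro mult_mono) (auto intro!: powr_mono2' simp: pos_powr_def)
      also have "\<dots> = t powr (a - q)" by (simp add: powr_add[symmetric])
      finally show ?thesis using 3 by (simp add: f_def)
    qed
  qed
  also have "\<dots> = ennreal (r powr (- q)) * (\<integral>\<^sup>+t. ennreal (indicator {..r} t * pos_powr t a) \<partial>lborel) + (\<integral>\<^sup>+t. ennreal (t powr (a - q)) * indicator {r..} t \<partial>lborel)"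
    by (subst nn_integral_add) (auto simp: nn_integral_cmult)
  also have "\<dots> = ennreal (r powr (- q) * (r powr (a + 1) / (a + 1)) + r powr (a + 1 - q) / (q - a - 1))"
    unfolding tail using nn_integral_powr_0_b[OF a, of r] r a q by (simp add: ennreal_mult'[symmetric] ennreal_plus)
  also have "r powr (- q) * (r powr (a + 1) / (a + 1)) + r powr (a + 1 - q) / (q - a - 1) = (1 / (a + 1) + 1 / (q - a - 1)) * r powr (a + 1 - q)"
    by (simp add: powr_add[symmetric] algebra_simps)
  finally show ?thesis .
qed

lemma nn_integral_half_plane:
  fixes r a q p s m :: real
  assumes r: "r > 0" and a: "a > -1" and q: "q > a + 1" and p: "p > 1"
  shows "(\<integral>\<^sup>+w. ennreal (pos_powr (Im w - s) a * (r + (Im w - s)) powr (- q) * (r + \<bar>Re w - m\<bar>) powr (- p)) \<partial>lborel)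
     \<le> ennreal ((1 / (a + 1) + 1 / (q - a - 1)) * (2 / (p - 1)) * r powr (a + 2 - q - p))"
proof -
  have "(\<integral>\<^sup>+w. ennreal (pos_powr (Im w - s) a * (r + (Im w - s)) powr (- q) * (r + \<bar>Re w - m\<bar>) powr (- p)) \<partial>lborel)
    = (\<integral>\<^sup>+x. (\<integral>\<^sup>+y. ennreal (pos_powr (y - s) a * (r + (y - s)) powr (- q)) * ennreal ((r + \<bar>x - m\<bar>) powr (- p)) \<partial>lborel) \<partial>lborel)"
    by (subst nn_integral_complex_split) (auto simp: ennreal_mult')
  also have "\<dots> = (\<integral>\<^sup>+y. ennreal (pos_powr (y - s) a * (r + (y - s)) powr (- q)) \<partial>lborel) * (\<integral>\<^sup>+x. ennreal ((r + \<bar>x - m\<bar>) powr (- p)) \<partial>lborel)"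
    by (subst nn_integral_multc, simp, subst nn_integral_cmult) auto
  also have "\<dots> \<le> ennreal ((1 / (a + 1) + 1 / (q - a - 1)) * r powr (a + 1 - q)) * ennreal (2 / (p - 1) * r powr (1 - p))"
    by (intro mult_mono nn_integral_abs_powr nn_integral_pos_powr_powr assms) auto
  also have "\<dots> = ennreal ((1 / (a + 1) + 1 / (q - a - 1)) * (2 / (p - 1)) * (r powr (a + 1 - q) * r powr (1 - p)))"
    using assms by (subst ennreal_mult'[symmetric]) (auto simp: mult_ac)
  also have "r powr (a + 1 - q) * r powr (1 - p) = r powr (a + 2 - q - p)"
    by (simp add: powr_add[symmetric] algebra_simps)
  finally show ?thesis .
qed

text \<open>Half of the power is spent on each real coordinate, which bounds the integrand by a
  product of functions of one real variable. With R = sqrt r one has r + x^2 >= (R + |x|)^2 / 2, so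
  each factor is a line integral of size R^(1 - p), and the two together give r^(1 - p).\<close>

lemma nn_integral_plane:
  fixes r p :: real and z :: complex
  assumes r: "r > 0" and p: "p > 1"
  shows "(\<integral>\<^sup>+w. ennreal ((r + (cmod (z - w))\<^sup>2) powr (- p)) \<partial>lborel) \<le> ennreal (2 powr p * (2 / (p - 1))\<^sup>2 * r powr (1 - p))"
proof -
  define R where "R = sqrt r"
  have R: "R > 0" "R\<^sup>2 = r" using r by (auto simp: R_def)
  have one: "(r + x\<^sup>2) powr (- (p/2)) \<le> 2 powr (p/2) * (R + \<bar>x\<bar>) powr (- p)" for x
  proof -
    have "(R + \<bar>x\<bar>)\<^sup>2 / 2 \<le> r + x\<^sup>2"
      using sum_squares_bound[of R "\<bar>x\<bar>"] R by (simp add: power2_eq_square algebra_simps)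
    hence "(r + x\<^sup>2) powr (- (p/2)) \<le> ((R + \<bar>x\<bar>)\<^sup>2 / 2) powr (- (p/2))"
      using R p by (intro powr_mono2') auto
    also have "\<dots> = 2 powr (p/2) * ((R + \<bar>x\<bar>)\<^sup>2) powr (- (p/2))"
      using R by (subst powr_divide) (auto simp: powr_minus field_simps)
    also have "((R + \<bar>x\<bar>)\<^sup>2) powr (- (p/2)) = (R + \<bar>x\<bar>) powr (- p)"
      proof -
      have "(R + \<bar>x\<bar>)\<^sup>2 = (R + \<bar>x\<bar>) powr 2" using R by simp
      thus ?thesis by (simp only: powr_powr) simp
    qed
    finally show ?thesis .
  qed
  have two: "(r + (cmod (z - Complex x y))\<^sup>2) powr (- p) \<le> 2 powr p * ((R + \<bar>x - Re z\<bar>) powr (- p) * (R + \<bar>y - Im z\<bar>) powr (- p))" for x y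
  proof -
    have A: "(cmod (z - Complex x y))\<^sup>2 = (x - Re z)\<^sup>2 + (y - Im z)\<^sup>2"
      by (simp add: cmod_power2 power2_commute)
    have "(r + (cmod (z - Complex x y))\<^sup>2) powr (- p) = (r + (cmod (z - Complex x y))\<^sup>2) powr (- (p/2)) * (r + (cmod (z - Complex x y))\<^sup>2) powr (- (p/2))"
      by (simp add: powr_add[symmetric])
    also have "\<dots> \<le> (r + (x - Re z)\<^sup>2) powr (- (p/2)) * (r + (y - Im z)\<^sup>2) powr (- (p/2))"
      using r p unfolding A by (intro mult_mono powr_mono2') (auto simp: add_pos_nonneg)
    also have "\<dots> \<le> (2 powr (p/2) * (R + \<bar>x - Re z\<bar>) powr (- p)) * (2 powr (p/2) * (R + \<bar>y - Im z\<bar>) powr (- p))"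
      by (intro mult_mono one) auto
    also have "\<dots> = (2 powr (p/2) * 2 powr (p/2)) * ((R + \<bar>x - Re z\<bar>) powr (- p) * (R + \<bar>y - Im z\<bar>) powr (- p))"
      by (simp only: mult_ac)
    finally show ?thesis by (simp add: powr_add[symmetric])
  qed
  have "(\<integral>\<^sup>+w. ennreal ((r + (cmod (z - w))\<^sup>2) powr (- p)) \<partial>lborel)
     = (\<integral>\<^sup>+x. (\<integral>\<^sup>+y. ennreal ((r + (cmod (z - Complex x y))\<^sup>2) powr (- p)) \<partial>lborel) \<partial>lborel)"
    by (subst nn_integral_complex_split) auto
  also have "\<dots> \<le> (\<integral>\<^sup>+x. (\<integral>\<^sup>+y. ennreal (2 powr p * (R + \<bar>x - Re z\<bar>) powr (- p)) * ennreal ((R + \<bar>y - Im z\<bar>) powr (- p)) \<partial>lborel) \<partial>lborel)"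
    by (intro nn_integral_mono) (use two in \<open>auto simp: ennreal_mult'[symmetric] mult.assoc\<close>)
  also have "\<dots> = ennreal (2 powr p) * ((\<integral>\<^sup>+x. ennreal ((R + \<bar>x - Re z\<bar>) powr (- p)) \<partial>lborel) * (\<integral>\<^sup>+y. ennreal ((R + \<bar>y - Im z\<bar>) powr (- p)) \<partial>lborel))"
    by (subst nn_integral_cmult, simp, subst nn_integral_multc, simp) (simp add: ennreal_mult' nn_integral_cmult mult.assoc)
  also have "\<dots> \<le> ennreal (2 powr p) * (ennreal (2 / (p - 1) * R powr (1 - p)) * ennreal (2 / (p - 1) * R powr (1 - p)))"
    by (intro mult_mono nn_integral_abs_powr R p) auto
  also have "\<dots> = ennreal (2 powr p * (2 / (p - 1))\<^sup>2 * (R powr (1 - p) * R powr (1 - p)))"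
    using p by (simp add: ennreal_mult'[symmetric] power2_eq_square mult_ac)
  also have "R powr (1 - p) * R powr (1 - p) = r powr (1 - p)"
    using R by (simp add: powr_mult[symmetric] power2_eq_square)
  finally show ?thesis .
qed

section \<open>The function \<open>rho2\<close> on the tube: real and imaginary part, lower
  bounds\<close>

lemma UNIV_minus_last: "UNIV - {last_idx :: 'n::{finite,linorder}} = {..<last_idx}"
proof -
  have "j \<le> last_idx" for j :: 'n unfolding last_idx_def by simp
  thus ?thesis by (auto simp: less_le)
qed

lemma card_below_last: "real (card {..<last_idx :: 'n::{finite,linorder}}) = real CARD('n) - 1"
proof -
  have "card (UNIV - {last_idx :: 'n}) = CARD('n) - 1" by simp
  thus ?thesis unfolding UNIV_minus_last by (simp add: of_nat_diff Suc_leI)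
qed

lemma tube_iff: "w \<in> tube \<longleftrightarrow> rho w > 0"
  by (auto simp: tube_def rho_def)

lemma rho_measurable [measurable]: "rho \<in> borel_measurable borel"
  unfolding rho_def[abs_def] by measurable

lemma rho2_measurable [measurable]: "rho2 z \<in> borel_measurable borel"
proof -
  have "continuous_on UNIV (rho2 z)" unfolding rho2_def[abs_def] by (intro continuous_intros)
  thus ?thesis by (rule borel_measurable_continuous_onI)
qed

text \<open>Coordinatewise Re ((a - cnj b)^2) = |a - b|^2 - 2 (Im a)^2 - 2 (Im b)^2, and the squares
  of the imaginary parts complete the last coordinates to \<open>rho z\<close> and
  \<open>rho w\<close>. Positivity on the tube and all lower bounds for |rho2| start here.\<close>

lemma Re_rho2: "Re (rho2 z w) = (\<Sum>j\<in>{..<last_idx}. (cmod (z $ j - w $ j))\<^sup>2) / 4 + (rho z + rho w) / 2"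
proof -
  have "Re ((z $ j - cnj (w $ j))\<^sup>2) = (cmod (z $ j - w $ j))\<^sup>2 - 2 * (Im (z $ j))\<^sup>2 - 2 * (Im (w $ j))\<^sup>2" for j
    by (simp only: cmod_power2) (simp add: power2_eq_square algebra_simps)
  hence "Re (\<Sum>j\<in>{..<last_idx}. (z $ j - cnj (w $ j))\<^sup>2) = (\<Sum>j\<in>{..<last_idx}. (cmod (z $ j - w $ j))\<^sup>2)
      - 2 * (\<Sum>j\<in>{..<last_idx}. (Im (z $ j))\<^sup>2) - 2 * (\<Sum>j\<in>{..<last_idx}. (Im (w $ j))\<^sup>2)"
    by (simp only: Re_sum sum_subtractf sum_distrib_left)
  thus ?thesis unfolding rho2_def rho_def by (simp add: field_simps)
qed

lemma Im_rho2: "Im (rho2 z w) = (\<Sum>j\<in>{..<last_idx}. (Re (z $ j) - Re (w $ j)) * (Im (z $ j) + Im (w $ j))) / 2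
    - (Re (z $ last_idx) - Re (w $ last_idx)) / 2"
proof -
  have "Im ((z $ j - cnj (w $ j))\<^sup>2) = 2 * ((Re (z $ j) - Re (w $ j)) * (Im (z $ j) + Im (w $ j)))" for j
    by (simp add: power2_eq_square algebra_simps)
  hence "Im (\<Sum>j\<in>{..<last_idx}. (z $ j - cnj (w $ j))\<^sup>2) = 2 * (\<Sum>j\<in>{..<last_idx}. (Re (z $ j) - Re (w $ j)) * (Im (z $ j) + Im (w $ j)))"
    by (simp only: Im_sum sum_distrib_left)
  thus ?thesis unfolding rho2_def by (simp add: field_simps)
qed

lemma Re_rho2_pos: "z \<in> tube \<Longrightarrow> w \<in> tube \<Longrightarrow> Re (rho2 z w) > 0"
  unfolding Re_rho2 tube_iff by (intro add_nonneg_pos) (auto intro: sum_nonneg)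

text \<open>Each bound keeps \<open>rho z\<close> and one further quantity. The first two come from
  the real part alone; the third combines it with the imaginary part. The centre for Re w_n in the
  third bound depends on w' but not on w_n, so it is a mere translation when w_n is integrated
  first.\<close>

lemma rho2_bounds:
  assumes z: "z \<in> tube" and w: "w \<in> tube"
  shows "cmod (rho2 z w) \<ge> (rho z + rho w) / 4"
    and "j < last_idx \<Longrightarrow> cmod (rho2 z w) \<ge> (rho z + (cmod (z $ j - w $ j))\<^sup>2) / 4"
    and "cmod (rho2 z w) \<ge> (rho z + \<bar>Re (w $ last_idx) - (Re (z $ last_idx)
        - (\<Sum>j\<in>{..<last_idx}. (Re (z $ j) - Re (w $ j)) * (Im (z $ j) + Im (w $ j))))\<bar>) / 4"
proof -
  have pos: "rho z > 0" "rho w > 0" using z w by (auto simp: tube_iff)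
  have re: "Re (rho2 z w) \<le> cmod (rho2 z w)" "\<bar>Im (rho2 z w)\<bar> \<le> cmod (rho2 z w)"
    by (auto simp: complex_Re_le_cmod abs_Im_le_cmod)
  have s: "(\<Sum>j\<in>{..<last_idx}. (cmod (z $ j - w $ j))\<^sup>2) \<ge> 0" by (intro sum_nonneg) auto
  show "cmod (rho2 z w) \<ge> (rho z + rho w) / 4"
    using re(1) s pos unfolding Re_rho2 by argo
  show "cmod (rho2 z w) \<ge> (rho z + (cmod (z $ j - w $ j))\<^sup>2) / 4" if "j < last_idx"
  proof -
    have "(cmod (z $ j - w $ j))\<^sup>2 \<le> (\<Sum>j\<in>{..<last_idx}. (cmod (z $ j - w $ j))\<^sup>2)"
      using that by (intro member_le_sum) auto
    thus ?thesis using re(1) pos unfolding Re_rho2 by argo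
  qed
  show "cmod (rho2 z w) \<ge> (rho z + \<bar>Re (w $ last_idx) - (Re (z $ last_idx)
        - (\<Sum>j\<in>{..<last_idx}. (Re (z $ j) - Re (w $ j)) * (Im (z $ j) + Im (w $ j))))\<bar>) / 4"
    using re s pos unfolding Re_rho2 Im_rho2 by argo
qed

text \<open>The kernel estimate factors: a power of \<open>|\<rho>(z,w)|\<close> is split into pieces, each of which sees only one
  of the coordinates.\<close>

lemma tube_integral_bound:
  assumes a: "a > -1" and s: "s > 0"
  obtains C where "C \<ge> 0" "\<And>z :: complex^'n::{finite,linorder}. z \<in> tube \<Longrightarrow>
     (\<integral>\<^sup>+w. ennreal (pos_powr (rho w) a * cmod (rho2 z w) powr (- (real CARD('n) + 1 + a + s))) \<partial>lborel)
       \<le> ennreal (C * rho z powr (- s))"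
proof -
  \<comment> \<open>The excess s is shared equally by n + 1 factors: q for the height, p for the
    real part of the last coordinate and for each of the n - 1 others. Each lies above its critical
    exponent by \<sigma>, and n p + q = N.\<close>
  define \<sigma> where "\<sigma> = s / (real CARD('n) + 1)"
  define p where "p = 1 + \<sigma>"
  define q where "q = a + 1 + \<sigma>"
  define N where "N = real CARD('n) + 1 + a + s"
  have \<sigma>: "\<sigma> > 0" using s by (simp add: \<sigma>_def)
  have pq: "p > 1" "q > a + 1" "q > 0" using \<sigma> a by (auto simp: p_def q_def)
  have \<sigma>n: "(real CARD('n) + 1) * \<sigma> = s" by (simp add: \<sigma>_def add_pos_pos)
  let ?I = "{..<last_idx :: 'n}"
  have N: "N = real CARD('n) * p + q" using \<sigma>n by (simp add: N_def p_def q_def algebra_simps)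
  define c1 where "c1 = (1 / (a + 1) + 1 / (q - a - 1)) * (2 / (p - 1))"
  define c2 where "c2 = 2 powr p * (2 / (p - 1))\<^sup>2"
  have c: "c1 \<ge> 0" "c2 \<ge> 0" using a pq by (auto simp: c1_def c2_def)
  define C where "C = 4 powr N * c1 * c2 ^ card ?I"
  show ?thesis
  proof
    show "C \<ge> 0" using c by (simp add: C_def)
    fix z :: "(complex, 'n) vec" assume z: "z \<in> tube"
    define r where "r = rho z"
    have r: "r > 0" using z by (simp add: tube_iff r_def)
    define m where "m p = Re (z $ last_idx) - (\<Sum>j\<in>?I. (Re (z $ j) - Re (p j)) * (Im (z $ j) + Im (p j)))" for p :: "'n \<Rightarrow> complex"
    define S where "S p = (\<Sum>j\<in>?I. (Im (p j))\<^sup>2)" for p :: "'n \<Rightarrow> complex"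
    \<comment> \<open>The total power is distributed over the n + 1 lower bounds for X; t is the
      height, u the distance of the real parts, v j the squared distance in coordinate j.\<close>
    have pw: "X powr (- N) \<le> 4 powr N * ((r + t) powr (- q) * (r + u) powr (- p) * (\<Prod>j\<in>?I. (r + v j) powr (- p)))"
      if "X \<ge> (r + t) / 4" "X \<ge> (r + u) / 4" "\<And>j. j \<in> ?I \<Longrightarrow> X \<ge> (r + v j) / 4" "t \<ge> 0" "u \<ge> 0" "\<And>j. v j \<ge> 0" for X t u v
    proof -
      have "(r + t) / 4 > 0" using that(4) r by simp
      hence X: "X > 0" using that(1) by (rule less_le_trans)
      have e: "- N = - q + (- p) + real (card ?I) * (- p)"
        unfolding N card_below_last by (simp add: algebra_simps)
      have "X powr (- N) = X powr (- q) * X powr (- p) * (\<Prod>j\<in>?I. X powr (- p))"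
      proof -
        have "X powr (real (card ?I) * (- p)) = (X powr (- p)) powr real (card ?I)" by (simp add: powr_powr mult.commute)
        also have "\<dots> = (X powr (- p)) ^ card ?I" using X by (intro powr_realpow) simp
        finally show ?thesis unfolding e powr_add by simp
      qed
      also have "\<dots> \<le> ((r + t) / 4) powr (- q) * ((r + u) / 4) powr (- p) * (\<Prod>j\<in>?I. ((r + v j) / 4) powr (- p))"
      proof -
        have "r + v j > 0" for j using r that(6)[of j] by (rule add_pos_nonneg)
        hence "X powr (- p) \<le> ((r + v j) / 4) powr (- p)" if "j \<in> ?I" for j
          using \<open>\<And>j. j \<in> ?I \<Longrightarrow> X \<ge> (r + v j) / 4\<close>[OF that] pq by (intro powr_mono2') auto
        thus ?thesis using that r pq by (intro mult_mono powr_mono2' prod_mono) (auto intro!: prod_nonneg)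
      qed
      also have "\<dots> = (4 powr q * (r + t) powr (- q)) * (4 powr p * (r + u) powr (- p)) * (\<Prod>j\<in>?I. 4 powr p * (r + v j) powr (- p))"
        using that r by (simp add: powr_divide powr_minus field_simps)
      also have "\<dots> = (4 powr q * 4 powr p * (4 powr p) ^ card ?I) * ((r + t) powr (- q) * (r + u) powr (- p) * (\<Prod>j\<in>?I. (r + v j) powr (- p)))"
        by (simp add: prod.distrib mult_ac)
      also have "4 powr q * 4 powr p * (4 powr p) ^ card ?I = 4 powr N"
        proof -
        have "(4 powr p) ^ card ?I = 4 powr (p * real (card ?I))"
          by (subst powr_realpow[symmetric]) (auto simp: powr_powr)
        thus ?thesis by (simp add: N powr_add[symmetric] card_below_last algebra_simps)
      qed
      finally show ?thesis .
    qed
    have "(\<integral>\<^sup>+w. ennreal (pos_powr (rho w) a * cmod (rho2 z w) powr (- N)) \<partial>lborel)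
       = (\<integral>\<^sup>+p. (\<integral>\<^sup>+\<eta>. ennreal (pos_powr (rho (vec_lambda (p(last_idx := \<eta>)))) a * cmod (rho2 z (vec_lambda (p(last_idx := \<eta>)))) powr (- N)) \<partial>lborel) \<partial>(\<Pi>\<^sub>M j\<in>?I. lborel))"
      by (subst nn_integral_vec_split(1)[where i = last_idx]) (auto simp: UNIV_minus_last)
    also have "\<dots> \<le> (\<integral>\<^sup>+x. (\<integral>\<^sup>+\<eta>. ennreal (4 powr N * (\<Prod>j\<in>?I. (r + (cmod (z $ j - x j))\<^sup>2) powr (- p))) *
          ennreal (pos_powr (Im \<eta> - S x) a * (r + (Im \<eta> - S x)) powr (- q) * (r + \<bar>Re \<eta> - m x\<bar>) powr (- p)) \<partial>lborel) \<partial>(\<Pi>\<^sub>M j\<in>?I. lborel))"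
    proof (intro nn_integral_mono)
      fix x :: "'n \<Rightarrow> complex" and \<eta> :: complex
      let ?w = "vec_lambda (x(last_idx := \<eta>))"
      have rw: "rho ?w = Im \<eta> - S x" unfolding rho_def S_def by (auto intro!: sum.cong)
      show "ennreal (pos_powr (rho ?w) a * cmod (rho2 z ?w) powr (- N)) \<le> ennreal (4 powr N * (\<Prod>j\<in>?I. (r + (cmod (z $ j - x j))\<^sup>2) powr (- p))) *
          ennreal (pos_powr (Im \<eta> - S x) a * (r + (Im \<eta> - S x)) powr (- q) * (r + \<bar>Re \<eta> - m x\<bar>) powr (- p))"
      proof (cases "?w \<in> tube")
        case True
        have mx: "(\<Sum>j\<in>?I. (Re (z $ j) - Re (?w $ j)) * (Im (z $ j) + Im (?w $ j))) = (\<Sum>j\<in>?I. (Re (z $ j) - Re (x j)) * (Im (z $ j) + Im (x j)))"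
          by (auto intro!: sum.cong)
        have "cmod (rho2 z ?w) powr (- N) \<le> 4 powr N * ((r + rho ?w) powr (- q) * (r + \<bar>Re \<eta> - m x\<bar>) powr (- p) * (\<Prod>j\<in>?I. (r + (cmod (z $ j - x j))\<^sup>2) powr (- p)))"
        proof (rule pw)
          show "cmod (rho2 z ?w) \<ge> (r + rho ?w) / 4" unfolding r_def by (rule rho2_bounds(1)[OF z True])
          show "cmod (rho2 z ?w) \<ge> (r + \<bar>Re \<eta> - m x\<bar>) / 4"
            using rho2_bounds(3)[OF z True] unfolding r_def mx by (simp add: m_def)
          show "cmod (rho2 z ?w) \<ge> (r + (cmod (z $ j - x j))\<^sup>2) / 4" if "j \<in> ?I" for j
            using rho2_bounds(2)[OF z True, of j] that by (auto simp: r_def split: if_splits)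
          show "rho ?w \<ge> 0" using True by (simp add: tube_iff)
        qed auto
        from mult_left_mono[OF this, of "pos_powr (rho ?w) a"] show ?thesis
          unfolding rw by (simp add: ennreal_mult'[symmetric] mult_ac prod_nonneg)
      next
        case False
        thus ?thesis by (simp add: tube_iff pos_powr_def)
      qed
    qed
    \<comment> \<open>The bound for the last coordinate does not depend on the centres
      \<open>S x\<close> and \<open>m x\<close>, so the coupling with the other coordinates
      disappears and a product remains.\<close>
    also have "\<dots> \<le> (\<integral>\<^sup>+x. ennreal (4 powr N * (\<Prod>j\<in>?I. (r + (cmod (z $ j - x j))\<^sup>2) powr (- p))) * ennreal (c1 * r powr (a + 2 - q - p)) \<partial>(\<Pi>\<^sub>M j\<in>?I. lborel))"
    proof (rule nn_integral_mono)
      fix x :: "'n \<Rightarrow> complex"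
      show "(\<integral>\<^sup>+\<eta>. ennreal (4 powr N * (\<Prod>j\<in>?I. (r + (cmod (z $ j - x j))\<^sup>2) powr (- p))) *
          ennreal (pos_powr (Im \<eta> - S x) a * (r + (Im \<eta> - S x)) powr (- q) * (r + \<bar>Re \<eta> - m x\<bar>) powr (- p)) \<partial>lborel)
        \<le> ennreal (4 powr N * (\<Prod>j\<in>?I. (r + (cmod (z $ j - x j))\<^sup>2) powr (- p))) * ennreal (c1 * r powr (a + 2 - q - p))"
        unfolding c1_def
        by (subst nn_integral_cmult, simp, intro mult_left_mono nn_integral_half_plane) (use r a pq in auto)
    qed
    also have "\<dots> = ennreal (4 powr N) * (\<integral>\<^sup>+x. (\<Prod>j\<in>?I. ennreal ((r + (cmod (z $ j - x j))\<^sup>2) powr (- p))) \<partial>(\<Pi>\<^sub>M j\<in>?I. lborel)) * ennreal (c1 * r powr (a + 2 - q - p))"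
      by (simp add: nn_integral_multc nn_integral_cmult ennreal_mult' prod_ennreal)
    also have "(\<integral>\<^sup>+x. (\<Prod>j\<in>?I. ennreal ((r + (cmod (z $ j - x j))\<^sup>2) powr (- p))) \<partial>(\<Pi>\<^sub>M j\<in>?I. lborel))
       = (\<Prod>j\<in>?I. (\<integral>\<^sup>+y. ennreal ((r + (cmod (z $ j - y))\<^sup>2) powr (- p)) \<partial>lborel))"
    proof -
      interpret product_sigma_finite "\<lambda>i::'n. (lborel :: complex measure)" ..
      show ?thesis by (rule product_nn_integral_prod) auto
    qed
    also have "ennreal (4 powr N) * (\<Prod>j\<in>?I. (\<integral>\<^sup>+y. ennreal ((r + (cmod (z $ j - y))\<^sup>2) powr (- p)) \<partial>lborel)) * ennreal (c1 * r powr (a + 2 - q - p))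
       \<le> ennreal (4 powr N) * (\<Prod>j\<in>?I. ennreal (c2 * r powr (1 - p))) * ennreal (c1 * r powr (a + 2 - q - p))"
      unfolding c2_def using r pq by (intro mult_mono prod_mono_ennreal nn_integral_plane) auto
    also have "\<dots> = ennreal (C * ((r powr (1 - p)) ^ card ?I * r powr (a + 2 - q - p)))"
      using c by (simp add: C_def ennreal_mult'[symmetric] ennreal_power power_mult_distrib mult_ac)
    also have "(r powr (1 - p)) ^ card ?I * r powr (a + 2 - q - p) = r powr (- s)"
    proof -
      have "(1 - p) * real (card ?I) + (a + 2 - q - p) = - s"
        unfolding card_below_last \<sigma>n[symmetric] by (simp add: p_def q_def algebra_simps)
      moreover have "(r powr (1 - p)) ^ card ?I = r powr ((1 - p) * real (card ?I))"
        using r by (subst powr_realpow[symmetric]) (auto simp: powr_powr)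
      ultimately show ?thesis by (simp add: powr_add[symmetric])
    qed
    finally show "(\<integral>\<^sup>+w. ennreal (pos_powr (rho w) a * cmod (rho2 z w) powr (- (real CARD('n) + 1 + a + s))) \<partial>lborel) \<le> ennreal (C * rho z powr (- s))"
      by (simp add: N_def r_def)
  qed
qed

subsection \<open>The Cauchy formula on the real line\<close>

lemma integrable_dominated:
  fixes f :: "'a \<Rightarrow> 'b::{banach, second_countable_topology}"
  assumes "f \<in> borel_measurable M" "\<And>x. norm (f x) \<le> g x" "(\<integral>\<^sup>+x. ennreal (g x) \<partial>M) < \<infinity>"
  shows "integrable M f"
proof (rule integrableI_bounded)
  have "(\<integral>\<^sup>+x. ennreal (norm (f x)) \<partial>M) \<le> (\<integral>\<^sup>+x. ennreal (g x) \<partial>M)"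
    using assms(2) by (intro nn_integral_mono ennreal_leI)
  thus "(\<integral>\<^sup>+x. ennreal (norm (f x)) \<partial>M) < \<infinity>" using assms(3) by simp
qed (rule assms)

lemma cnj_measurable [measurable]: "cnj \<in> borel_measurable borel"
  by (intro borel_measurable_continuous_onI continuous_intros)

lemma integrable_abs_powr:
  fixes r p m :: real
  assumes "r > 0" "p > 1"
  shows "integrable lborel (\<lambda>x. (r + \<bar>x - m\<bar>) powr (- p))"
  by (rule integrable_dominated[where g = "\<lambda>x. (r + \<bar>x - m\<bar>) powr (- p)"])
     (use nn_integral_abs_powr[OF assms, of m] in \<open>auto intro: le_less_trans\<close>)

lemma integral_abs_powr_le:
  fixes r p :: real
  assumes "r > 0" "p > 1"
  shows "(LINT x|lborel. (r + \<bar>x\<bar>) powr (- p)) \<le> 2 / (p - 1) * r powr (1 - p)"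
proof -
  have "ennreal (LINT x|lborel. (r + \<bar>x\<bar>) powr (- p)) = (\<integral>\<^sup>+x. ennreal ((r + \<bar>x\<bar>) powr (- p)) \<partial>lborel)"
    by (rule nn_integral_eq_integral[symmetric]) (use integrable_abs_powr[OF assms, of 0] in auto)
  also have "\<dots> \<le> ennreal (2 / (p - 1) * r powr (1 - p))"
    using nn_integral_abs_powr[OF assms, of 0] by simp
  finally show ?thesis using assms by (subst (asm) ennreal_le_iff) auto
qed

text \<open>Cauchy's theorem for the rectangles over [-n, n], expressed by a primitive F on the
  convex set S: the horizontal sides are differences of values of F, and the vertical sides are at
  most v times the bound on H at abscissa n or -n, which tends to 0.\<close>

lemma horizontal_line_integral_shift:
  fixes H :: "complex \<Rightarrow> complex" and v p B :: real
  assumes S: "open S" "convex S" and hol: "H holomorphic_on S"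
    and sub: "\<And>\<zeta>. 0 \<le> Im \<zeta> \<Longrightarrow> Im \<zeta> \<le> v \<Longrightarrow> \<zeta> \<in> S"
    and bd: "\<And>\<zeta>. 0 \<le> Im \<zeta> \<Longrightarrow> Im \<zeta> \<le> v \<Longrightarrow> cmod (H \<zeta>) \<le> B * (1 + \<bar>Re \<zeta>\<bar>) powr (- p)"
    and p: "p > 1" and v: "v \<ge> 0"
  shows "(LINT u|lborel. H (Complex u v)) = (LINT u|lborel. H (Complex u 0))"
proof -
  obtain F where F: "\<And>x. x \<in> S \<Longrightarrow> (F has_field_derivative H x) (at x within S)"
    using holomorphic_convex_primitive'[OF S(2) S(1) hol] by blast
  have B: "B \<ge> 0" using order_trans[OF norm_ge_zero bd[of 0]] v by auto
  have int: "integrable lborel (\<lambda>u. H (Complex u c))" if c: "0 \<le> c" "c \<le> v" for c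
  proof (rule Bochner_Integration.integrable_bound)
    show "integrable lborel (\<lambda>u. B * (1 + \<bar>u\<bar>) powr (- p))"
      using integrable_abs_powr[of 1 p 0] p by simp
    have "continuous_on UNIV (\<lambda>u. H (Complex u c))"
    proof (rule continuous_on_compose2[OF holomorphic_on_imp_continuous_on[OF hol]])
      show "continuous_on UNIV (\<lambda>u. Complex u c)" unfolding Complex_eq by (intro continuous_intros)
      show "(\<lambda>u. Complex u c) ` UNIV \<subseteq> S" using sub c by auto
    qed
    thus "(\<lambda>u. H (Complex u c)) \<in> borel_measurable lborel"
      using borel_measurable_continuous_onI by simp
    show "AE u in lborel. norm (H (Complex u c)) \<le> norm (B * (1 + \<bar>u\<bar>) powr (- p))"
    proof (rule AE_I2)
      fix u show "norm (H (Complex u c)) \<le> norm (B * (1 + \<bar>u\<bar>) powr (- p))"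
        using bd[of "Complex u c"] c B by (simp add: abs_mult)
    qed
  qed
  define I where "I c n = (LINT u|lborel. indicator {- real n..real n} u *\<^sub>R H (Complex u c))" for c n
  have lim: "(\<lambda>n. I c n) \<longlonglongrightarrow> (LINT u|lborel. H (Complex u c))" if c: "0 \<le> c" "c \<le> v" for c
    unfolding I_def
  proof (rule integral_dominated_convergence[where w = "\<lambda>u. cmod (H (Complex u c))"])
    show "(\<lambda>u. H (Complex u c)) \<in> borel_measurable lborel" using int[OF c] by auto
    show "integrable lborel (\<lambda>u. cmod (H (Complex u c)))" using int[OF c] by simp
    show "AE u in lborel. (\<lambda>i. indicator {- real i..real i} u *\<^sub>R H (Complex u c)) \<longlonglongrightarrow> H (Complex u c)"
    proof (rule AE_I2)
      fix u :: real
      obtain N where N: "\<bar>u\<bar> \<le> real N" using real_arch_simple by blast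
      have "indicator {- real n..real n} u *\<^sub>R H (Complex u c) = H (Complex u c)" if "n \<ge> N" for n
        proof -
        have "real N \<le> real n" using that by simp
        hence "u \<in> {- real n..real n}" using N unfolding abs_le_iff by simp
        thus ?thesis by simp
      qed
      hence "eventually (\<lambda>n. indicator {- real n..real n} u *\<^sub>R H (Complex u c) = H (Complex u c)) sequentially"
        unfolding eventually_sequentially by blast
      thus "(\<lambda>i. indicator {- real i..real i} u *\<^sub>R H (Complex u c)) \<longlonglongrightarrow> H (Complex u c)"
        by (rule tendsto_eventually)
    qed
    show "AE u in lborel. norm (indicator {- real i..real i} u *\<^sub>R H (Complex u c)) \<le> cmod (H (Complex u c))" for i
      by (auto split: split_indicator)
    show "(\<lambda>u. indicator {- real i..real i} u *\<^sub>R H (Complex u c)) \<in> borel_measurable lborel" for i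
      using borel_measurable_integrable[OF int[OF c]] by measurable
  qed
  have I_eq: "I c n = F (Complex (real n) c) - F (Complex (- real n) c)" if c: "0 \<le> c" "c \<le> v" for c n
  proof -
    have "((\<lambda>u. F (Complex u c)) has_vector_derivative H (Complex u c)) (at u within {- real n..real n})" for u
    proof -
      have "(F has_field_derivative H (Complex u c)) (at (Complex u c))"
        using F[of "Complex u c"] sub[of "Complex u c"] c at_within_open[OF _ S(1), of "Complex u c"] by simp
      moreover have "((\<lambda>u. Complex u c) has_vector_derivative 1) (at u within {- real n..real n})"
        unfolding Complex_eq by (auto intro!: derivative_eq_intros simp: has_vector_derivative_def scaleR_conv_of_real)
      ultimately have "(F \<circ> (\<lambda>u. Complex u c) has_vector_derivative 1 * H (Complex u c)) (at u within {- real n..real n})"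
        by (intro field_vector_diff_chain_within) (auto intro: has_field_derivative_at_within)
      thus ?thesis by (simp add: o_def)
    qed
    hence "((\<lambda>u. H (Complex u c)) has_integral (F (Complex (real n) c) - F (Complex (- real n) c))) {- real n..real n}"
      by (intro fundamental_theorem_of_calculus) auto
    moreover have "set_integrable lborel {- real n..real n} (\<lambda>u. H (Complex u c))"
      unfolding set_integrable_def by (rule integrable_mult_indicator) (use int[OF c] in auto)
    ultimately show ?thesis
      using set_borel_integral_eq_integral(2)[of "{- real n..real n}" "\<lambda>u. H (Complex u c)"]
      unfolding I_def set_lebesgue_integral_def by (simp add: integral_unique)
  qed
  have side: "cmod (F (Complex x v) - F (Complex x 0)) \<le> B * (1 + \<bar>x\<bar>) powr (- p) * v" for x
  proof -
    have "cmod (F (Complex x v) - F (Complex x 0)) \<le> B * (1 + \<bar>x\<bar>) powr (- p) * cmod (Complex x v - Complex x 0)"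
    proof (rule field_differentiable_bound[where S = "closed_segment (Complex x 0) (Complex x v)" and f' = H])
      fix \<zeta> assume "\<zeta> \<in> closed_segment (Complex x 0) (Complex x v)"
      then obtain t where t: "0 \<le> t" "t \<le> 1" "\<zeta> = (1 - t) *\<^sub>R Complex x 0 + t *\<^sub>R Complex x v"
        by (auto simp: closed_segment_def)
      hence "\<zeta> = Complex x (t * v)" by (simp add: complex_eq_iff algebra_simps)
      hence \<zeta>: "Re \<zeta> = x" "0 \<le> Im \<zeta>" "Im \<zeta> \<le> v" using v t(1,2) by (auto simp: mult_left_le_one_le)
      show "(F has_field_derivative H \<zeta>) (at \<zeta> within closed_segment (Complex x 0) (Complex x v))"
        by (rule has_field_derivative_at_within) (use F[of \<zeta>] sub[of \<zeta>] at_within_open[OF _ S(1), of \<zeta>] \<zeta> in simp)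
      show "cmod (H \<zeta>) \<le> B * (1 + \<bar>x\<bar>) powr (- p)" using bd[of \<zeta>] \<zeta> by simp
    qed auto
    also have "cmod (Complex x v - Complex x 0) = v" using v by (simp add: cmod_def)
    finally show ?thesis .
  qed
  have L0: "(\<lambda>n. I v n - I 0 n) \<longlonglongrightarrow> 0"
  proof (rule Lim_null_comparison)
    show "\<forall>\<^sub>F n in sequentially. norm (I v n - I 0 n) \<le> 2 * (B * (1 + real n) powr (- p) * v)"
    proof (rule always_eventually, rule allI)
      fix n
      have "I v n - I 0 n = (F (Complex (real n) v) - F (Complex (real n) 0)) - (F (Complex (- real n) v) - F (Complex (- real n) 0))"
        using v by (simp add: I_eq)
      thus "norm (I v n - I 0 n) \<le> 2 * (B * (1 + real n) powr (- p) * v)"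
        using side[of "real n"] side[of "- real n"] norm_triangle_ineq4[of "F (Complex (real n) v) - F (Complex (real n) 0)" "F (Complex (- real n) v) - F (Complex (- real n) 0)"] by simp
    qed
    have "(\<lambda>n. (1 + real n) powr (- p)) \<longlonglongrightarrow> 0"
      using p by (intro tendsto_neg_powr filterlim_tendsto_add_at_top[OF tendsto_const] filterlim_real_sequentially) auto
    from tendsto_mult[OF tendsto_const[of "2 * B"] tendsto_mult[OF this tendsto_const[of v]]]
    show "(\<lambda>n. 2 * (B * (1 + real n) powr (- p) * v)) \<longlonglongrightarrow> 0" by (simp add: mult.assoc)
  qed
  have "(\<lambda>n. I v n - I 0 n) \<longlonglongrightarrow> (LINT u|lborel. H (Complex u v)) - (LINT u|lborel. H (Complex u 0))"
    using v by (intro tendsto_diff lim) auto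
  from LIMSEQ_unique[OF L0 this] show ?thesis by simp
qed

lemma integral_Poisson:
  fixes x s :: real
  assumes s: "s > 0"
  shows "(LINT u|lborel. 1 / ((u - x)\<^sup>2 + s\<^sup>2)) = pi / s"
proof -
  have "(LINT u|lborel. 1 / ((u - x)\<^sup>2 + s\<^sup>2)) = s * (LINT u|lborel. 1 / (((x + s * u) - x)\<^sup>2 + s\<^sup>2))"
    using s by (subst lborel_integral_real_affine[where c = s and t = x]) auto
  also have "(\<lambda>u. 1 / (((x + s * u) - x)\<^sup>2 + s\<^sup>2)) = (\<lambda>u. 1 / s\<^sup>2 * inverse (1 + u\<^sup>2))"
    using s by (auto simp: fun_eq_iff field_simps power2_eq_square)
  also have "(LINT u|lborel. 1 / s\<^sup>2 * inverse (1 + u\<^sup>2)) = 1 / s\<^sup>2 * (LINT u|lborel. inverse (1 + u\<^sup>2))"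
    by (rule integral_mult_right_zero)
  also have "(LINT u|lborel. inverse (1 + u\<^sup>2)) = pi"
    using LBINT_inverse_1_plus_square by (simp add: interval_lebesgue_integral_def set_lebesgue_integral_def)
  finally show ?thesis using s by (simp add: power2_eq_square)
qed

text \<open>After subtracting a multiple of the Poisson-type quotient
  the integrand is holomorphic in the upper half-plane, so the line can be pushed to infinity.\<close>

lemma Cauchy_formula_real_line:
  fixes G :: "complex \<Rightarrow> complex" and \<delta> B :: real
  assumes \<delta>: "\<delta> > 0" and hol: "G holomorphic_on {\<zeta>. Im \<zeta> > - \<delta>}"
    and bd: "\<And>\<zeta>. Im \<zeta> \<ge> 0 \<Longrightarrow> cmod (G \<zeta>) \<le> B / (1 + cmod \<zeta>)"
    and \<xi>: "Im \<xi> > 0"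
  shows "(LINT u|lborel. G (of_real u) / (of_real u - \<xi>)) = 2 * of_real pi * \<i> * G \<xi>"
proof -
  define s where "s = Im \<xi>"
  \<comment> \<open>E equals 1 at \<xi> and has its only pole at \<open>cnj \<xi>\<close>, in the
    lower half-plane. Hence g vanishes at \<xi>, and g \<zeta> / (\<zeta> - \<xi>) extends
    holomorphically, while E \<zeta> / (\<zeta> - \<xi>) on the real line is a multiple of the
    Poisson kernel.\<close>
  define E where "E \<zeta> = (\<xi> - cnj \<xi>) / (\<zeta> - cnj \<xi>)" for \<zeta>
  define g where "g \<zeta> = G \<zeta> - G \<xi> * E \<zeta>" for \<zeta>
  \<comment> \<open>The minimum keeps the pole \<open>cnj \<xi>\<close>, at height -s, outside
    S.\<close>
  define S where "S = {\<zeta>. Im \<zeta> > - min \<delta> s}"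
  define H where "H \<zeta> = (if \<zeta> = \<xi> then deriv g \<xi> else (g \<zeta> - g \<xi>) / (\<zeta> - \<xi>))" for \<zeta>
  have s: "s > 0" using \<xi> by (simp add: s_def)
  have S: "open S" "convex S" unfolding S_def by (auto simp: open_halfspace_Im_gt convex_halfspace_Im_gt)
  have "\<xi> - cnj \<xi> \<noteq> 0" using \<xi> by (auto simp: complex_eq_iff)
  hence g0: "g \<xi> = 0" by (simp add: g_def E_def)
  have holE: "E holomorphic_on S" unfolding E_def[abs_def]
    by (intro holomorphic_intros) (auto simp: S_def s_def complex_eq_iff)
  have holg: "g holomorphic_on S" unfolding g_def[abs_def]
    by (intro holomorphic_intros holE holomorphic_on_subset[OF hol]) (auto simp: S_def)
  have holH: "H holomorphic_on S" unfolding H_def[abs_def] by (rule pole_lemma_open[OF holg S(1)])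
  have far: "1 / cmod (\<zeta> - c) \<le> ((1 + cmod c) / r + 1) / (1 + cmod \<zeta>)" if "r > 0" "cmod (\<zeta> - c) \<ge> r" for \<zeta> c r
  proof -
    have "1 + cmod \<zeta> \<le> (1 + cmod c) + cmod (\<zeta> - c)" using norm_triangle_sub[of \<zeta> c] by simp
    also have "(1 + cmod c) \<le> (1 + cmod c) / r * cmod (\<zeta> - c)"
    proof -
      have "(1 + cmod c) / r * r \<le> (1 + cmod c) / r * cmod (\<zeta> - c)" using that by (intro mult_left_mono) auto
      thus ?thesis using that by simp
    qed
    finally have "1 + cmod \<zeta> \<le> ((1 + cmod c) / r + 1) * cmod (\<zeta> - c)" by (simp add: algebra_simps)
    moreover have "cmod (\<zeta> - c) > 0" "1 + cmod \<zeta> > 0" using that by (auto simp: add_pos_nonneg)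
    ultimately show ?thesis by (simp add: field_simps)
  qed
  define c1 where "c1 = B + cmod (G \<xi>) * (cmod (\<xi> - cnj \<xi>) * ((1 + cmod \<xi>) / s + 1))"
  have gb: "cmod (g \<zeta>) \<le> c1 / (1 + cmod \<zeta>)" if "Im \<zeta> \<ge> 0" for \<zeta>
  proof -
    have "cmod (\<zeta> - cnj \<xi>) \<ge> s" using abs_Im_le_cmod[of "\<zeta> - cnj \<xi>"] that s by (simp add: s_def)
    hence "1 / cmod (\<zeta> - cnj \<xi>) \<le> ((1 + cmod \<xi>) / s + 1) / (1 + cmod \<zeta>)" using far[OF s, of \<zeta> "cnj \<xi>"] by simp
    hence "cmod (E \<zeta>) \<le> cmod (\<xi> - cnj \<xi>) * (((1 + cmod \<xi>) / s + 1) / (1 + cmod \<zeta>))"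
      unfolding E_def norm_divide by (metis divide_inverse inverse_eq_divide mult_left_mono norm_ge_zero)
    hence "cmod (G \<xi> * E \<zeta>) \<le> cmod (G \<xi>) * (cmod (\<xi> - cnj \<xi>) * (((1 + cmod \<xi>) / s + 1) / (1 + cmod \<zeta>)))"
      unfolding norm_mult by (rule mult_left_mono) simp
    with bd[OF that] have "cmod (g \<zeta>) \<le> B / (1 + cmod \<zeta>) + cmod (G \<xi>) * (cmod (\<xi> - cnj \<xi>) * (((1 + cmod \<xi>) / s + 1) / (1 + cmod \<zeta>)))"
      unfolding g_def by (intro order_trans[OF norm_triangle_ineq4] add_mono)
    thus ?thesis by (simp only: c1_def add_divide_distrib[of B] times_divide_eq_right)
  qed
  have c1: "c1 \<ge> 0" using gb[of 0] order_trans[OF norm_ge_zero] by auto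
  obtain M where M: "\<And>\<zeta>. \<zeta> \<in> cball \<xi> (s/2) \<Longrightarrow> cmod (H \<zeta>) \<le> M"
  proof -
    have "cball \<xi> (s/2) \<subseteq> S"
    proof
      fix \<zeta> assume "\<zeta> \<in> cball \<xi> (s/2)"
      hence "\<bar>Im (\<xi> - \<zeta>)\<bar> \<le> s / 2" using abs_Im_le_cmod[of "\<xi> - \<zeta>"] by (simp add: dist_norm)
      hence "Im \<zeta> > 0" using s unfolding s_def minus_complex.sel by linarith
      thus "\<zeta> \<in> S" using s \<delta> by (simp add: S_def min_def)
    qed
    hence "compact (H ` cball \<xi> (s/2))"
      by (intro compact_continuous_image holomorphic_on_imp_continuous_on holomorphic_on_subset[OF holH]) auto
    thus ?thesis using that compact_imp_bounded bounded_iff by (metis image_eqI)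
  qed
  have M0: "M \<ge> 0" by (rule order_trans[OF norm_ge_zero M[of \<xi>]]) (use s in auto)
  \<comment> \<open>The first summand serves outside the disc of radius s / 2 about \<xi>, the
    second inside it, where H is only known to be bounded by compactness.\<close>
  define c2 where "c2 = c1 * ((1 + cmod \<xi>) / (s/2) + 1) + M * (1 + cmod \<xi> + s)^2"
  have c2: "c2 \<ge> 0" using c1 M0 s by (simp add: c2_def)
  have Hb: "cmod (H \<zeta>) \<le> c2 / (1 + cmod \<zeta>)^2" if "Im \<zeta> \<ge> 0" for \<zeta>
  proof (cases "\<zeta> \<in> cball \<xi> (s/2)")
    case True
    have "1 + cmod \<zeta> \<le> 1 + cmod \<xi> + s"
      using True norm_triangle_sub[of \<zeta> \<xi>] s by (simp add: dist_norm norm_minus_commute)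
    hence "(1 + cmod \<zeta>)^2 \<le> (1 + cmod \<xi> + s)^2" by (intro power_mono) auto
    hence "cmod (H \<zeta>) * (1 + cmod \<zeta>)^2 \<le> M * (1 + cmod \<xi> + s)^2" by (intro mult_mono M[OF True] M0) auto
    also have "\<dots> \<le> c2" using c1 s by (simp add: c2_def)
    finally have "cmod (H \<zeta>) * (1 + cmod \<zeta>)\<^sup>2 \<le> c2" .
    moreover have "(1 + cmod \<zeta>)\<^sup>2 > 0" by (intro zero_less_power add_pos_nonneg) auto
    ultimately show ?thesis by (simp only: pos_le_divide_eq)
  next
    case False
    hence d: "cmod (\<zeta> - \<xi>) \<ge> s / 2" "\<zeta> \<noteq> \<xi>" using s by (auto simp: dist_norm norm_minus_commute)
    have "cmod (H \<zeta>) = cmod (g \<zeta>) * (1 / cmod (\<zeta> - \<xi>))" using d by (simp add: H_def g0 norm_divide)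
    also have "\<dots> \<le> (c1 / (1 + cmod \<zeta>)) * (((1 + cmod \<xi>) / (s/2) + 1) / (1 + cmod \<zeta>))"
      using s c1 d by (intro mult_mono gb that far) auto
    also have "\<dots> = c1 * ((1 + cmod \<xi>) / (s/2) + 1) / (1 + cmod \<zeta>)^2" by (simp add: power2_eq_square)
    also have "\<dots> \<le> c2 / (1 + cmod \<zeta>)^2" using M0 by (intro divide_right_mono) (auto simp: c2_def)
    finally show ?thesis .
  qed
  \<comment> \<open>The quadratic decay is divided: 3/2 for integrability in x, 1/2 for decay as the
    line moves up.\<close>
  have Hb': "cmod (H (Complex x v)) \<le> c2 * (1 + \<bar>x\<bar>) powr (- (3/2)) * (1 + v) powr (- (1/2))" if "v \<ge> 0" for x v
  proof -
    have "\<bar>x\<bar> \<le> cmod (Complex x v)" "v \<le> cmod (Complex x v)"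
      using abs_Re_le_cmod[of "Complex x v"] abs_Im_le_cmod[of "Complex x v"] by auto
    hence "(1 + cmod (Complex x v)) powr (- (3/2)) * (1 + cmod (Complex x v)) powr (- (1/2)) \<le> (1 + \<bar>x\<bar>) powr (- (3/2)) * (1 + v) powr (- (1/2))"
      using that by (intro mult_mono powr_mono2') auto
    moreover have "(1 + cmod (Complex x v)) powr (- (3/2)) * (1 + cmod (Complex x v)) powr (- (1/2)) = 1 / (1 + cmod (Complex x v))^2"
    proof -
      have "1 + cmod (Complex x v) > 0" by (intro add_pos_nonneg) auto
      thus ?thesis by (simp add: powr_add[symmetric] powr_minus_divide)
    qed
    ultimately have "c2 * (1 / (1 + cmod (Complex x v))^2) \<le> c2 * ((1 + \<bar>x\<bar>) powr (- (3/2)) * (1 + v) powr (- (1/2)))"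
      using c2 by (intro mult_left_mono) auto
    thus ?thesis using Hb[of "Complex x v"] that by (simp add: mult.assoc)
  qed
  define I where "I = (LINT u|lborel. H (Complex u 0))"
  have Iv: "(LINT u|lborel. H (Complex u v)) = I" if "v \<ge> 0" for v
    unfolding I_def
  proof (rule horizontal_line_integral_shift[OF S holH, where B = c2 and p = "3/2"])
    fix \<zeta> assume z: "0 \<le> Im \<zeta>" "Im \<zeta> \<le> v"
    show "\<zeta> \<in> S" using z \<delta> s by (auto simp: S_def)
    have "(1 + Im \<zeta>) powr (- (1/2)) \<le> 1" using powr_mono2'[of "- (1/2)" 1 "1 + Im \<zeta>"] z by simp
    hence "c2 * (1 + \<bar>Re \<zeta>\<bar>) powr (- (3/2)) * (1 + Im \<zeta>) powr (- (1/2)) \<le> c2 * (1 + \<bar>Re \<zeta>\<bar>) powr (- (3/2)) * 1"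
      using c2 by (intro mult_left_mono) auto
    thus "cmod (H \<zeta>) \<le> c2 * (1 + \<bar>Re \<zeta>\<bar>) powr (- (3/2))"
      using Hb'[of "Im \<zeta>" "Re \<zeta>"] z by simp
  qed (use that in auto)
  \<comment> \<open>The integral does not depend on the height v, but its bound tends to 0 with v;
    so it is 0. The factor 4 is 2 / (p - 1) for p = 3/2.\<close>
  have "cmod I \<le> c2 * 4 * (1 + v) powr (- (1/2))" if "v \<ge> 0" for v
  proof -
    have "cmod I \<le> (LINT u|lborel. cmod (H (Complex u v)))"
      unfolding Iv[OF that, symmetric] by (rule integral_norm_bound)
    also have "\<dots> \<le> (LINT u|lborel. c2 * (1 + v) powr (- (1/2)) * (1 + \<bar>u\<bar>) powr (- (3/2)))"
      using Hb'[OF that] integrable_abs_powr[of 1 "3/2" 0]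
      by (intro integral_mono') (auto simp: mult_ac c2)
    also have "\<dots> \<le> c2 * (1 + v) powr (- (1/2)) * 4"
      using integral_abs_powr_le[of 1 "3/2"] c2 by (simp add: mult_left_mono)
    finally show ?thesis by (simp add: mult_ac)
  qed
  hence le: "cmod I \<le> c2 * 4 * (1 + real n) powr (- (1/2))" for n by simp
  have "(\<lambda>n. (1 + real n) powr (- (1/2))) \<longlonglongrightarrow> 0"
    by (intro tendsto_neg_powr filterlim_tendsto_add_at_top[OF tendsto_const] filterlim_real_sequentially) auto
  from tendsto_mult[OF tendsto_const[of "c2 * 4"] this]
  have "(\<lambda>n. c2 * 4 * (1 + real n) powr (- (1/2))) \<longlonglongrightarrow> 0" by simp
  from LIMSEQ_le_const[OF this, of "cmod I"] le have "cmod I \<le> 0" by blast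
  hence I0: "I = 0" by simp
  have E_int: "E (of_real u) / (of_real u - \<xi>) = (\<xi> - cnj \<xi>) * of_real (1 / ((u - Re \<xi>)\<^sup>2 + s\<^sup>2))" for u :: real
  proof -
    have *: "(of_real u - cnj \<xi>) * (of_real u - \<xi>) = of_real ((u - Re \<xi>)\<^sup>2 + s\<^sup>2)"
      by (rule complex_eqI) (simp_all add: s_def power2_eq_square algebra_simps)
    have "E (of_real u) / (of_real u - \<xi>) = (\<xi> - cnj \<xi>) / ((of_real u - cnj \<xi>) * (of_real u - \<xi>))"
      by (simp add: E_def)
    thus ?thesis unfolding * by (simp only: of_real_divide of_real_1 times_divide_eq_right mult_1_right)
  qed
  have intI: "integrable lborel (\<lambda>u. H (Complex u 0))"
  proof (rule Bochner_Integration.integrable_bound)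
    show "integrable lborel (\<lambda>u. c2 * (1 + \<bar>u\<bar>) powr (- (3/2)))"
      using integrable_abs_powr[of 1 "3/2" 0] by simp
    have "continuous_on UNIV (\<lambda>u. H (Complex u 0))"
    proof (rule continuous_on_compose2[OF holomorphic_on_imp_continuous_on[OF holH]])
      show "continuous_on UNIV (\<lambda>u. Complex u 0)" unfolding Complex_eq by (intro continuous_intros)
      show "(\<lambda>u. Complex u 0) ` UNIV \<subseteq> S" using s \<delta> by (auto simp: S_def)
    qed
    thus "(\<lambda>u. H (Complex u 0)) \<in> borel_measurable lborel"
      using borel_measurable_continuous_onI by simp
    show "AE u in lborel. norm (H (Complex u 0)) \<le> norm (c2 * (1 + \<bar>u\<bar>) powr (- (3/2)))"
    proof (rule AE_I2)
      fix u show "norm (H (Complex u 0)) \<le> norm (c2 * (1 + \<bar>u\<bar>) powr (- (3/2)))"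
        using Hb'[of 0 u] c2 by (simp add: abs_mult)
    qed
  qed
  have intE: "integrable lborel (\<lambda>u. G \<xi> * (E (of_real u) / (of_real u - \<xi>)))"
  proof -
    have "integrable lborel (\<lambda>u. 1 / ((u - Re \<xi>)\<^sup>2 + s\<^sup>2))"
    \<comment> \<open>A non-integrable function has integral 0 by convention, so the known value pi
      / s, which is positive, forces integrability.\<close>
    proof (rule ccontr)
      assume "\<not> integrable lborel (\<lambda>u. 1 / ((u - Re \<xi>)\<^sup>2 + s\<^sup>2))"
      hence "(LINT u|lborel. 1 / ((u - Re \<xi>)\<^sup>2 + s\<^sup>2)) = 0" by (rule not_integrable_integral_eq)
      thus False unfolding integral_Poisson[OF s] using s by simp
    qed
    thus ?thesis unfolding E_int by (intro integrable_mult_right integrable_of_real)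
  qed
  have "G (of_real u) / (of_real u - \<xi>) = H (Complex u 0) + G \<xi> * (E (of_real u) / (of_real u - \<xi>))" for u
  proof -
    have "of_real u \<noteq> \<xi>" using \<xi> by (auto simp: complex_eq_iff)
    thus ?thesis by (simp add: H_def g0 complex_of_real_def[symmetric]) (simp add: g_def diff_divide_distrib)
  qed
  hence "(LINT u|lborel. G (of_real u) / (of_real u - \<xi>)) = I + (LINT u|lborel. G \<xi> * (E (of_real u) / (of_real u - \<xi>)))"
    unfolding I_def by (simp only:) (rule Bochner_Integration.integral_add[OF intI intE])
  also have "\<dots> = G \<xi> * ((\<xi> - cnj \<xi>) * of_real (pi / s))"
    unfolding E_int I0 using integral_Poisson[OF s, of "Re \<xi>"]
    by (simp only: integral_mult_right_zero integral_complex_of_real add_0)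
  also have "\<dots> = 2 * of_real pi * \<i> * G \<xi>"
    using s by (simp add: s_def complex_diff_cnj)
  finally show ?thesis .
qed

subsection \<open>The reproducing formula on the half-plane\<close>

text \<open>G may be arbitrary outside S, and need not be measurable there; the zeros of \<phi> hide
  this. It is applied to holomorphic functions represented by total functions.\<close>

lemma borel_measurable_mult_vanishing:
  fixes \<phi> G :: "'a::euclidean_space \<Rightarrow> complex"
  assumes [measurable]: "\<phi> \<in> borel_measurable borel" and S: "open S" "continuous_on S G"
    and z: "\<And>x. x \<notin> S \<Longrightarrow> \<phi> x = 0"
  shows "(\<lambda>x. \<phi> x * G x) \<in> borel_measurable borel"
proof -
  have [measurable]: "(\<lambda>x. if x \<in> S then G x else 0) \<in> borel_measurable borel"
    using S by (intro borel_measurable_continuous_on_if) auto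
  have "(\<lambda>x. \<phi> x * (if x \<in> S then G x else 0)) \<in> borel_measurable borel" by measurable
  moreover have "(\<lambda>x. \<phi> x * (if x \<in> S then G x else 0)) = (\<lambda>x. \<phi> x * G x)" using z by auto
  ultimately show ?thesis by simp
qed

lemma integral_complex_split:
  fixes f :: "complex \<Rightarrow> complex"
  assumes f: "integrable lborel f"
  shows "(LINT w|lborel. f w) = (LINT y|lborel. (LINT x|lborel. f (Complex x y)))"
    and "(LINT w|lborel. f w) = (LINT x|lborel. (LINT y|lborel. f (Complex x y)))"
proof -
  have [measurable]: "f \<in> borel_measurable borel" using f by auto
  have m: "(\<lambda>(x, y). Complex x y) \<in> borel_measurable (lborel \<Otimes>\<^sub>M lborel)" by (simp add: lborel_prod)
  have "integrable (lborel \<Otimes>\<^sub>M lborel) (\<lambda>z. f ((\<lambda>(x, y). Complex x y) z))"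
    using f by (subst (asm) lborel_complex, subst (asm) integrable_distr_eq[OF m]) auto
  hence i: "integrable (lborel \<Otimes>\<^sub>M lborel) (\<lambda>(x, y). f (Complex x y))" by (simp add: case_prod_beta')
  have e: "(LINT w|lborel. f w) = integral\<^sup>L (lborel \<Otimes>\<^sub>M lborel) (\<lambda>(x, y). f (Complex x y))"
    by (subst lborel_complex, subst integral_distr[OF m]) (auto simp: case_prod_beta')
  show "(LINT w|lborel. f w) = (LINT y|lborel. (LINT x|lborel. f (Complex x y)))"
    unfolding e by (rule lborel_pair.integral_snd[OF i, symmetric])
  show "(LINT w|lborel. f w) = (LINT x|lborel. (LINT y|lborel. f (Complex x y)))"
    unfolding e by (rule lborel_pair.integral_fst[OF i, symmetric])
qed

lemma norm_powr_of_real [simp]: "cmod (z powr complex_of_real s) = cmod z powr s"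
  by (simp add: norm_powr_real_powr')

lemma Re_pos_not_nonpos_Reals: "Re z > 0 \<Longrightarrow> z \<notin> \<real>\<^sub>\<le>\<^sub>0"
  by (auto simp: complex_nonpos_Reals_iff)

text \<open>The antiderivative is a multiple of \<open>(v / (v + A))\<^sup>g\<^sup>+\<^sup>1\<close>.\<close>

lemma integral_pos_powr_complex:
  fixes A :: complex and g :: real
  assumes A: "Re A > 0" and g: "g > -1"
  shows "(LINT v|lborel. of_real (pos_powr v g) * (of_real v + A) powr of_real (- (g + 2))) = 1 / (of_real (g + 1) * A)"
proof -
  define f where "f v = of_real (v powr g) * (of_real v + A) powr of_real (- (g + 2))" for v :: real
  define W where "W v = of_real v / (of_real v + A)" for v :: real
  define F where "F v = W v powr of_real (g + 1) / (of_real (g + 1) * A)" for v :: real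
  have A0: "A \<noteq> 0" using A by auto
  have int: "integrable lborel (\<lambda>v. of_real (pos_powr v g) * (of_real v + A) powr of_real (- (g + 2)))"
  proof (rule integrable_dominated[where g = "\<lambda>v. pos_powr v g * (Re A + v) powr (- (g + 2))"])
    fix v
    show "norm (complex_of_real (pos_powr v g) * (of_real v + A) powr of_real (- (g + 2))) \<le> pos_powr v g * (Re A + v) powr (- (g + 2))"
    proof (cases "v > 0")
      case True
      have "Re A + v \<le> cmod (of_real v + A)" using complex_Re_le_cmod[of "of_real v + A"] by simp
      hence "cmod (of_real v + A) powr (- (g + 2)) \<le> (Re A + v) powr (- (g + 2))"
        using True A g by (intro powr_mono2') auto
      thus ?thesis unfolding norm_mult norm_powr_of_real by (simp add: mult_left_mono)
    qed (simp add: pos_powr_def)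
    show "(\<integral>\<^sup>+v. ennreal (pos_powr v g * (Re A + v) powr (- (g + 2))) \<partial>lborel) < \<infinity>"
      using nn_integral_pos_powr_powr[OF A g, of "g + 2" 0] by (auto intro: le_less_trans)
  qed measurable
  have eq: "indicator (einterval 0 \<infinity>) v *\<^sub>R f v = of_real (pos_powr v g) * (of_real v + A) powr of_real (- (g + 2))" for v
    by (auto simp: f_def pos_powr_def einterval_def zero_ereal_def split: split_indicator)
  have nz: "of_real v + A \<noteq> 0" "Re (of_real v + A) > 0" if "v > 0" for v
  proof -
    show "Re (of_real v + A) > 0" using that A by simp
    thus "of_real v + A \<noteq> 0" by (metis less_irrefl zero_complex.sel(1))
  qed
  have W_inv: "W v = inverse ((of_real v + A) / of_real v)" for v by (simp add: W_def)
  \<comment> \<open>W v is the inverse of a number with positive real part, so the principal power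
    is differentiable along the whole path.\<close>
  have ReW: "Re (W v) > 0" if v: "v > 0" for v
  proof -
    have "Re ((of_real v + A) / of_real v) > 0" using nz[OF v] v by simp
    moreover have "Re (inverse y) > 0" if "Re y > 0" for y
      using that by (auto simp: Re_complex_div_gt_0 inverse_complex.sel intro!: divide_pos_pos add_pos_nonneg)
    ultimately show ?thesis unfolding W_inv by blast
  qed
  have "(LBINT v=0..\<infinity>. f v) = 1 / (of_real (g + 1) * A) - 0"
  proof (rule interval_integral_FTC_integrable[where F = F])
    fix v assume "(0::ereal) < ereal v"
    hence v: "v > 0" by simp
    have "((\<lambda>z. z / (z + A)) has_field_derivative A / (of_real v + A)\<^sup>2) (at (of_real v))"
      using nz[OF v] by (auto intro!: derivative_eq_intros simp: power2_eq_square)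
    moreover have "((\<lambda>z. z powr of_real (g + 1)) has_field_derivative of_real (g + 1) * W v powr (of_real (g + 1) - 1)) (at (of_real v / (of_real v + A)))"
      using has_field_derivative_powr[OF Re_pos_not_nonpos_Reals[OF ReW[OF v]], of "of_real (g + 1)"] by (simp add: W_def)
    ultimately have "((\<lambda>z. (z / (z + A)) powr of_real (g + 1)) has_field_derivative of_real (g + 1) * W v powr (of_real (g + 1) - 1) * (A / (of_real v + A)\<^sup>2)) (at (of_real v))"
      using DERIV_chain2 by fastforce
    from DERIV_cdivide[OF this, of "of_real (g + 1) * A"]
    have "((\<lambda>z. (z / (z + A)) powr of_real (g + 1) / (of_real (g + 1) * A)) has_field_derivative
       of_real (g + 1) * W v powr (of_real (g + 1) - 1) * (A / (of_real v + A)\<^sup>2) / (of_real (g + 1) * A)) (at (of_real v))" .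
    also have "of_real (g + 1) * W v powr (of_real (g + 1) - 1) * (A / (of_real v + A)\<^sup>2) / (of_real (g + 1) * A) = f v"
    proof -
      \<comment> \<open>Since v is positive and all arguments avoid the cut, Ln (W v) = ln v - L
        holds without a multiple of 2 pi i. This is what allows the principal powers to be split and
        recombined.\<close>
      define L where "L = Ln (of_real v + A)"
      have eL: "exp L = of_real v + A" using nz[OF v] by (simp add: L_def)
      have g1: "complex_of_real (g + 1) \<noteq> 0" using g by (simp add: of_real_eq_0_iff del: of_real_add)
      have W0: "W v \<noteq> 0" using ReW[OF v] by auto
      have "Ln (W v) = - Ln ((of_real v + A) / of_real v)" unfolding W_inv
        using nz[OF v] v by (intro Ln_inverse Re_pos_not_nonpos_Reals) simp
      also have "Ln ((of_real v + A) / of_real v) = L - of_real (ln v)"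
        using Ln_divide_of_real[of v "of_real v + A"] nz[OF v] v by (simp add: L_def)
      finally have LW: "Ln (W v) = of_real (ln v) - L" by simp
      have "W v powr (of_real (g + 1) - 1) = exp (of_real g * (of_real (ln v) - L))"
        using W0 by (simp add: powr_def LW)
      also have "\<dots> = of_real (v powr g) * exp (- of_real g * L)"
        using v by (simp add: powr_def exp_of_real[symmetric] exp_add[symmetric] algebra_simps)
      finally have 1: "W v powr (of_real (g + 1) - 1) = of_real (v powr g) * exp (- of_real g * L)" .
      have "(of_real v + A) powr of_real (- (g + 2)) = exp (- of_real g * L) * exp (- (2 * L))"
        using nz[OF v] by (simp add: powr_def L_def exp_add[symmetric] algebra_simps)
      also have "exp (- (2 * L)) = inverse ((of_real v + A)\<^sup>2)"
        by (simp only: exp_minus exp_double eL)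
      finally have "f v = of_real (v powr g) * exp (- of_real g * L) * inverse ((of_real v + A)\<^sup>2)"
        by (simp add: f_def)
      thus ?thesis unfolding 1 using g1 A0 nz[OF v] by (simp add: field_simps del: of_real_add)
    qed
    finally have "((\<lambda>z. (z / (z + A)) powr of_real (g + 1) / (of_real (g + 1) * A)) has_field_derivative f v) (at (of_real v))" .
    from has_vector_derivative_real_field[OF this] show "(F has_vector_derivative f v) (at v)"
      by (simp add: F_def[abs_def] W_def)
    have "isCont (\<lambda>z. (z + A) powr of_real (- (g + 2))) (of_real v)"
    proof -
      have "((\<lambda>z. z powr of_real (- (g + 2))) has_field_derivative of_real (- (g + 2)) * (of_real v + A) powr (of_real (- (g + 2)) - 1)) (at (of_real v + A))"
        by (rule has_field_derivative_powr[OF Re_pos_not_nonpos_Reals[OF nz(2)[OF v]]])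
      hence "isCont (\<lambda>z. z powr of_real (- (g + 2))) (of_real v + A)" by (rule DERIV_isCont)
      moreover have "isCont (\<lambda>z. z + A) (of_real v)" by (intro continuous_intros)
      ultimately show ?thesis
        using isCont_o2[where f = "\<lambda>z. z + A" and g = "\<lambda>z. z powr of_real (- (g + 2))"] by blast
    qed
    moreover have "isCont complex_of_real v" by (intro continuous_intros)
    ultimately have "isCont (\<lambda>v. (of_real v + A) powr of_real (- (g + 2))) v"
      using isCont_o2[where f = complex_of_real and g = "\<lambda>z. (z + A) powr of_real (- (g + 2))"] by blast
    moreover have "isCont (\<lambda>v. complex_of_real (v powr g)) v" using v by (intro continuous_intros) auto
    ultimately show "isCont f v" unfolding f_def[abs_def] by (intro isCont_mult)
  next
    show "set_integrable lborel (einterval 0 \<infinity>) f"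
      using int unfolding set_integrable_def eq .
    have W0: "((\<lambda>v. cmod (W v)) \<longlongrightarrow> 0) (at_right 0)"
    proof -
      have "((\<lambda>v. of_real v / (of_real v + A)) \<longlongrightarrow> of_real 0 / (of_real 0 + A)) (at_right 0)"
        using A0 by (intro tendsto_intros) auto
      thus ?thesis unfolding W_def by (intro tendsto_norm_zero) simp
    qed
    have "((\<lambda>v. cmod (W v) powr (g + 1)) \<longlongrightarrow> 0) (at_right 0)"
      using g by (intro tendsto_zero_powrI[OF W0 tendsto_const]) auto
    hence "((\<lambda>v. cmod (W v powr of_real (g + 1))) \<longlongrightarrow> 0) (at_right 0)"
      by (simp only: norm_powr_of_real)
    hence "((\<lambda>v. W v powr of_real (g + 1)) \<longlongrightarrow> 0) (at_right 0)" by (rule tendsto_norm_zero_cancel)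
    hence "(F \<longlongrightarrow> 0) (at_right 0)" unfolding F_def[abs_def] by (rule tendsto_divide_zero)
    thus "((F \<circ> real_of_ereal) \<longlongrightarrow> 0) (at_right 0)"
      by (simp add: zero_ereal_def ereal_tendsto_simps)
    have "((\<lambda>v. inverse (1 + of_real (inverse v) * A)) \<longlongrightarrow> inverse (1 + of_real 0 * A)) at_top"
      by (intro tendsto_intros tendsto_inverse_0_at_top filterlim_ident) simp
    moreover have "\<forall>\<^sub>F v in at_top. inverse (1 + of_real (inverse v) * A) = W v"
      using eventually_gt_at_top[of 0] by eventually_elim (simp add: W_inv field_simps)
    ultimately have "(W \<longlongrightarrow> 1) at_top" by (simp add: tendsto_cong)
    moreover have "isCont (\<lambda>z. z powr complex_of_real (g + 1)) 1"
      by (rule DERIV_isCont[OF has_field_derivative_powr]) simp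
    ultimately have "((\<lambda>v. W v powr of_real (g + 1)) \<longlongrightarrow> 1 powr of_real (g + 1)) at_top"
      by (rule isCont_tendsto_compose[rotated])
    hence "(F \<longlongrightarrow> 1 / (of_real (g + 1) * A)) at_top"
      unfolding F_def[abs_def] using g A0 by (intro tendsto_divide) (auto simp: of_real_eq_0_iff simp del: of_real_add)
    thus "((F \<circ> real_of_ereal) \<longlongrightarrow> 1 / (of_real (g + 1) * A)) (at_left \<infinity>)"
      by (simp add: ereal_tendsto_simps)
  qed auto
  thus ?thesis by (simp add: interval_lebesgue_integral_def set_lebesgue_integral_def eq)
qed

text \<open>The Bergman kernel of the upper half-plane for the weight
  \<open>Im \<eta> powr g\<close>, up to its constant: the case n = 1 of \<open>rho2\<close>, raised
  to -(n + 1 + g).\<close>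

definition half_plane_kernel :: "real \<Rightarrow> complex \<Rightarrow> complex \<Rightarrow> complex" where
  "half_plane_kernel g \<xi> \<eta> = (- (\<i> / 2) * (\<xi> - cnj \<eta>)) powr of_real (- (g + 2))"

lemma half_plane_kernel_measurable [measurable]: "half_plane_kernel g \<xi> \<in> borel_measurable borel"
  unfolding half_plane_kernel_def[abs_def] by measurable

text \<open>The growth factor \<open>Im \<eta> powr (- a)\<close> leaves an excess a in the
  exponent. Half of it is given to the height, q = (g - a) + 1 + a / 2, and half to the real part, p
  = 1 + a / 2; together q + p = g + 2.\<close>

lemma half_plane_kernel_integrable:
  assumes \<xi>: "Im \<xi> > 0" and a: "0 < a" "a < g + 1"
  shows "(\<integral>\<^sup>+\<eta>. ennreal (pos_powr (Im \<eta>) (g - a) * cmod (half_plane_kernel g \<xi> \<eta>)) \<partial>lborel) < \<infinity>"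
proof -
  define q where "q = g + 1 - a / 2"
  define p where "p = 1 + a / 2"
  define r where "r = Im \<xi>"
  have r: "r > 0" using \<xi> by (simp add: r_def)
  have pw: "cmod (half_plane_kernel g \<xi> \<eta>) \<le> 4 powr (g + 2) * ((r + Im \<eta>) powr (- q) * (r + \<bar>Re \<eta> - Re \<xi>\<bar>) powr (- p))" if "Im \<eta> > 0" for \<eta>
  proof -
    define X where "X = cmod (- (\<i> / 2) * (\<xi> - cnj \<eta>))"
    have 1: "X \<ge> (r + Im \<eta>) / 2"
    proof -
      have "Re (- (\<i> / 2) * (\<xi> - cnj \<eta>)) = (r + Im \<eta>) / 2" by (simp add: r_def field_simps)
      thus ?thesis using complex_Re_le_cmod[of "- (\<i> / 2) * (\<xi> - cnj \<eta>)"] by (simp only: X_def)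
    qed
    have 2: "X \<ge> \<bar>Re \<eta> - Re \<xi>\<bar> / 2"
    proof -
      have "\<bar>Im (- (\<i> / 2) * (\<xi> - cnj \<eta>))\<bar> = \<bar>Re \<eta> - Re \<xi>\<bar> / 2" by (simp add: field_simps)
      thus ?thesis using abs_Im_le_cmod[of "- (\<i> / 2) * (\<xi> - cnj \<eta>)"] by (simp only: X_def)
    qed
    have X: "X \<ge> (r + Im \<eta>) / 4" "X \<ge> (r + \<bar>Re \<eta> - Re \<xi>\<bar>) / 4"
    proof -
      have "r + Im \<eta> \<le> 2 * X" "\<bar>Re \<eta> - Re \<xi>\<bar> \<le> 2 * X" using 1 2 by simp_all
      hence "r + Im \<eta> \<le> 4 * X" "r + \<bar>Re \<eta> - Re \<xi>\<bar> \<le> 4 * X" using r that by simp_all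
      thus "X \<ge> (r + Im \<eta>) / 4" "X \<ge> (r + \<bar>Re \<eta> - Re \<xi>\<bar>) / 4" by simp_all
    qed
    have "cmod (half_plane_kernel g \<xi> \<eta>) = X powr (- q) * X powr (- p)"
      unfolding half_plane_kernel_def norm_powr_of_real X_def[symmetric] powr_add[symmetric] by (simp add: q_def p_def algebra_simps)
    also have "\<dots> \<le> ((r + Im \<eta>) / 4) powr (- q) * ((r + \<bar>Re \<eta> - Re \<xi>\<bar>) / 4) powr (- p)"
      using X r that a by (intro mult_mono powr_mono2') (auto simp: q_def p_def)
    also have "\<dots> = (4 powr q * 4 powr p) * ((r + Im \<eta>) powr (- q) * (r + \<bar>Re \<eta> - Re \<xi>\<bar>) powr (- p))"
      using r that by (simp add: powr_divide powr_minus field_simps)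
    also have "4 powr q * 4 powr p = (4::real) powr (g + 2)" unfolding powr_add[symmetric] by (simp add: q_def p_def add.commute)
    finally show ?thesis .
  qed
  have "(\<integral>\<^sup>+\<eta>. ennreal (pos_powr (Im \<eta>) (g - a) * cmod (half_plane_kernel g \<xi> \<eta>)) \<partial>lborel)
     \<le> (\<integral>\<^sup>+\<eta>. ennreal (4 powr (g + 2)) * ennreal (pos_powr (Im \<eta> - 0) (g - a) * (r + (Im \<eta> - 0)) powr (- q) * (r + \<bar>Re \<eta> - Re \<xi>\<bar>) powr (- p)) \<partial>lborel)"
  proof (rule nn_integral_mono)
    fix \<eta> :: complex
    have "pos_powr (Im \<eta>) (g - a) * cmod (half_plane_kernel g \<xi> \<eta>) \<le> 4 powr (g + 2) * (pos_powr (Im \<eta>) (g - a) * (r + Im \<eta>) powr (- q) * (r + \<bar>Re \<eta> - Re \<xi>\<bar>) powr (- p))"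
    proof (cases "Im \<eta> > 0")
      case True
      from mult_left_mono[OF pw[OF True], of "pos_powr (Im \<eta>) (g - a)"] show ?thesis by (simp add: mult_ac)
    qed (simp add: pos_powr_def)
    thus "ennreal (pos_powr (Im \<eta>) (g - a) * cmod (half_plane_kernel g \<xi> \<eta>)) \<le> ennreal (4 powr (g + 2)) * ennreal (pos_powr (Im \<eta> - 0) (g - a) * (r + (Im \<eta> - 0)) powr (- q) * (r + \<bar>Re \<eta> - Re \<xi>\<bar>) powr (- p))"
      by (simp add: ennreal_mult'[symmetric])
  qed
  also have "\<dots> = ennreal (4 powr (g + 2)) * (\<integral>\<^sup>+\<eta>. ennreal (pos_powr (Im \<eta> - 0) (g - a) * (r + (Im \<eta> - 0)) powr (- q) * (r + \<bar>Re \<eta> - Re \<xi>\<bar>) powr (- p)) \<partial>lborel)"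
    by (rule nn_integral_cmult) auto
  also have "\<dots> < \<infinity>"
  proof -
    have "(\<integral>\<^sup>+\<eta>. ennreal (pos_powr (Im \<eta> - 0) (g - a) * (r + (Im \<eta> - 0)) powr (- q) * (r + \<bar>Re \<eta> - Re \<xi>\<bar>) powr (- p)) \<partial>lborel) < \<infinity>"
      by (rule le_less_trans[OF nn_integral_half_plane]) (use r a in \<open>auto simp: q_def p_def\<close>)
    thus ?thesis by (simp add: ennreal_mult_less_top)
  qed
  finally show ?thesis .
qed

text \<open>On the line Im \<eta> = y the conjugate is cnj \<eta> = \<eta> - 2 \<i> y, so the kernel
  is there the restriction of a holomorphic function, and the line can be lowered to the real axis.
  Then G no longer depends on y, the integral over y is explicit and leaves a multiple of 1 / (x -
  \<xi>), and the Cauchy formula on the real line gives G \<xi>. The constant is (-2 \<i> / (g + 1))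
  * (2 pi \<i>) = 4 pi / (g + 1).\<close>

lemma half_plane_reproducing_decay:
  fixes G :: "complex \<Rightarrow> complex"
  assumes \<delta>: "\<delta> > 0" and hol: "G holomorphic_on {\<zeta>. Im \<zeta> > - \<delta>}"
    and bd: "\<And>\<zeta>. Im \<zeta> \<ge> 0 \<Longrightarrow> cmod (G \<zeta>) \<le> B / (1 + cmod \<zeta>)\<^sup>2"
    and \<xi>: "Im \<xi> > 0" and g: "g > -1"
  shows "(LINT \<eta>|lborel. of_real (pos_powr (Im \<eta>) g) * half_plane_kernel g \<xi> \<eta> * G \<eta>) = of_real (4 * pi / (g + 1)) * G \<xi>"
proof -
  define f where "f \<eta> = of_real (pos_powr (Im \<eta>) g) * half_plane_kernel g \<xi> \<eta> * G \<eta>" for \<eta>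
  define A where "A x = - (\<i> / 2) * (\<xi> - of_real x)" for x :: real
  define K where "K x y = (of_real y + A x) powr of_real (- (g + 2))" for x y :: real
  \<comment> \<open>The integrand after every horizontal line has been lowered to the real axis; the
    weight still sees the original height.\<close>
  define f2 where "f2 w = of_real (pos_powr (Im w) g) * K (Re w) (Im w) * G (of_real (Re w))" for w
  have B: "B \<ge> 0" using order_trans[OF norm_ge_zero bd[of 0]] by simp
  have cG: "continuous_on {\<zeta>. Im \<zeta> > - \<delta>} G" using hol by (rule holomorphic_on_imp_continuous_on)
  have opn: "open {\<zeta>. Im \<zeta> > - \<delta>}" by (rule open_halfspace_Im_gt)
  have int1: "integrable lborel f"
  proof -
    \<comment> \<open>An auxiliary growth exponent, used for integrability only: as a is at most 1,
      the decay of G is stronger than \<open>Im \<eta> powr (- a)\<close>.\<close>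
    define a where "a = min 1 ((g + 1) / 2)"
    have a: "0 < a" "a < g + 1" "a \<le> 1" using g by (auto simp: a_def min_def)
    show ?thesis
    proof (rule integrable_dominated[where g = "\<lambda>\<eta>. B * (pos_powr (Im \<eta>) (g - a) * cmod (half_plane_kernel g \<xi> \<eta>))"])
      have c: "continuous_on {\<zeta>. Im \<zeta> > 0} G" by (rule continuous_on_subset[OF cG]) (use \<delta> in auto)
      show "f \<in> borel_measurable lborel" unfolding f_def[abs_def] measurable_lborel2
        by (rule borel_measurable_mult_vanishing[where \<phi> = "\<lambda>\<eta>. of_real (pos_powr (Im \<eta>) g) * half_plane_kernel g \<xi> \<eta>" and S = "{\<zeta>. Im \<zeta> > 0}"])
           (auto simp: pos_powr_def c open_halfspace_Im_gt)
      show "norm (f \<eta>) \<le> B * (pos_powr (Im \<eta>) (g - a) * cmod (half_plane_kernel g \<xi> \<eta>))" for \<eta>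
      proof (cases "Im \<eta> > 0")
        case True
        have "Im \<eta> powr a \<le> (1 + Im \<eta>) powr a" using True a by (intro powr_mono2) auto
        also have "\<dots> \<le> (1 + Im \<eta>) powr 2" using True a by (intro powr_mono) auto
        also have "\<dots> = (1 + Im \<eta>)\<^sup>2" using True by simp
        also have "\<dots> \<le> (1 + cmod \<eta>)\<^sup>2" using True abs_Im_le_cmod[of \<eta>] by (intro power_mono) auto
        finally have "B / (1 + cmod \<eta>)\<^sup>2 \<le> B / Im \<eta> powr a" using True B
          by (intro divide_left_mono mult_pos_pos zero_less_power add_pos_nonneg) auto
        hence "cmod (G \<eta>) \<le> B * Im \<eta> powr (- a)" using bd[of \<eta>] True by (simp add: powr_minus divide_inverse)
        hence "norm (f \<eta>) \<le> Im \<eta> powr g * cmod (half_plane_kernel g \<xi> \<eta>) * (B * Im \<eta> powr (- a))"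
          using True by (simp add: f_def norm_mult pos_powr_def mult_left_mono)
        also have "\<dots> = B * ((Im \<eta> powr g * Im \<eta> powr (- a)) * cmod (half_plane_kernel g \<xi> \<eta>))" by simp
        finally show ?thesis using True by (simp add: pos_powr_def powr_add[symmetric])
      qed (simp add: f_def pos_powr_def)
      show "(\<integral>\<^sup>+\<eta>. ennreal (B * (pos_powr (Im \<eta>) (g - a) * cmod (half_plane_kernel g \<xi> \<eta>))) \<partial>lborel) < \<infinity>"
        using half_plane_kernel_integrable[OF \<xi> a(1,2)] B
        by (subst ennreal_mult', simp, subst nn_integral_cmult) (auto simp: ennreal_mult_less_top)
    qed
  qed
  have mGr: "(\<lambda>w. G (of_real (Re w))) \<in> borel_measurable borel"
    by (intro borel_measurable_continuous_onI continuous_on_compose2[OF cG] continuous_intros) (use \<delta> in auto)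
  have int2: "integrable lborel f2"
  proof -
    \<comment> \<open>One r serves both factors: r + y is at most the real part of y + A x because r
      <= Im \<xi> / 2, and r + |x| <= 1 + |x| because r <= 1.\<close>
    define r where "r = min 1 (Im \<xi> / 2)"
    have r: "r > 0" "r \<le> 1" "r \<le> Im \<xi> / 2" using \<xi> by (auto simp: r_def)
    show ?thesis
    proof (rule integrable_dominated[where g = "\<lambda>w. B * (pos_powr (Im w - 0) g * (r + (Im w - 0)) powr (- (g + 2)) * (r + \<bar>Re w - 0\<bar>) powr (- 2))"])
      show "f2 \<in> borel_measurable lborel" unfolding f2_def[abs_def] K_def A_def using mGr by measurable
      show "norm (f2 w) \<le> B * (pos_powr (Im w - 0) g * (r + (Im w - 0)) powr (- (g + 2)) * (r + \<bar>Re w - 0\<bar>) powr (- 2))" for w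
      proof (cases "Im w > 0")
        case True
        have "r + Im w \<le> cmod (of_real (Im w) + A (Re w))"
          using complex_Re_le_cmod[of "of_real (Im w) + A (Re w)"] r by (simp add: A_def)
        hence 1: "cmod (K (Re w) (Im w)) \<le> (r + Im w) powr (- (g + 2))"
          unfolding K_def norm_powr_of_real using r True g by (intro powr_mono2') auto
        have "cmod (G (of_real (Re w))) \<le> B / (1 + \<bar>Re w\<bar>)\<^sup>2" using bd[of "of_real (Re w)"] by simp
        also have "\<dots> \<le> B / (r + \<bar>Re w\<bar>)\<^sup>2" using r B
          by (intro divide_left_mono power_mono mult_pos_pos zero_less_power add_pos_nonneg) auto
        also have "\<dots> = B * (r + \<bar>Re w\<bar>) powr (- 2)"
        proof -
          have "r + \<bar>Re w\<bar> > 0" using r by (intro add_pos_nonneg) auto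
          thus ?thesis by (simp add: powr_minus divide_inverse)
        qed
        finally have "norm (f2 w) \<le> pos_powr (Im w) g * (r + Im w) powr (- (g + 2)) * (B * (r + \<bar>Re w\<bar>) powr (- 2))"
          unfolding f2_def norm_mult using 1 by (intro mult_mono) auto
        thus ?thesis by (simp add: mult_ac)
      qed (simp add: f2_def pos_powr_def)
      have "(\<integral>\<^sup>+w. ennreal (pos_powr (Im w - 0) g * (r + (Im w - 0)) powr (- (g + 2)) * (r + \<bar>Re w - 0\<bar>) powr (- 2)) \<partial>lborel) < \<infinity>"
        by (rule le_less_trans[OF nn_integral_half_plane]) (use r g in auto)
      thus "(\<integral>\<^sup>+w. ennreal (B * (pos_powr (Im w - 0) g * (r + (Im w - 0)) powr (- (g + 2)) * (r + \<bar>Re w - 0\<bar>) powr (- 2))) \<partial>lborel) < \<infinity>"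
        using B by (subst ennreal_mult', simp, subst nn_integral_cmult) (auto simp: ennreal_mult_less_top)
    qed
  qed
  have "(LINT x|lborel. f (Complex x y)) = (LINT x|lborel. f2 (Complex x y))" for y
  proof (cases "y > 0")
    case True
    define H where "H \<zeta> = (- (\<i> / 2) * (\<xi> - \<zeta> + 2 * \<i> * of_real y)) powr of_real (- (g + 2)) * G \<zeta>" for \<zeta>
    have e1: "f (Complex x y) = of_real (pos_powr y g) * H (Complex x y)" for x
    proof -
      have "\<xi> - cnj (Complex x y) = \<xi> - Complex x y + 2 * \<i> * of_real y" by (simp add: complex_eq_iff)
      thus ?thesis by (simp only: f_def H_def half_plane_kernel_def mult.assoc complex.sel)
    qed
    have e2: "f2 (Complex x y) = of_real (pos_powr y g) * H (Complex x 0)" for x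
    proof -
      have "of_real y + A x = - (\<i> / 2) * (\<xi> - Complex x 0 + 2 * \<i> * of_real y)" by (simp add: A_def complex_eq_iff field_simps)
      thus ?thesis by (simp add: f2_def H_def K_def complex_of_real_def mult.assoc)
    qed
    have "(LINT x|lborel. H (Complex x y)) = (LINT x|lborel. H (Complex x 0))"
    \<comment> \<open>Below the height Im \<xi> + 2 y the base of the power has positive real part;
      the lower limit -\<delta> comes from the domain of G.\<close>
    proof (rule horizontal_line_integral_shift[where S = "{\<zeta>. Im \<zeta> > - \<delta>} \<inter> {\<zeta>. Im \<zeta> < Im \<xi> + 2 * y}" and p = 2 and B = "B * (Im \<xi> / 2) powr (- (g + 2))"])
      show "open ({\<zeta>. Im \<zeta> > - \<delta>} \<inter> {\<zeta>. Im \<zeta> < Im \<xi> + 2 * y})"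
        by (intro open_Int open_halfspace_Im_gt open_halfspace_Im_lt)
      show "convex ({\<zeta>. Im \<zeta> > - \<delta>} \<inter> {\<zeta>. Im \<zeta> < Im \<xi> + 2 * y})"
        by (intro convex_Int convex_halfspace_Im_gt convex_halfspace_Im_lt)
      show "H holomorphic_on ({\<zeta>. Im \<zeta> > - \<delta>} \<inter> {\<zeta>. Im \<zeta> < Im \<xi> + 2 * y})"
        unfolding H_def[abs_def]
        by (intro holomorphic_intros holomorphic_on_subset[OF hol] Re_pos_not_nonpos_Reals) auto
      fix \<zeta> assume z: "0 \<le> Im \<zeta>" "Im \<zeta> \<le> y"
      show "\<zeta> \<in> {\<zeta>. Im \<zeta> > - \<delta>} \<inter> {\<zeta>. Im \<zeta> < Im \<xi> + 2 * y}" using z \<delta> \<xi> True by auto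
      have "Im \<xi> / 2 \<le> cmod (- (\<i> / 2) * (\<xi> - \<zeta> + 2 * \<i> * of_real y))"
      proof -
        have "Re (- (\<i> / 2) * (\<xi> - \<zeta> + 2 * \<i> * of_real y)) = Im \<xi> / 2 + (y - Im \<zeta> / 2)" by (simp add: field_simps)
        hence "Im \<xi> / 2 \<le> Re (- (\<i> / 2) * (\<xi> - \<zeta> + 2 * \<i> * of_real y))" using z True by simp
        thus ?thesis using complex_Re_le_cmod order_trans by blast
      qed
      hence 1: "cmod (- (\<i> / 2) * (\<xi> - \<zeta> + 2 * \<i> * of_real y)) powr (- (g + 2)) \<le> (Im \<xi> / 2) powr (- (g + 2))"
        using \<xi> g by (intro powr_mono2') auto
      have "cmod (G \<zeta>) \<le> B / (1 + cmod \<zeta>)\<^sup>2" using bd z by simp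
      also have "\<dots> \<le> B / (1 + \<bar>Re \<zeta>\<bar>)\<^sup>2" using B abs_Re_le_cmod[of \<zeta>]
        by (intro divide_left_mono power_mono mult_pos_pos zero_less_power add_pos_nonneg) auto
      also have "\<dots> = B * (1 + \<bar>Re \<zeta>\<bar>) powr (- 2)" by (simp add: powr_minus divide_inverse)
      finally have "cmod (H \<zeta>) \<le> (Im \<xi> / 2) powr (- (g + 2)) * (B * (1 + \<bar>Re \<zeta>\<bar>) powr (- 2))"
        unfolding H_def norm_mult[of _ "G \<zeta>"] norm_powr_of_real using 1 by (intro mult_mono) auto
      thus "cmod (H \<zeta>) \<le> B * (Im \<xi> / 2) powr (- (g + 2)) * (1 + \<bar>Re \<zeta>\<bar>) powr (- 2)" by (simp add: mult_ac)
    qed (use True in auto)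
    thus ?thesis unfolding e1 e2 by (simp only: integral_mult_right_zero)
  qed (simp add: f_def f2_def pos_powr_def)
  hence "(LINT \<eta>|lborel. f \<eta>) = (LINT w|lborel. f2 w)"
    using integral_complex_split(1)[OF int1] integral_complex_split(1)[OF int2] by simp
  also have "\<dots> = (LINT x|lborel. (LINT y|lborel. f2 (Complex x y)))" by (rule integral_complex_split(2)[OF int2])
  also have "\<dots> = (LINT x|lborel. (- 2 * \<i> / of_real (g + 1)) * (G (of_real x) / (of_real x - \<xi>)))"
  proof (rule Bochner_Integration.integral_cong[OF refl])
    fix x :: real
    have ReA: "Re (A x) > 0" using \<xi> by (simp add: A_def)
    have "(LINT y|lborel. f2 (Complex x y)) = (LINT y|lborel. (of_real (pos_powr y g) * (of_real y + A x) powr of_real (- (g + 2))) * G (of_real x))"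
      by (simp add: f2_def K_def)
    also have "\<dots> = (LINT y|lborel. of_real (pos_powr y g) * (of_real y + A x) powr of_real (- (g + 2))) * G (of_real x)"
      by (rule integral_mult_left_zero)
    also have "\<dots> = 1 / (of_real (g + 1) * A x) * G (of_real x)"
      by (subst integral_pos_powr_complex[OF ReA g]) simp
    also have "\<dots> = (- 2 * \<i> / of_real (g + 1)) * (G (of_real x) / (of_real x - \<xi>))"
    proof -
      have "of_real x - \<xi> \<noteq> 0" "\<xi> - of_real x \<noteq> 0" using \<xi> by (auto simp: complex_eq_iff)
      hence "1 / A x = - 2 * \<i> / (of_real x - \<xi>)" by (simp add: A_def field_simps)
      moreover have "1 / (of_real (g + 1) * A x) * G (of_real x) = (1 / A x) * (G (of_real x) / of_real (g + 1))" by simp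
      ultimately show ?thesis by (simp add: mult_ac)
    qed
    finally show "(LINT y|lborel. f2 (Complex x y)) = (- 2 * \<i> / of_real (g + 1)) * (G (of_real x) / (of_real x - \<xi>))" .
  qed
  also have "\<dots> = (- 2 * \<i> / of_real (g + 1)) * (LINT x|lborel. G (of_real x) / (of_real x - \<xi>))"
    by (rule integral_mult_right_zero)
  also have "(LINT x|lborel. G (of_real x) / (of_real x - \<xi>)) = 2 * of_real pi * \<i> * G \<xi>"
  proof (rule Cauchy_formula_real_line[OF \<delta> hol _ \<xi>])
    fix \<zeta> :: complex assume "Im \<zeta> \<ge> 0"
    have "(1 + cmod \<zeta>) * 1 \<le> (1 + cmod \<zeta>) * (1 + cmod \<zeta>)" by (intro mult_left_mono) auto
    hence "B / (1 + cmod \<zeta>)\<^sup>2 \<le> B / (1 + cmod \<zeta>)"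
      using B unfolding power2_eq_square
      by (intro divide_left_mono mult_pos_pos add_pos_nonneg) auto
    thus "cmod (G \<zeta>) \<le> B / (1 + cmod \<zeta>)" using bd[OF \<open>Im \<zeta> \<ge> 0\<close>] by simp
  qed
  also have "(- 2 * \<i> / of_real (g + 1)) * (2 * of_real pi * \<i> * G \<xi>) = of_real (4 * pi / (g + 1)) * G \<xi>"
    by (simp add: mult_ac)
  finally show ?thesis by (simp only: f_def)
qed

text \<open>Regularization: translate upwards by \<open>\<delta>\<close> and divide by \<open>(1 - \<i> \<delta> \<eta>)\<^sup>2\<close>, then let \<open>\<delta>\<close> tend to 0.\<close>

lemma half_plane_reproducing:
  fixes G :: "complex \<Rightarrow> complex"
  assumes hol: "G holomorphic_on {\<zeta>. Im \<zeta> > 0}"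
    and bd: "\<And>\<zeta>. Im \<zeta> > 0 \<Longrightarrow> cmod (G \<zeta>) \<le> C * Im \<zeta> powr (- a)" and a: "0 < a" "a < g + 1"
    and \<xi>: "Im \<xi> > 0"
  shows "(LINT \<eta>|lborel. of_real (pos_powr (Im \<eta>) g) * half_plane_kernel g \<xi> \<eta> * G \<eta>) = of_real (4 * pi / (g + 1)) * G \<xi>"
proof -
  define d where "d k = 1 / (real k + 1)" for k
  define Gk where "Gk k \<eta> = G (\<eta> + \<i> * of_real (d k)) / (1 - \<i> * of_real (d k) * \<eta>)\<^sup>2" for k \<eta>
  have d: "d k > 0" "d k \<le> 1" for k by (auto simp: d_def)
  have C: "C \<ge> 0" using order_trans[OF norm_ge_zero bd[of \<i>]] by simp
  \<comment> \<open>The lower bound 1 gives a majorant that does not depend on k; the linear lower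
    bound gives, for each fixed k, the quadratic decay required by the preceding formula.\<close>
  have den: "cmod (1 - \<i> * of_real (d k) * \<eta>) \<ge> 1" "cmod (1 - \<i> * of_real (d k) * \<eta>) \<ge> d k / 2 * (1 + cmod \<eta>)" if "Im \<eta> \<ge> 0" for k \<eta>
  proof -
    have "Re (1 - \<i> * of_real (d k) * \<eta>) \<ge> 1" using d[of k] that by simp
    thus 1: "cmod (1 - \<i> * of_real (d k) * \<eta>) \<ge> 1" using complex_Re_le_cmod order_trans by blast
    have "(cmod (1 - \<i> * of_real (d k) * \<eta>))\<^sup>2 = (1 + d k * Im \<eta>)\<^sup>2 + (d k * Re \<eta>)\<^sup>2"
      by (simp add: cmod_power2)
    also have "\<dots> \<ge> (d k * Im \<eta>)\<^sup>2 + (d k * Re \<eta>)\<^sup>2"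
    proof -
      have "(d k * Im \<eta>)\<^sup>2 \<le> (1 + d k * Im \<eta>)\<^sup>2" using d[of k] that by (intro power_mono) auto
      thus ?thesis by simp
    qed
    also have "(d k * Im \<eta>)\<^sup>2 + (d k * Re \<eta>)\<^sup>2 = (d k * cmod \<eta>)\<^sup>2" by (simp add: power_mult_distrib cmod_power2 algebra_simps)
    finally have "d k * cmod \<eta> \<le> cmod (1 - \<i> * of_real (d k) * \<eta>)" by (rule power2_le_imp_le) simp
    moreover have "d k \<le> cmod (1 - \<i> * of_real (d k) * \<eta>)" using 1 d[of k] by linarith
    ultimately show "cmod (1 - \<i> * of_real (d k) * \<eta>) \<ge> d k / 2 * (1 + cmod \<eta>)" by (simp add: algebra_simps)
  qed
  have dom: "cmod (Gk k \<eta>) \<le> C * (Im \<eta> + d k) powr (- a)" if "Im \<eta> \<ge> 0" for k \<eta>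
  proof -
    have "cmod (Gk k \<eta>) = cmod (G (\<eta> + \<i> * of_real (d k))) / (cmod (1 - \<i> * of_real (d k) * \<eta>))\<^sup>2"
      by (simp add: Gk_def norm_divide norm_power)
    also have "\<dots> \<le> cmod (G (\<eta> + \<i> * of_real (d k))) / 1"
      using den(1)[OF that, of k] by (intro divide_left_mono) (auto simp: one_le_power)
    also have "\<dots> \<le> C * (Im \<eta> + d k) powr (- a)" using bd[of "\<eta> + \<i> * of_real (d k)"] d[of k] that by simp
    finally show ?thesis .
  qed
  have rep: "(LINT \<eta>|lborel. of_real (pos_powr (Im \<eta>) g) * half_plane_kernel g \<xi> \<eta> * Gk k \<eta>) = of_real (4 * pi / (g + 1)) * Gk k \<xi>" for k
  proof (rule half_plane_reproducing_decay[where \<delta> = "d k" and B = "C * d k powr (- a) * (2 / d k)\<^sup>2"])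
    \<comment> \<open>The zero of the denominator is at height -1 / d k, which is not above -d k
      because d k <= 1.\<close>
    have ne: "1 - \<i> * of_real (d k) * \<eta> \<noteq> 0" if "Im \<eta> > - d k" for \<eta>
    proof -
      have "d k * Im \<eta> > d k * (- d k)" using that d[of k] by (intro mult_strict_left_mono) auto
      moreover have "d k * d k \<le> 1" using d[of k] by (intro mult_le_one) auto
      ultimately have "Re (1 - \<i> * of_real (d k) * \<eta>) > 0" by simp
      thus ?thesis by (metis less_irrefl zero_complex.sel(1))
    qed
    have "(G \<circ> (\<lambda>\<eta>. \<eta> + \<i> * of_real (d k))) holomorphic_on {\<zeta>. Im \<zeta> > - d k}"
      by (rule holomorphic_on_compose_gen[OF _ hol]) (auto intro!: holomorphic_intros)
    thus "Gk k holomorphic_on {\<zeta>. Im \<zeta> > - d k}" unfolding Gk_def[abs_def]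
      using ne by (intro holomorphic_intros) (auto simp: o_def)
    fix \<zeta> :: complex assume z: "Im \<zeta> \<ge> 0"
    have "cmod (Gk k \<zeta>) = cmod (G (\<zeta> + \<i> * of_real (d k))) / (cmod (1 - \<i> * of_real (d k) * \<zeta>))\<^sup>2"
      by (simp add: Gk_def norm_divide norm_power)
    also have "\<dots> \<le> (C * d k powr (- a)) / (d k / 2 * (1 + cmod \<zeta>))\<^sup>2"
    proof (intro frac_le power_mono den z)
      have "cmod (G (\<zeta> + \<i> * of_real (d k))) \<le> C * (Im \<zeta> + d k) powr (- a)" using bd[of "\<zeta> + \<i> * of_real (d k)"] d[of k] z by simp
      also have "\<dots> \<le> C * d k powr (- a)" using C d[of k] z a by (intro mult_left_mono powr_mono2') auto
      finally show "cmod (G (\<zeta> + \<i> * of_real (d k))) \<le> C * d k powr (- a)" .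
      show "0 < (d k / 2 * (1 + cmod \<zeta>))\<^sup>2" using d[of k] by (intro zero_less_power mult_pos_pos add_pos_nonneg) auto
      show "0 \<le> d k / 2 * (1 + cmod \<zeta>)" using d[of k] by (intro mult_nonneg_nonneg) auto
    qed (use C in auto)
    also have "\<dots> = C * d k powr (- a) * (2 / d k)\<^sup>2 / (1 + cmod \<zeta>)\<^sup>2" by (simp add: power_mult_distrib power_divide)
    finally show "cmod (Gk k \<zeta>) \<le> C * d k powr (- a) * (2 / d k)\<^sup>2 / (1 + cmod \<zeta>)\<^sup>2" .
  qed (use d \<xi> a in auto)
  have dlim: "d \<longlonglongrightarrow> 0" unfolding d_def[abs_def] using LIMSEQ_inverse_real_of_nat by (simp add: inverse_eq_divide add.commute)
  have Glim: "(\<lambda>k. Gk k \<eta>) \<longlonglongrightarrow> G \<eta>" if "Im \<eta> > 0" for \<eta>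
  proof -
    have "isCont G \<eta>"
      using continuous_on_eq_continuous_at[OF open_halfspace_Im_gt[of 0], of G] holomorphic_on_imp_continuous_on[OF hol] that by auto
    moreover have "(\<lambda>k. \<eta> + \<i> * of_real (d k)) \<longlonglongrightarrow> \<eta> + \<i> * of_real 0" by (intro tendsto_intros dlim)
    ultimately have "(\<lambda>k. G (\<eta> + \<i> * of_real (d k))) \<longlonglongrightarrow> G \<eta>" by (intro isCont_tendsto_compose[of \<eta> G]) auto
    hence "(\<lambda>k. Gk k \<eta>) \<longlonglongrightarrow> G \<eta> / (1 - \<i> * of_real 0 * \<eta>)\<^sup>2" unfolding Gk_def by (intro tendsto_intros dlim) auto
    thus ?thesis by simp
  qed
  have meas: "(\<lambda>\<eta>. of_real (pos_powr (Im \<eta>) g) * half_plane_kernel g \<xi> \<eta> * F \<eta>) \<in> borel_measurable lborel" if "continuous_on {\<zeta>. Im \<zeta> > 0} F" for F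
    unfolding measurable_lborel2
    by (rule borel_measurable_mult_vanishing[where \<phi> = "\<lambda>\<eta>. of_real (pos_powr (Im \<eta>) g) * half_plane_kernel g \<xi> \<eta>" and S = "{\<zeta>. Im \<zeta> > 0}"])
       (auto simp: pos_powr_def that open_halfspace_Im_gt)
  have cG: "continuous_on {\<zeta>. Im \<zeta> > 0} G" using hol by (rule holomorphic_on_imp_continuous_on)
  have "(\<lambda>k. LINT \<eta>|lborel. of_real (pos_powr (Im \<eta>) g) * half_plane_kernel g \<xi> \<eta> * Gk k \<eta>)
      \<longlonglongrightarrow> (LINT \<eta>|lborel. of_real (pos_powr (Im \<eta>) g) * half_plane_kernel g \<xi> \<eta> * G \<eta>)"
  proof (rule integral_dominated_convergence[where w = "\<lambda>\<eta>. C * (pos_powr (Im \<eta>) (g - a) * cmod (half_plane_kernel g \<xi> \<eta>))"])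
    show "(\<lambda>\<eta>. of_real (pos_powr (Im \<eta>) g) * half_plane_kernel g \<xi> \<eta> * G \<eta>) \<in> borel_measurable lborel"
      by (rule meas[OF cG])
    show "(\<lambda>\<eta>. of_real (pos_powr (Im \<eta>) g) * half_plane_kernel g \<xi> \<eta> * Gk k \<eta>) \<in> borel_measurable lborel" for k
    proof (rule meas)
      have "continuous_on {\<zeta>. Im \<zeta> > 0} (\<lambda>\<eta>. G (\<eta> + \<i> * of_real (d k)))"
        by (rule continuous_on_compose2[OF cG]) (use d[of k] in \<open>auto intro!: continuous_intros add_pos_pos\<close>)
      moreover have "1 - \<i> * of_real (d k) * \<eta> \<noteq> 0" if "Im \<eta> > 0" for \<eta> using den(1)[of \<eta> k] that by auto
      ultimately show "continuous_on {\<zeta>. Im \<zeta> > 0} (Gk k)" unfolding Gk_def[abs_def] by (intro continuous_intros) auto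
    qed
    show "integrable lborel (\<lambda>\<eta>. C * (pos_powr (Im \<eta>) (g - a) * cmod (half_plane_kernel g \<xi> \<eta>)))"
      by (intro integrable_mult_right integrable_dominated[OF _ _ half_plane_kernel_integrable[OF \<xi> a]]) auto
    show "AE \<eta> in lborel. (\<lambda>k. of_real (pos_powr (Im \<eta>) g) * half_plane_kernel g \<xi> \<eta> * Gk k \<eta>) \<longlonglongrightarrow> of_real (pos_powr (Im \<eta>) g) * half_plane_kernel g \<xi> \<eta> * G \<eta>"
    proof (rule AE_I2)
      fix \<eta> :: complex
      show "(\<lambda>k. of_real (pos_powr (Im \<eta>) g) * half_plane_kernel g \<xi> \<eta> * Gk k \<eta>) \<longlonglongrightarrow> of_real (pos_powr (Im \<eta>) g) * half_plane_kernel g \<xi> \<eta> * G \<eta>"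
        by (cases "Im \<eta> > 0") (auto intro!: tendsto_intros Glim simp: pos_powr_def)
    qed
    show "AE \<eta> in lborel. norm (of_real (pos_powr (Im \<eta>) g) * half_plane_kernel g \<xi> \<eta> * Gk k \<eta>) \<le> C * (pos_powr (Im \<eta>) (g - a) * cmod (half_plane_kernel g \<xi> \<eta>))" for k
    proof (rule AE_I2)
      fix \<eta> :: complex
      show "norm (of_real (pos_powr (Im \<eta>) g) * half_plane_kernel g \<xi> \<eta> * Gk k \<eta>) \<le> C * (pos_powr (Im \<eta>) (g - a) * cmod (half_plane_kernel g \<xi> \<eta>))"
      proof (cases "Im \<eta> > 0")
        case True
        have "C * (Im \<eta> + d k) powr (- a) \<le> C * Im \<eta> powr (- a)"
          using True d[of k] C a by (intro mult_left_mono powr_mono2') auto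
        hence "cmod (Gk k \<eta>) \<le> C * Im \<eta> powr (- a)" using dom[of \<eta> k] True by simp
        hence "norm (of_real (pos_powr (Im \<eta>) g) * half_plane_kernel g \<xi> \<eta> * Gk k \<eta>) \<le> Im \<eta> powr g * cmod (half_plane_kernel g \<xi> \<eta>) * (C * Im \<eta> powr (- a))"
          using True by (simp add: norm_mult pos_powr_def mult_left_mono)
        also have "\<dots> = C * ((Im \<eta> powr g * Im \<eta> powr (- a)) * cmod (half_plane_kernel g \<xi> \<eta>))" by simp
        finally show ?thesis using True by (simp add: pos_powr_def powr_add[symmetric])
      qed (simp add: pos_powr_def)
    qed
  qed
  moreover have "(\<lambda>k. of_real (4 * pi / (g + 1)) * Gk k \<xi>) \<longlonglongrightarrow> of_real (4 * pi / (g + 1)) * G \<xi>"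
    by (intro tendsto_intros Glim \<xi>)
  ultimately show ?thesis unfolding rep by (rule LIMSEQ_unique)
qed

subsection \<open>The reproducing formula on the tube\<close>

lemma borel_measurable_vecI:
  fixes f :: "'b \<Rightarrow> 'a::euclidean_space^'n::finite"
  assumes "\<And>i. (\<lambda>x. f x $ i) \<in> borel_measurable M"
  shows "f \<in> borel_measurable M"
proof (subst borel_measurable_euclidean_space, intro ballI)
  fix b :: "'a^'n" assume "b \<in> Basis"
  then obtain i c where b: "b = axis i c" by (auto simp: Basis_vec_def)
  show "(\<lambda>x. f x \<bullet> b) \<in> borel_measurable M"
    unfolding b inner_axis using assms[of i] by (intro borel_measurable_inner) auto
qed

lemma has_derivative_vecI:
  fixes c :: "complex \<Rightarrow> complex^'n::finite"
  assumes "\<And>i. ((\<lambda>t. c t $ i) has_field_derivative d $ i) (at t)"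
  shows "(c has_derivative (\<lambda>h. h *s d)) (at t)"
proof (subst has_derivative_componentwise_within, intro ballI)
  fix b :: "complex^'n" assume "b \<in> Basis"
  then obtain i e where b: "b = axis i e" by (auto simp: Basis_vec_def)
  have "((\<lambda>t. c t $ i) has_derivative (\<lambda>h. h * d $ i)) (at t)"
    using assms[of i] by (simp add: has_field_derivative_def mult_commute_abs)
  hence "((\<lambda>t. c t $ i \<bullet> e) has_derivative (\<lambda>h. (h * d $ i) \<bullet> e)) (at t)"
    by (rule has_derivative_inner_left)
  thus "((\<lambda>x. c x \<bullet> b) has_derivative (\<lambda>x. (x *s d) \<bullet> b)) (at t)"
    by (simp add: b inner_axis)
qed

text \<open>Complex linearity of D turns the real chain rule into a complex derivative. All
  one-variable arguments, along discs, vertical half-planes and segments, pass through this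
  lemma.\<close>

lemma holomorphic_several_curve:
  fixes F :: "complex^'n::finite \<Rightarrow> complex"
  assumes D: "(F has_derivative D) (at (c t))" "\<And>a v. D (a *s v) = a * D v"
    and c: "\<And>i. ((\<lambda>t. c t $ i) has_field_derivative d $ i) (at t)"
  shows "((\<lambda>t. F (c t)) has_field_derivative D d) (at t)"
proof -
  have "(F \<circ> c has_derivative D \<circ> (\<lambda>h. h *s d)) (at t)"
    by (rule diff_chain_at[OF has_derivative_vecI[OF c] D(1)])
  moreover have "D \<circ> (\<lambda>h. h *s d) = (*) (D d)" by (auto simp: fun_eq_iff D(2))
  ultimately show ?thesis by (simp add: has_field_derivative_def o_def)
qed

lemma holomorphic_several_imp_continuous_on:
  "holomorphic_several F T \<Longrightarrow> continuous_on T F"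
  unfolding holomorphic_several_def
  by (intro continuous_at_imp_continuous_on ballI) (blast dest: has_derivative_continuous)

text \<open>Cauchy's formula at the centre of the unit circle, with the parameter in [0, 1] so that
  the angular measure is normalised, and as a Lebesgue integral so that Fubini applies.\<close>

lemma circle_mean_value:
  assumes S: "open S" "cball 0 1 \<subseteq> S" and g: "g holomorphic_on S"
  shows "(LINT x|lborel. indicator {0..1} x *\<^sub>R g (cis (2 * pi * x))) = g 0"
proof -
  have e: "circlepath 0 1 x = cis (2 * pi * x)" for x by (simp add: circlepath cis_conv_exp mult_ac)
  have "((\<lambda>u. g u / (u - 0)) has_contour_integral (2 * of_real pi * \<i> * g 0)) (circlepath 0 1)"
    by (rule Cauchy_integral_circlepath_simple[OF holomorphic_on_subset[OF g S(2)]]) simp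
  hence "((\<lambda>x. g (cis (2 * pi * x)) / cis (2 * pi * x) * (2 * pi * \<i> * cis (2 * pi * x))) has_integral (2 * of_real pi * \<i> * g 0)) {0..1}"
    unfolding has_contour_integral_def
    by (rule has_integral_eq[rotated]) (simp add: vector_derivative_circlepath01 e cis_conv_exp mult_ac)
  hence "((\<lambda>x. (2 * pi * \<i>) * g (cis (2 * pi * x))) has_integral (2 * of_real pi * \<i> * g 0)) {0..1}"
    by (simp add: mult_ac)
  from has_integral_mult_right[OF this, of "1 / (2 * pi * \<i>)"]
  have i: "((\<lambda>x. g (cis (2 * pi * x))) has_integral g 0) {0..1}" by simp
  have "continuous_on {0..1} (\<lambda>x. g (cis (2 * pi * x)))"
    by (rule continuous_on_compose2[OF holomorphic_on_imp_continuous_on[OF g]])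
       (use S(2) in \<open>auto intro!: continuous_intros simp: subset_iff\<close>)
  hence "set_integrable lborel {0..1} (\<lambda>x. g (cis (2 * pi * x)))"
    unfolding set_integrable_def by (intro borel_integrable_compact) auto
  from set_borel_integral_eq_integral(2)[OF this] integral_unique[OF i] show ?thesis
    by (simp add: set_lebesgue_integral_def)
qed

lemma continuous_on_axis [continuous_intros]:
  fixes f :: "'b::topological_space \<Rightarrow> 'a::euclidean_space"
  assumes "continuous_on S f"
  shows "continuous_on S (\<lambda>x. axis i (f x) :: 'a^'n::finite)"
proof -
  have "linear (axis i :: 'a \<Rightarrow> 'a^'n)" by (rule linearI) (auto simp: axis_def vec_eq_iff)
  hence "bounded_linear (axis i :: 'a \<Rightarrow> 'a^'n)" by (simp add: linear_conv_bounded_linear)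
  from bounded_linear.continuous_on[OF this assms] show ?thesis .
qed

section \<open>Coordinates centred at a point, and rotations of the first coordinates\<close>

lemma open_tube: "open (tube :: ((complex, 'n::{finite,linorder}) vec) set)"
  unfolding tube_def by (intro open_Collect_less continuous_intros)

lemma axis_last_nth:
  "axis last_idx t $ last_idx = t" "j < last_idx \<Longrightarrow> axis last_idx t $ j = 0"
  by (auto simp: axis_def)

text \<open>Coordinates centred at \<open>z\<close>, in which the kernel depends on the last coordinate only and the domain is
  the Siegel domain \<open>Im \<eta> > |w'|\<^sup>2/2\<close>.\<close>

definition siegel_q :: "complex^'n::{finite,linorder} \<Rightarrow> complex^'n::{finite,linorder} \<Rightarrow> complex" where
  "siegel_q z w = \<i> * (\<Sum>j\<in>{..<last_idx}. of_real ((Im (z $ j))\<^sup>2)) - \<i> / 2 * (\<Sum>j\<in>{..<last_idx}. (w $ j)\<^sup>2)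
      + 2 * (\<Sum>j\<in>{..<last_idx}. of_real (Im (z $ j)) * w $ j)"

text \<open>A shear in the last coordinate followed by the translation by z'; both preserve volume,
  and the map is polynomial in w. The entry z_n is removed from the translation and reappears in
  \<open>siegel_pt\<close>.\<close>

definition siegel_map :: "complex^'n::{finite,linorder} \<Rightarrow> complex^'n::{finite,linorder} \<Rightarrow> complex^'n::{finite,linorder}" where
  "siegel_map z w = (z - axis last_idx (z $ last_idx)) + (w + axis last_idx (siegel_q z w))"

text \<open>The half-plane point that represents z: \<open>siegel_map z\<close> sends it, placed on
  the last axis, to z, and its imaginary part is \<open>rho z\<close>.\<close>

definition siegel_pt :: "complex^'n::{finite,linorder} \<Rightarrow> complex" where
  "siegel_pt z = z $ last_idx - \<i> * (\<Sum>j\<in>{..<last_idx}. of_real ((Im (z $ j))\<^sup>2))"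

definition siegel_rho :: "complex^'n::{finite,linorder} \<Rightarrow> real" where
  "siegel_rho w = Im (w $ last_idx) - (\<Sum>j\<in>{..<last_idx}. (cmod (w $ j))\<^sup>2) / 2"

lemma siegel_map_nth:
  "siegel_map z w $ last_idx = w $ last_idx + siegel_q z w"
  "j < last_idx \<Longrightarrow> siegel_map z w $ j = z $ j + w $ j"
  by (auto simp: siegel_map_def axis_def)

text \<open>Since (Im u)^2 = (|u|^2 - Re (u^2)) / 2, the term with (w_j)^2 in
  \<open>siegel_q\<close> removes the part Re (u^2) of the defining function and leaves |u|^2 / 2,
  which rotations preserve; the remaining terms of \<open>siegel_q\<close> absorb the shift by Im
  z_j.\<close>

lemma rho_siegel_map: "rho (siegel_map z w) = siegel_rho w"
proof -
  have t: "(Im (z $ j))\<^sup>2 - Re ((w $ j)\<^sup>2) / 2 + 2 * (Im (z $ j) * Im (w $ j)) - (Im (z $ j) + Im (w $ j))\<^sup>2 = - ((cmod (w $ j))\<^sup>2 / 2)" for j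
    unfolding cmod_power2 by (simp add: power2_eq_square field_simps)
  have "rho (siegel_map z w) = Im (w $ last_idx) + Im (siegel_q z w) - (\<Sum>j\<in>{..<last_idx}. (Im (z $ j) + Im (w $ j))\<^sup>2)"
    unfolding rho_def by (simp add: siegel_map_nth)
  also have "Im (siegel_q z w) = (\<Sum>j\<in>{..<last_idx}. (Im (z $ j))\<^sup>2) - (\<Sum>j\<in>{..<last_idx}. Re ((w $ j)\<^sup>2)) / 2 + 2 * (\<Sum>j\<in>{..<last_idx}. Im (z $ j) * Im (w $ j))"
    unfolding siegel_q_def by (simp add: Re_sum Im_sum del: of_real_power)
  also have "Im (w $ last_idx) + \<dots> - (\<Sum>j\<in>{..<last_idx}. (Im (z $ j) + Im (w $ j))\<^sup>2)
      = Im (w $ last_idx) + (\<Sum>j\<in>{..<last_idx}. (Im (z $ j))\<^sup>2 - Re ((w $ j)\<^sup>2) / 2 + 2 * (Im (z $ j) * Im (w $ j)) - (Im (z $ j) + Im (w $ j))\<^sup>2)"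
    by (simp only: sum_subtractf sum.distrib sum_distrib_left sum_divide_distrib)
  also have "\<dots> = siegel_rho w"
    unfolding t siegel_rho_def by (simp add: sum_negf sum_divide_distrib)
  finally show ?thesis .
qed

lemma rho2_siegel_map: "rho2 z (siegel_map z w) = - (\<i> / 2) * (siegel_pt z - cnj (w $ last_idx))"
proof -
  define y where "y j = complex_of_real (Im (z $ j))" for j
  define v where "v j = cnj (w $ j)" for j
  have t1: "(z $ j - cnj (siegel_map z w $ j))\<^sup>2 = - 4 * (y j)\<^sup>2 - 4 * \<i> * (y j * v j) + (v j)\<^sup>2" if "j < last_idx" for j
  proof -
    have "z $ j - cnj (z $ j + w $ j) = 2 * \<i> * y j - v j" by (simp add: y_def v_def complex_eq_iff)
    thus ?thesis using that by (simp only: siegel_map_nth) (simp add: power2_eq_square algebra_simps)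
  qed
  have q: "cnj (siegel_q z w) = - \<i> * (\<Sum>j\<in>{..<last_idx}. (y j)\<^sup>2) + \<i> / 2 * (\<Sum>j\<in>{..<last_idx}. (v j)\<^sup>2) + 2 * (\<Sum>j\<in>{..<last_idx}. y j * v j)"
    by (simp add: siegel_q_def y_def v_def)
  have s: "(\<Sum>j\<in>{..<last_idx}. (z $ j - cnj (siegel_map z w $ j))\<^sup>2)
      = - 4 * (\<Sum>j\<in>{..<last_idx}. (y j)\<^sup>2) - 4 * \<i> * (\<Sum>j\<in>{..<last_idx}. y j * v j) + (\<Sum>j\<in>{..<last_idx}. (v j)\<^sup>2)"
    by (simp add: t1 sum.distrib sum_subtractf sum_distrib_left)
  have p: "siegel_pt z = z $ last_idx - \<i> * (\<Sum>j\<in>{..<last_idx}. (y j)\<^sup>2)" by (simp add: siegel_pt_def y_def)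
  show ?thesis
    unfolding rho2_def s p siegel_map_nth complex_cnj_add q by (simp add: algebra_simps)
qed

lemma Im_siegel_pt: "Im (siegel_pt z) = rho z"
  by (simp add: siegel_pt_def rho_def Re_sum)

lemma siegel_map_centre: "siegel_map z (axis last_idx (siegel_pt z)) = z"
proof -
  have "(\<Sum>j\<in>{..<last_idx}. (axis last_idx (siegel_pt z) $ j)\<^sup>2) = 0" "(\<Sum>j\<in>{..<last_idx}. of_real (Im (z $ j)) * axis last_idx (siegel_pt z) $ j) = 0"
    by (auto intro!: sum.neutral simp: axis_def)
  thus ?thesis unfolding siegel_map_def siegel_q_def by (simp add: siegel_pt_def vec_eq_iff axis_def)
qed

lemma siegel_q_continuous: "continuous_on S (siegel_q z)"
  unfolding siegel_q_def[abs_def] by (intro continuous_intros)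

lemma siegel_map_continuous: "continuous_on S (siegel_map z)"
  unfolding siegel_map_def[abs_def] by (intro continuous_intros siegel_q_continuous)

lemma siegel_map_measurable [measurable]: "siegel_map z \<in> borel_measurable borel"
  by (rule borel_measurable_continuous_onI[OF siegel_map_continuous])

lemma siegel_rho_measurable [measurable]: "siegel_rho \<in> borel_measurable borel"
  unfolding siegel_rho_def[abs_def] by measurable

lemma lborel_distr_siegel_map: "distr lborel borel (siegel_map z) = lborel"
proof -
  have [measurable]: "siegel_q z \<in> borel_measurable borel"
    by (rule borel_measurable_continuous_onI[OF siegel_q_continuous])
  have q: "siegel_q z (w + axis last_idx t) = siegel_q z w" for w t
    unfolding siegel_q_def by (simp add: axis_last_nth cong: sum.cong_simp)
  have "distr lborel borel (siegel_map z) = distr (distr lborel borel (\<lambda>w. w + axis last_idx (siegel_q z w))) borel ((+) (z - axis last_idx (z $ last_idx)))"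
    by (subst distr_distr) (auto simp: siegel_map_def[abs_def] o_def)
  also have "\<dots> = lborel"
    by (subst lborel_distr_shear[OF _ q]) (auto simp: lborel_distr_plus)
  finally show ?thesis .
qed

text \<open>The factor c is any complex number: |c| = 1 gives the measure-preserving rotations, c =
  0 the projection to the last axis, and the holomorphic dependence on c connects the two by the
  mean value property.\<close>

definition rot :: "complex \<Rightarrow> complex^'n::{finite,linorder} \<Rightarrow> complex^'n::{finite,linorder}" where
  "rot c w = (\<chi> j. if j = last_idx then w $ last_idx else c * w $ j)"

lemma rot_nth: "rot c w $ last_idx = w $ last_idx" "j < last_idx \<Longrightarrow> rot c w $ j = c * w $ j"
  by (auto simp: rot_def)

lemma siegel_rho_rot: "cmod c = 1 \<Longrightarrow> siegel_rho (rot c w) = siegel_rho w"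
  by (simp add: siegel_rho_def rot_nth norm_mult)

lemma lborel_distr_rot:
  assumes "cmod c = 1"
  shows "distr lborel borel (rot c) = lborel"
proof (rule lborel_distr_isometry)
  show "linear (rot c)" by (rule linearI) (auto simp: rot_def vec_eq_iff algebra_simps)
  show "norm (rot c w) = norm w" for w
    unfolding norm_vec_def by (rule L2_set_cong) (auto simp: rot_def norm_mult assms)
qed

text \<open>Averaging over the rotations of \<open>w'\<close> replaces \<open>H\<close> by its restriction to \<open>w' = 0\<close>.\<close>

lemma siegel_rotation_average:
  fixes \<Phi> H :: "complex^'n::{finite,linorder} \<Rightarrow> complex"
  assumes int: "integrable lborel (\<lambda>w. \<Phi> w * H w)"
    and inv: "\<And>c w. cmod c = 1 \<Longrightarrow> \<Phi> (rot c w) = \<Phi> w"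
    and supp: "\<And>w. siegel_rho w \<le> 0 \<Longrightarrow> \<Phi> w = 0"
    and hol: "\<And>w. siegel_rho w > 0 \<Longrightarrow> \<exists>S. open S \<and> cball 0 1 \<subseteq> S \<and> (\<lambda>t. H (rot t w)) holomorphic_on S"
  shows "(LINT w|lborel. \<Phi> w * H w) = (LINT w|lborel. \<Phi> w * H (axis last_idx (w $ last_idx)))"
proof -
  define \<Psi> where "\<Psi> w = \<Phi> w * H w" for w
  have [measurable]: "\<Psi> \<in> borel_measurable borel" using int by (auto simp: \<Psi>_def[abs_def])
  have rm: "(\<lambda>z. rot (cis (2 * pi * fst z)) (snd z :: (complex, 'n) vec)) \<in> borel_measurable (lborel \<Otimes>\<^sub>M lborel)"
  proof (rule borel_measurable_vecI)
    have [measurable]: "(\<lambda>x. cis (2 * pi * x)) \<in> borel_measurable borel"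
      by (intro borel_measurable_continuous_onI continuous_intros)
    fix i :: 'n
    show "(\<lambda>z. rot (cis (2 * pi * fst z)) (snd z) $ i) \<in> borel_measurable (lborel \<Otimes>\<^sub>M (lborel :: (complex, 'n) vec measure))"
      unfolding rot_def vec_lambda_beta by (cases "i = last_idx") (simp_all, measurable)
  qed
  define f where "f = (\<lambda>x w. indicator {0..1} x *\<^sub>R \<Psi> (rot (cis (2 * pi * x)) w))"
  have rot_inv: "integrable lborel (\<lambda>w. \<Psi> (rot c w))" "(LINT w|lborel. \<Psi> (rot c w)) = (LINT w|lborel. \<Psi> w)"
     "(LINT w|lborel. cmod (\<Psi> (rot c w))) = (LINT w|lborel. cmod (\<Psi> w))" if c: "cmod c = 1" for c
  proof -
    have m: "(rot c :: (complex, 'n) vec \<Rightarrow> _) \<in> borel_measurable lborel"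
    proof -
      have "linear (rot c :: (complex, 'n) vec \<Rightarrow> _)" by (rule linearI) (auto simp: rot_def vec_eq_iff algebra_simps)
      hence "bounded_linear (rot c :: (complex, 'n) vec \<Rightarrow> _)" by (simp add: linear_conv_bounded_linear)
      from borel_measurable_continuous_onI[OF linear_continuous_on[OF this]] show ?thesis by simp
    qed
    have "integrable (distr lborel borel (rot c)) \<Psi>" using int by (simp add: lborel_distr_rot[OF c] \<Psi>_def[abs_def])
    thus "integrable lborel (\<lambda>w. \<Psi> (rot c w))" by (subst (asm) integrable_distr_eq[OF m]) auto
    show "(LINT w|lborel. \<Psi> (rot c w)) = (LINT w|lborel. \<Psi> w)"
      by (subst (2) lborel_distr_rot[OF c, symmetric], subst integral_distr[OF m]) auto
    show "(LINT w|lborel. cmod (\<Psi> (rot c w))) = (LINT w|lborel. cmod (\<Psi> w))"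
      by (subst (2) lborel_distr_rot[OF c, symmetric], subst integral_distr[OF m]) auto
  qed
  have fi: "integrable (lborel \<Otimes>\<^sub>M lborel) (case_prod f)"
  proof (rule lborel_pair.Fubini_integrable)
    show "case_prod f \<in> borel_measurable (lborel \<Otimes>\<^sub>M lborel)"
      unfolding f_def case_prod_beta
      by (intro borel_measurable_scaleR measurable_compose[OF rm \<open>\<Psi> \<in> borel_measurable borel\<close>]) measurable
    have "(\<lambda>x. LINT w|lborel. norm (case_prod f (x, w))) = (\<lambda>x. indicator {0..1} x *\<^sub>R (LINT w|lborel. cmod (\<Psi> w)))"
      by (auto simp: f_def rot_inv(3) split: split_indicator)
    thus "integrable lborel (\<lambda>x. LINT w|lborel. norm (case_prod f (x, w)))"
      by (simp only:) (intro integrable_scaleR_left integrable_real_indicator, auto)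
    show "AE x in lborel. integrable lborel (\<lambda>w. case_prod f (x, w))"
      by (intro AE_I2) (auto simp: f_def rot_inv)
  qed
  have "(LINT w|lborel. (LINT x|lborel. f x w)) = (LINT x|lborel. (LINT w|lborel. f x w))"
    by (rule lborel_pair.Fubini_integral[OF fi])
  also have "\<dots> = (LINT x|lborel. indicator {0..1::real} x *\<^sub>R (LINT w|lborel. \<Psi> w))"
    by (simp add: f_def rot_inv)
  also have "\<dots> = (LINT w|lborel. \<Psi> w)"
    by (subst integral_scaleR_left) (auto intro: integrable_real_indicator)
  finally have 1: "(LINT w|lborel. (LINT x|lborel. f x w)) = (LINT w|lborel. \<Psi> w)" .
  \<comment> \<open>The other order of integration: for fixed w the average over the circle is the
    value at the centre, \<open>rot 0 w\<close>. Only \<Phi> is pulled out, being constant on the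
    circle.\<close>
  have "(LINT x|lborel. f x w) = \<Phi> w * H (axis last_idx (w $ last_idx))" for w
  proof (cases "siegel_rho w > 0")
    case True
    from hol[OF this] obtain S where S: "open S" "cball 0 1 \<subseteq> S" "(\<lambda>t. H (rot t w)) holomorphic_on S" by blast
    have "(LINT x|lborel. f x w) = (LINT x|lborel. \<Phi> w * (indicator {0..1} x *\<^sub>R H (rot (cis (2 * pi * x)) w)))"
      by (simp add: f_def \<Psi>_def inv)
    also have "\<dots> = \<Phi> w * H (rot 0 w)"
      by (simp only: integral_mult_right_zero circle_mean_value[OF S])
    also have "rot 0 w = axis last_idx (w $ last_idx)" by (simp add: rot_def vec_eq_iff axis_def)
    finally show ?thesis .
  next
    case False
    thus ?thesis using supp[of w] inv[of _ w] by (simp add: f_def \<Psi>_def)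
  qed
  with 1 show ?thesis by (simp add: \<Psi>_def)
qed

text \<open>The kernel estimate with weight b - a and excess a. For a = 0 there would be no excess,
  and the estimate would not apply.\<close>

lemma bergman_integrable_bound:
  fixes z :: "complex^'n::{finite,linorder}"
  assumes b: "b > -1" and a: "0 < a" "a < b + 1" and z: "z \<in> tube"
  shows "(\<integral>\<^sup>+w. ennreal (pos_powr (rho w) (b - a) * cmod (rho2 z w) powr (- (real CARD('n) + 1 + b))) \<partial>lborel) < \<infinity>"
proof -
  obtain C where "C \<ge> 0" "\<And>z :: (complex, 'n) vec. z \<in> tube \<Longrightarrow>
     (\<integral>\<^sup>+w. ennreal (pos_powr (rho w) (b - a) * cmod (rho2 z w) powr (- (real CARD('n) + 1 + (b - a) + a))) \<partial>lborel) \<le> ennreal (C * rho z powr (- a))"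
    using tube_integral_bound[of "b - a" a] a by auto
  from le_less_trans[OF this(2)[OF z] ennreal_less_top] show ?thesis by (simp add: algebra_simps)
qed

text \<open>The growth bound makes the integrand absolutely integrable, as the change of variables
  and the averaging require. On the last axis \<open>rho\<close> becomes Im \<eta>, so G inherits
  the bound with the same a, and a < b + 1 is more than the half-plane formula with weight b + m
  asks for.\<close>

theorem bergman_reproducing:
  fixes F :: "complex^'n::{finite,linorder} \<Rightarrow> complex"
  assumes b: "b > -1" and a: "0 < a" "a < b + 1"
    and hol: "holomorphic_several F tube"
    and bd: "\<And>w. w \<in> tube \<Longrightarrow> cmod (F w) \<le> C * rho w powr (- a)"
    and z: "z \<in> tube"
  shows "integrable lborel (\<lambda>w. of_real (pos_powr (rho w) b) * (bergman_kernel b z w * F w))"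
    and "(LINT w|lborel. of_real (pos_powr (rho w) b) * (bergman_kernel b z w * F w)) = F z"
proof -
  define n where "n = real CARD('n)"
  define c where "c = Gamma (n + 1 + b) / (2 ^ (CARD('n) + 1) * pi ^ CARD('n) * Gamma (b + 1))"
  have bk: "bergman_kernel b z w = of_real c * rho2 z w powr of_real (- (n + 1 + b))" for w
    by (simp only: bergman_kernel_def c_def n_def)
  have C: "C \<ge> 0"
  proof -
    have "cmod (F z) * rho z powr a \<le> C * rho z powr (- a) * rho z powr a" using bd[OF z] by (intro mult_right_mono) auto
    also have "\<dots> = C" using z by (simp add: tube_iff powr_add[symmetric] mult.assoc)
    finally show ?thesis using order_trans[of 0] by (smt (verit) mult_nonneg_nonneg norm_ge_zero powr_ge_zero)
  qed
  have cF: "continuous_on tube F" by (rule holomorphic_several_imp_continuous_on[OF hol])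
  define h where "h w = of_real (pos_powr (rho w) b) * rho2 z w powr of_real (- (n + 1 + b)) * F w" for w
  have hm: "h \<in> borel_measurable borel"
    unfolding h_def[abs_def]
    by (rule borel_measurable_mult_vanishing[where \<phi> = "\<lambda>w. of_real (pos_powr (rho w) b) * rho2 z w powr of_real (- (n + 1 + b))" and S = tube])
       (auto simp: pos_powr_def tube_iff[symmetric] cF open_tube)
  have hint: "integrable lborel h"
  proof (rule integrable_dominated[where g = "\<lambda>w. C * (pos_powr (rho w) (b - a) * cmod (rho2 z w) powr (- (n + 1 + b)))"])
    show "h \<in> borel_measurable lborel" using hm by simp
    show "norm (h w) \<le> C * (pos_powr (rho w) (b - a) * cmod (rho2 z w) powr (- (n + 1 + b)))" for w
    proof (cases "w \<in> tube")
      case True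
      hence r: "rho w > 0" by (simp add: tube_iff)
      have "norm (h w) \<le> rho w powr b * cmod (rho2 z w) powr (- (n + 1 + b)) * (C * rho w powr (- a))"
        unfolding h_def norm_mult norm_powr_of_real using bd[OF True] r by (simp add: pos_powr_def mult_left_mono)
      also have "\<dots> = C * ((rho w powr b * rho w powr (- a)) * cmod (rho2 z w) powr (- (n + 1 + b)))" by simp
      finally show ?thesis using r by (simp add: pos_powr_def powr_add[symmetric])
    qed (simp add: h_def pos_powr_def tube_iff C)
    show "(\<integral>\<^sup>+w. ennreal (C * (pos_powr (rho w) (b - a) * cmod (rho2 z w) powr (- (n + 1 + b)))) \<partial>lborel) < \<infinity>"
      using bergman_integrable_bound[OF b a z] C
      by (subst ennreal_mult', simp, subst nn_integral_cmult) (auto simp: ennreal_mult_less_top n_def)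
  qed
  have hk: "of_real (pos_powr (rho w) b) * (bergman_kernel b z w * F w) = of_real c * h w" for w
    by (simp add: bk h_def mult_ac)
  show "integrable lborel (\<lambda>w. of_real (pos_powr (rho w) b) * (bergman_kernel b z w * F w))"
    unfolding hk by (intro integrable_mult_right hint)
  define m where "m = card (UNIV - {last_idx :: 'n})"
  have mn: "n = real m + 1" "CARD('n) = Suc m"
    using card_below_last[where 'n = 'n] by (auto simp: n_def m_def UNIV_minus_last)
  define \<xi> where "\<xi> = siegel_pt z"
  \<comment> \<open>The exponents agree: n + 1 + b = (b + m) + 2, because n = m + 1.\<close>
  define \<Phi> where "\<Phi> w = of_real (pos_powr (siegel_rho w) b) * half_plane_kernel (b + real m) \<xi> (w $ last_idx)" for w :: "(complex, 'n) vec"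
  define H where "H w = F (siegel_map z w)" for w
  define G where "G \<eta> = H (axis last_idx \<eta>)" for \<eta>
  have hS: "h (siegel_map z w) = \<Phi> w * H w" for w
    unfolding h_def \<Phi>_def H_def rho_siegel_map rho2_siegel_map half_plane_kernel_def \<xi>_def
    by (simp add: mn add_ac)
  have "(LINT w|lborel. h w) = (LINT w|distr lborel borel (siegel_map z). h w)"
    by (simp only: lborel_distr_siegel_map)
  also have "\<dots> = (LINT w|lborel. \<Phi> w * H w)"
    by (subst integral_distr) (auto simp: hm hS)
  also have "\<dots> = (LINT w|lborel. \<Phi> w * H (axis last_idx (w $ last_idx)))"
  proof (rule siegel_rotation_average)
    have "integrable (distr lborel borel (siegel_map z)) h" using hint by (simp only: lborel_distr_siegel_map)
    thus "integrable lborel (\<lambda>w. \<Phi> w * H w)" by (subst (asm) integrable_distr_eq) (auto simp: hm hS)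
    show "\<Phi> (rot c w) = \<Phi> w" if "cmod c = 1" for c w
      by (simp add: \<Phi>_def siegel_rho_rot[OF that] rot_nth)
    show "\<Phi> w = 0" if "siegel_rho w \<le> 0" for w using that by (simp add: \<Phi>_def pos_powr_def)
    fix w :: "(complex, 'n) vec" assume w: "siegel_rho w > 0"
    \<comment> \<open>The parameters for which the rotated point stays in the Siegel domain. The
      closed unit disc is included because |t| <= 1 only decreases |w'|.\<close>
    define S where "S = {t. siegel_rho (rot t w) > 0}"
    have "continuous_on UNIV (\<lambda>t. siegel_rho (rot t w))"
    proof -
      have "siegel_rho (rot t w) = Im (w $ last_idx) - (\<Sum>j\<in>{..<last_idx}. (cmod (t * w $ j))\<^sup>2) / 2" for t
        by (simp add: siegel_rho_def rot_nth cong: sum.cong_simp)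
      thus ?thesis by (simp only:) (intro continuous_intros; simp)
    qed
    hence "open S" unfolding S_def by (intro open_Collect_less continuous_intros) auto
    moreover have "cball 0 1 \<subseteq> S"
    proof
      fix t :: complex assume "t \<in> cball 0 1"
      hence "(cmod (t * w $ j))\<^sup>2 \<le> (cmod (w $ j))\<^sup>2" for j
        by (intro power_mono) (auto simp: norm_mult mult_left_le_one_le)
      hence "siegel_rho (rot t w) \<ge> siegel_rho w"
        unfolding siegel_rho_def by (simp add: rot_nth sum_mono divide_right_mono)
      thus "t \<in> S" using w by (simp add: S_def)
    qed
    moreover have "(\<lambda>t. H (rot t w)) holomorphic_on S"
    proof (rule holomorphic_on_subset[OF _ subset_refl], unfold holomorphic_on_open[OF \<open>open S\<close>], intro ballI)
      fix t assume t: "t \<in> S"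
      hence "siegel_map z (rot t w) \<in> tube" by (simp add: S_def tube_iff rho_siegel_map)
      then obtain D where D: "(F has_derivative D) (at (siegel_map z (rot t w)))" "\<And>a v. D (a *s v) = a * D v"
        using hol unfolding holomorphic_several_def by blast
      define d where "d = (\<chi> j. deriv (\<lambda>t. siegel_map z (rot t w) $ j) t)"
      have "(\<lambda>t. siegel_map z (rot t w) $ j) field_differentiable (at t)" for j
      proof (cases "j = last_idx")
        case True
        show ?thesis unfolding True siegel_map_nth rot_nth siegel_q_def
          by (simp add: rot_nth cong: sum.cong_simp) (intro derivative_intros; simp)
      next
        case False
        hence "j < last_idx" using UNIV_minus_last[where 'n = 'n] by blast
        thus ?thesis by (simp add: siegel_map_nth rot_nth) (intro derivative_intros; simp)
      qed
      hence "((\<lambda>t. siegel_map z (rot t w) $ j) has_field_derivative d $ j) (at t)" for j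
        by (simp add: d_def field_differentiable_derivI)
      from holomorphic_several_curve[OF D this] show "\<exists>f'. ((\<lambda>t. H (rot t w)) has_field_derivative f') (at t)"
        unfolding H_def by blast
    qed
    ultimately show "\<exists>S. open S \<and> cball 0 1 \<subseteq> S \<and> (\<lambda>t. H (rot t w)) holomorphic_on S" by blast
  qed
  also have "\<dots> = of_real ((2 * pi) ^ m * Gamma (b + 1) / Gamma (b + 1 + m)) * (LINT \<eta>|lborel. of_real (pos_powr (Im \<eta>) (b + m)) * half_plane_kernel (b + m) \<xi> \<eta> * G \<eta>)"
  proof -
    \<comment> \<open>G is controlled for Im \<eta> > 0 only; the cut-off makes the integrand Borel,
      and the weight vanishes where it acts.\<close>
    define T where "T \<eta> = (if Im \<eta> > 0 then half_plane_kernel (b + m) \<xi> \<eta> * G \<eta> else 0)" for \<eta>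
    define \<kappa> where "\<kappa> = (2 * pi) ^ m * Gamma (b + 1) / Gamma (b + 1 + m)"
    have \<kappa>: "\<kappa> \<ge> 0" using b by (auto simp: \<kappa>_def intro!: divide_nonneg_nonneg mult_nonneg_nonneg less_imp_le[OF Gamma_real_pos])
    have cG: "continuous_on {\<eta>. Im \<eta> > 0} G"
      unfolding G_def[abs_def] H_def
    proof (rule continuous_on_compose2[OF cF])
      show "continuous_on {\<eta>. Im \<eta> > 0} (\<lambda>\<eta>. siegel_map z (axis last_idx \<eta>))"
        by (rule continuous_on_compose2[OF siegel_map_continuous[of UNIV]]) (auto intro!: continuous_intros)
      show "(\<lambda>\<eta>. siegel_map z (axis last_idx \<eta>)) ` {\<eta>. Im \<eta> > 0} \<subseteq> tube"
        by (auto simp: tube_iff rho_siegel_map siegel_rho_def axis_last_nth cong: sum.cong_simp)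
    qed
    have "(\<lambda>\<eta>. (indicator {\<eta>. Im \<eta> > 0} \<eta> * half_plane_kernel (b + m) \<xi> \<eta>) * G \<eta>) \<in> borel_measurable borel"
    proof (rule borel_measurable_mult_vanishing[where S = "{\<eta>. Im \<eta> > 0}"])
      show "(\<lambda>\<eta>. indicator {\<eta>. Im \<eta> > 0} \<eta> * half_plane_kernel (b + m) \<xi> \<eta>) \<in> borel_measurable borel" by measurable
    qed (auto simp: open_halfspace_Im_gt cG)
    also have "(\<lambda>\<eta>. (indicator {\<eta>. Im \<eta> > 0} \<eta> * half_plane_kernel (b + m) \<xi> \<eta>) * G \<eta>) = T"
      by (auto simp: T_def fun_eq_iff)
    finally have [measurable]: "T \<in> borel_measurable borel" .
    have sr: "siegel_rho w = Im (w $ last_idx) - (\<Sum>j\<in>UNIV - {last_idx}. (cmod (w $ j))\<^sup>2) / 2" for w :: "(complex, 'n) vec"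
      unfolding siegel_rho_def UNIV_minus_last ..
    define P where "P w = pos_powr (siegel_rho w) b" for w :: "(complex, 'n) vec"
    have [measurable]: "P \<in> borel_measurable borel" unfolding P_def[abs_def] by measurable
    have Pn: "P w \<ge> 0" for w by (simp add: P_def)
    have "\<Phi> w * H (axis last_idx (w $ last_idx)) = P w *\<^sub>R T (w $ last_idx)" for w
    proof (cases "siegel_rho w > 0")
      case True
      moreover have "(\<Sum>j\<in>{..<last_idx}. (cmod (w $ j))\<^sup>2) \<ge> 0" by (intro sum_nonneg) auto
      ultimately have "Im (w $ last_idx) > 0" by (simp add: siegel_rho_def)
      thus ?thesis by (simp add: P_def \<Phi>_def T_def G_def scaleR_conv_of_real)
    qed (simp add: P_def \<Phi>_def pos_powr_def)
    hence "(LINT w|lborel. \<Phi> w * H (axis last_idx (w $ last_idx))) = (LINT w|lborel. P w *\<^sub>R T (w $ last_idx))"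
      by simp
    also have "\<dots> = (LINT w|density lborel (\<lambda>w. ennreal (P w)). T (w $ last_idx))"
      by (rule integral_density[symmetric]) (auto simp: Pn)
    also have "\<dots> = (LINT \<eta>|distr (density lborel (\<lambda>w. ennreal (P w))) borel (\<lambda>w. w $ last_idx). T \<eta>)"
      by (rule integral_distr[symmetric]) auto
    also have "\<dots> = (LINT \<eta>|density lborel (\<lambda>t. ennreal (\<kappa> * pos_powr (Im t) (b + m))). T \<eta>)"
      unfolding P_def sr \<kappa>_def m_def by (subst distr_density_pos_powr[OF b]) simp
    also have "\<dots> = (LINT \<eta>|lborel. (\<kappa> * pos_powr (Im \<eta>) (b + m)) *\<^sub>R T \<eta>)"
      by (rule integral_density) (use \<kappa> in auto)
    also have "\<dots> = (LINT \<eta>|lborel. of_real \<kappa> * (of_real (pos_powr (Im \<eta>) (b + m)) * half_plane_kernel (b + m) \<xi> \<eta> * G \<eta>))"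
      by (rule Bochner_Integration.integral_cong) (auto simp: T_def pos_powr_def scaleR_conv_of_real)
    also have "\<dots> = of_real \<kappa> * (LINT \<eta>|lborel. of_real (pos_powr (Im \<eta>) (b + m)) * half_plane_kernel (b + m) \<xi> \<eta> * G \<eta>)"
      by (rule integral_mult_right_zero)
    finally show ?thesis by (simp only: \<kappa>_def)
  qed
  also have "(LINT \<eta>|lborel. of_real (pos_powr (Im \<eta>) (b + m)) * half_plane_kernel (b + m) \<xi> \<eta> * G \<eta>) = of_real (4 * pi / (b + m + 1)) * G \<xi>"
  proof (rule half_plane_reproducing[where a = a and C = C])
    have tubeG: "siegel_map z (axis last_idx \<eta>) \<in> tube" "rho (siegel_map z (axis last_idx \<eta>)) = Im \<eta>" if "Im \<eta> > 0" for \<eta>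
      using that by (auto simp: tube_iff rho_siegel_map siegel_rho_def axis_last_nth cong: sum.cong_simp)
    show "cmod (G \<eta>) \<le> C * Im \<eta> powr (- a)" if "Im \<eta> > 0" for \<eta>
      using bd[OF tubeG(1)[OF that]] tubeG(2)[OF that] by (simp add: G_def H_def)
    show "G holomorphic_on {\<eta>. Im \<eta> > 0}"
      unfolding holomorphic_on_open[OF open_halfspace_Im_gt]
    proof (intro ballI)
      fix \<eta> :: complex assume "\<eta> \<in> {\<eta>. Im \<eta> > 0}"
      with tubeG obtain D where D: "(F has_derivative D) (at (siegel_map z (axis last_idx \<eta>)))" "\<And>a v. D (a *s v) = a * D v"
        using hol unfolding holomorphic_several_def by blast
      have q: "siegel_q z (axis last_idx t) = siegel_q z 0" for t
        unfolding siegel_q_def by (simp add: axis_last_nth cong: sum.cong_simp)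
      have "((\<lambda>t. siegel_map z (axis last_idx t) $ j) has_field_derivative axis last_idx 1 $ j) (at \<eta>)" for j
      proof (cases "j = last_idx")
        case True
        show ?thesis unfolding True siegel_map_nth q by (auto intro!: derivative_eq_intros simp: axis_def)
      next
        case False
        hence "j < last_idx" using UNIV_minus_last[where 'n = 'n] by blast
        thus ?thesis using False by (simp add: siegel_map_nth axis_def)
      qed
      from holomorphic_several_curve[OF D this] show "\<exists>f'. (G has_field_derivative f') (at \<eta>)"
        unfolding G_def[abs_def] H_def by blast
    qed
    show "Im \<xi> > 0" using z by (simp add: \<xi>_def Im_siegel_pt tube_iff)
  qed (use a in auto)
  also have "G \<xi> = F z" by (simp add: G_def H_def \<xi>_def siegel_map_centre)
  finally have main: "(LINT w|lborel. h w) = of_real ((2 * pi) ^ m * Gamma (b + 1) / Gamma (b + 1 + m)) * (of_real (4 * pi / (b + m + 1)) * F z)" .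
  \<comment> \<open>The normalisation of the Bergman kernel: (2 pi)^m * 4 pi = 2^(n + 1) * pi^n
    because n = m + 1, and Gamma (k + 1) = k * Gamma k with k = b + m + 1 removes the remaining
    factor.\<close>
  have const: "c * ((2 * pi) ^ m * Gamma (b + 1) / Gamma (b + 1 + m) * (4 * pi / (b + m + 1))) = 1"
  proof -
    have p: "b + 1 > 0" "b + 1 + m > 0" using b by auto
    have G: "Gamma (b + 1) \<noteq> 0" "Gamma (b + 1 + m) \<noteq> 0"
      using Gamma_real_pos[OF p(1)] Gamma_real_pos[OF p(2)] by auto
    have "b + 1 + m \<notin> \<int>\<^sub>\<le>\<^sub>0" using p(2) by (auto simp: nonpos_Ints_def)
    define k where "k = b + 1 + m"
    have k: "k \<noteq> 0" "b + 1 + m = k" "b + m + 1 = k" using p by (auto simp: k_def)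
    have "Gamma (n + 1 + b) = k * Gamma k" using Gamma_plus1[of k] \<open>b + 1 + m \<notin> \<int>\<^sub>\<le>\<^sub>0\<close> by (simp add: mn k_def add_ac)
    thus ?thesis unfolding c_def mn(2) k(2,3) using G unfolding k(2,3) using k(1) by (simp add: power_mult_distrib field_simps)
  qed
  have "(LINT w|lborel. of_real (pos_powr (rho w) b) * (bergman_kernel b z w * F w)) = of_real c * (LINT w|lborel. h w)"
    unfolding hk by (rule integral_mult_right_zero)
  also have "\<dots> = of_real (c * ((2 * pi) ^ m * Gamma (b + 1) / Gamma (b + 1 + m) * (4 * pi / (b + m + 1)))) * F z"
    unfolding main by (simp only: of_real_mult mult.assoc)
  also have "\<dots> = F z" unfolding const by simp
  finally show "(LINT w|lborel. of_real (pos_powr (rho w) b) * (bergman_kernel b z w * F w)) = F z" .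
qed

subsection \<open>Locally uniform estimates of the kernel\<close>

lemma convex_tube: "convex (tube :: ((complex, 'n::{finite,linorder}) vec) set)"
proof (rule convexI)
  fix a b :: "(complex, 'n) vec" and u v :: real
  assume ab: "a \<in> tube" "b \<in> tube" and uv: "0 \<le> u" "0 \<le> v" "u + v = 1"
  have sq: "(u * p + v * q)\<^sup>2 \<le> u * p\<^sup>2 + v * q\<^sup>2" for p q :: real
  proof -
    have u: "u = 1 - v" using uv by simp
    have "u * p\<^sup>2 + v * q\<^sup>2 - (u * p + v * q)\<^sup>2 = u * v * (p - q)\<^sup>2"
      unfolding u by (simp add: power2_eq_square algebra_simps)
    hence "u * p\<^sup>2 + v * q\<^sup>2 - (u * p + v * q)\<^sup>2 \<ge> 0" using uv(1,2) by simp
    thus ?thesis by simp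
  qed
  have "(\<Sum>j\<in>{..<last_idx}. (Im ((u *\<^sub>R a + v *\<^sub>R b) $ j))\<^sup>2) \<le> (\<Sum>j\<in>{..<last_idx}. u * (Im (a $ j))\<^sup>2 + v * (Im (b $ j))\<^sup>2)"
    by (intro sum_mono) (simp add: sq)
  also have "\<dots> = u * (\<Sum>j\<in>{..<last_idx}. (Im (a $ j))\<^sup>2) + v * (\<Sum>j\<in>{..<last_idx}. (Im (b $ j))\<^sup>2)"
    by (simp add: sum.distrib sum_distrib_left)
  also have "\<dots> < u * Im (a $ last_idx) + v * Im (b $ last_idx)"
  proof (cases "u = 0")
    case True
    thus ?thesis using ab uv by (simp add: tube_def)
  next
    case False
    have "u * (\<Sum>j\<in>{..<last_idx}. (Im (a $ j))\<^sup>2) < u * Im (a $ last_idx)" using ab False uv by (simp add: tube_def)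
    moreover have "v * (\<Sum>j\<in>{..<last_idx}. (Im (b $ j))\<^sup>2) \<le> v * Im (b $ last_idx)" using ab uv by (intro mult_left_mono) (auto simp: tube_def)
    ultimately show ?thesis by simp
  qed
  finally show "u *\<^sub>R a + v *\<^sub>R b \<in> tube" by (simp add: tube_def)
qed

lemma base_pt_nth: "base_pt $ last_idx = \<i>" "j < last_idx \<Longrightarrow> base_pt $ j = 0"
  by (auto simp: base_pt_def axis_def)

lemma rho_base_pt: "rho base_pt = 1"
  by (simp add: rho_def base_pt_nth)

lemma base_pt_tube: "base_pt \<in> tube"
  by (simp add: tube_iff rho_base_pt)

text \<open>A gauge for |rho2 z w| locally uniformly in z. It is quadratic in w' and linear in w_n,
  according to the parabolic scaling of the tube.\<close>

definition tube_size :: "complex^'n::{finite,linorder} \<Rightarrow> real" where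
  "tube_size w = 1 + (\<Sum>j\<in>{..<last_idx}. (cmod (w $ j))\<^sup>2) + cmod (w $ last_idx)"

lemma tube_size_ge_1: "tube_size w \<ge> 1"
  unfolding tube_size_def by (simp add: sum_nonneg)

lemma tube_size_measurable [measurable]: "tube_size \<in> borel_measurable borel"
  unfolding tube_size_def[abs_def] by measurable

lemma rho_le_tube_size: "rho w \<le> tube_size w"
proof -
  have "rho w \<le> Im (w $ last_idx)" unfolding rho_def by (simp add: sum_nonneg)
  also have "\<dots> \<le> cmod (w $ last_idx)" using abs_Im_le_cmod[of "w $ last_idx"] by linarith
  also have "\<dots> \<le> tube_size w" unfolding tube_size_def by (simp add: sum_nonneg)
  finally show ?thesis .
qed

lemma norm_nth_le_tube_size: "j < last_idx \<Longrightarrow> cmod (w $ j) \<le> sqrt (tube_size w)"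
proof (rule real_le_rsqrt)
  assume "j < last_idx"
  hence "(cmod (w $ j))\<^sup>2 \<le> (\<Sum>j\<in>{..<last_idx}. (cmod (w $ j))\<^sup>2)" by (intro member_le_sum) auto
  thus "(cmod (w $ j))\<^sup>2 \<le> tube_size w" unfolding tube_size_def by (simp add: add_increasing add_increasing2)
qed

lemma rho2_base_le_tube_size: "cmod (rho2 base_pt w) \<le> tube_size w"
proof -
  have "cmod (rho2 base_pt w) = cmod ((\<Sum>j\<in>{..<last_idx}. (cnj (w $ j))\<^sup>2) - 2 * \<i> * (\<i> - cnj (w $ last_idx))) / 4"
    by (simp add: rho2_def base_pt_nth norm_mult cong: sum.cong_simp)
  also have "\<dots> \<le> (cmod (\<Sum>j\<in>{..<last_idx}. (cnj (w $ j))\<^sup>2) + cmod (2 * \<i> * (\<i> - cnj (w $ last_idx)))) / 4"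
    by (intro divide_right_mono norm_triangle_ineq4) auto
  also have "\<dots> \<le> ((\<Sum>j\<in>{..<last_idx}. (cmod (w $ j))\<^sup>2) + 2 * (1 + cmod (w $ last_idx))) / 4"
  proof (intro divide_right_mono add_mono)
    show "cmod (\<Sum>j\<in>{..<last_idx}. (cnj (w $ j))\<^sup>2) \<le> (\<Sum>j\<in>{..<last_idx}. (cmod (w $ j))\<^sup>2)"
      by (rule order_trans[OF norm_sum]) (simp add: norm_power)
    show "cmod (2 * \<i> * (\<i> - cnj (w $ last_idx))) \<le> 2 * (1 + cmod (w $ last_idx))"
      using norm_triangle_ineq4[of \<i> "cnj (w $ last_idx)"] by (simp add: norm_mult)
  qed auto
  also have "\<dots> \<le> tube_size w"
  proof -
    have "(\<Sum>j\<in>{..<last_idx}. (cmod (w $ j))\<^sup>2) \<ge> 0" by (rule sum_nonneg) simp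
    thus ?thesis unfolding tube_size_def using norm_ge_zero[of "w $ last_idx"] by argo
  qed
  finally show ?thesis .
qed

text \<open>With X = |rho2 z w|, the real part controls |z' - w'|^2 and \<open>rho w\<close>; the
  imaginary part then controls Re w_n; and Im w_n is \<open>rho w\<close> plus the squares of the Im
  w_j. What remains are constants in R, absorbed by r <= 2 X.\<close>

lemma tube_size_le_rho2:
  fixes z w :: "complex^'n::{finite,linorder}"
  assumes z: "z \<in> tube" "norm z \<le> R" "rho z \<ge> r" and r: "r > 0" and w: "w \<in> tube"
  shows "tube_size w \<le> (2 * (1 + R + 7 * R\<^sup>2) / r + 30) * cmod (rho2 z w)"
proof -
  define X where "X = cmod (rho2 z w)"
  define s where "s = (\<Sum>j\<in>{..<last_idx}. (cmod (z $ j - w $ j))\<^sup>2)"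
  define Q where "Q = (\<Sum>j\<in>{..<last_idx}. (cmod (w $ j))\<^sup>2)"
  define SR where "SR = (\<Sum>j\<in>{..<last_idx}. (cmod (z $ j))\<^sup>2)"
  define P where "P = (\<Sum>j\<in>{..<last_idx}. (Re (z $ j) - Re (w $ j)) * (Im (z $ j) + Im (w $ j)))"
  have R: "R \<ge> 0" using z(2) norm_ge_zero order_trans by blast
  have s0: "s \<ge> 0" "Q \<ge> 0" unfolding s_def Q_def by (auto intro: sum_nonneg)
  have rw: "rho w > 0" using w by (simp add: tube_iff)
  have "Re (rho2 z w) \<le> X" "\<bar>Im (rho2 z w)\<bar> \<le> X" unfolding X_def by (auto simp: complex_Re_le_cmod abs_Im_le_cmod)
  hence X1: "s / 4 + (rho z + rho w) / 2 \<le> X" and X2: "\<bar>P / 2 - (Re (z $ last_idx) - Re (w $ last_idx)) / 2\<bar> \<le> X"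
    unfolding Re_rho2 Im_rho2 s_def P_def by simp_all
  have b1: "s \<le> 4 * X" "rho w \<le> 2 * X" "r \<le> 2 * X"
    using X1 s0 rw r z(3) by (simp_all add: field_simps)
  have SR: "SR \<le> R\<^sup>2"
  proof -
    have "SR \<le> (\<Sum>j\<in>UNIV. (cmod (z $ j))\<^sup>2)" unfolding SR_def by (intro sum_mono2) auto
    also have "\<dots> = (norm z)\<^sup>2" unfolding norm_vec_def L2_set_def by (simp add: sum_nonneg)
    also have "\<dots> \<le> R\<^sup>2" using z(2) by (intro power_mono) auto
    finally show ?thesis .
  qed
  have par: "(cmod (a + b))\<^sup>2 \<le> 2 * (cmod a)\<^sup>2 + 2 * (cmod b)\<^sup>2" for a b
  proof -
    have "(cmod (a + b))\<^sup>2 \<le> (cmod a + cmod b)\<^sup>2" by (intro power_mono norm_triangle_ineq) auto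
    also have "\<dots> \<le> 2 * (cmod a)\<^sup>2 + 2 * (cmod b)\<^sup>2" using sum_squares_bound[of "cmod a" "cmod b"] by (simp add: power2_sum)
    finally show ?thesis .
  qed
  have "Q \<le> (\<Sum>j\<in>{..<last_idx}. 2 * (cmod (z $ j))\<^sup>2 + 2 * (cmod (z $ j - w $ j))\<^sup>2)"
    unfolding Q_def
  proof (rule sum_mono)
    fix j show "(cmod (w $ j))\<^sup>2 \<le> 2 * (cmod (z $ j))\<^sup>2 + 2 * (cmod (z $ j - w $ j))\<^sup>2"
      using par[of "z $ j" "- (z $ j - w $ j)"] by (simp add: norm_minus_commute)
  qed
  also have "\<dots> = 2 * SR + 2 * s" by (simp add: SR_def s_def sum.distrib sum_distrib_left)
  finally have Q: "Q \<le> 2 * R\<^sup>2 + 8 * X" using SR b1 by linarith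
  have "\<bar>P\<bar> \<le> (\<Sum>j\<in>{..<last_idx}. ((cmod (z $ j - w $ j))\<^sup>2 + (2 * (cmod (z $ j))\<^sup>2 + 2 * (cmod (w $ j))\<^sup>2)) / 2)"
    unfolding P_def
  proof (intro order_trans[OF sum_abs] sum_mono)
    fix j
    have "\<bar>(Re (z $ j) - Re (w $ j)) * (Im (z $ j) + Im (w $ j))\<bar> \<le> cmod (z $ j - w $ j) * cmod (z $ j + w $ j)"
      unfolding abs_mult using abs_Re_le_cmod[of "z $ j - w $ j"] abs_Im_le_cmod[of "z $ j + w $ j"] by (intro mult_mono) auto
    also have "\<dots> \<le> ((cmod (z $ j - w $ j))\<^sup>2 + (cmod (z $ j + w $ j))\<^sup>2) / 2"
      using sum_squares_bound[of "cmod (z $ j - w $ j)" "cmod (z $ j + w $ j)"] by simp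
    also have "\<dots> \<le> ((cmod (z $ j - w $ j))\<^sup>2 + (2 * (cmod (z $ j))\<^sup>2 + 2 * (cmod (w $ j))\<^sup>2)) / 2"
      using par[of "z $ j" "w $ j"] by simp
    finally show "\<bar>(Re (z $ j) - Re (w $ j)) * (Im (z $ j) + Im (w $ j))\<bar> \<le> ((cmod (z $ j - w $ j))\<^sup>2 + (2 * (cmod (z $ j))\<^sup>2 + 2 * (cmod (w $ j))\<^sup>2)) / 2" .
  qed
  also have "\<dots> = (s + (2 * SR + 2 * Q)) / 2"
    by (simp add: s_def SR_def Q_def sum.distrib sum_distrib_left[symmetric] sum_divide_distrib[symmetric])
  finally have P: "\<bar>P\<bar> \<le> 2 * X + R\<^sup>2 + Q" using SR b1 by simp
  have zl: "\<bar>Re (z $ last_idx)\<bar> \<le> R"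
    using abs_Re_le_cmod[of "z $ last_idx"] Finite_Cartesian_Product.norm_nth_le[of z last_idx] z(2) by linarith
  have "\<bar>P - (Re (z $ last_idx) - Re (w $ last_idx))\<bar> \<le> 2 * X" using X2 by (simp add: diff_divide_distrib[symmetric])
  hence re: "\<bar>Re (w $ last_idx)\<bar> \<le> 4 * X + R\<^sup>2 + Q + R" using P zl by linarith
  have im: "\<bar>Im (w $ last_idx)\<bar> \<le> 2 * X + Q"
  proof -
    have "(\<Sum>j\<in>{..<last_idx}. (Im (w $ j))\<^sup>2) \<le> Q"
      unfolding Q_def by (intro sum_mono) (simp add: cmod_power2)
    moreover have "(\<Sum>j\<in>{..<last_idx}. (Im (w $ j))\<^sup>2) \<ge> 0" by (intro sum_nonneg) auto
    ultimately show ?thesis using b1(2) rw unfolding rho_def by linarith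
  qed
  have "cmod (w $ last_idx) \<le> 6 * X + R\<^sup>2 + R + 2 * Q"
    using cmod_le[of "w $ last_idx"] re im by linarith
  \<comment> \<open>Here Q occurs three times in total, contributing 6 R^2 + 24 X; hence the
    constants 7 and 30.\<close>
  hence "tube_size w \<le> 1 + R + 7 * R\<^sup>2 + 30 * X"
    using Q unfolding tube_size_def Q_def[symmetric] by linarith
  also have "1 + R + 7 * R\<^sup>2 \<le> (1 + R + 7 * R\<^sup>2) * (2 * X / r)"
  proof -
    have "1 \<le> 2 * X / r" using b1(3) r by simp
    from mult_left_mono[OF this, of "1 + R + 7 * R\<^sup>2"] R show ?thesis by simp
  qed
  finally have "tube_size w \<le> (1 + R + 7 * R\<^sup>2) * (2 * X / r) + 30 * X" by simp
  moreover have "A * (2 * X / r) + 30 * X = (2 * A / r + 30) * X" for A by (simp add: distrib_right)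
  ultimately show ?thesis by (simp only: X_def)
qed

text \<open>The opposite comparison, |rho2| at the base point at most \<open>tube_size\<close>,
  reduces this to the kernel estimate there with excess M - (n + 1 + a).\<close>

lemma tube_size_integral:
  assumes a: "a > -1" and M: "M > real CARD('n) + 1 + a"
  shows "(\<integral>\<^sup>+w. ennreal (pos_powr (rho w) a * tube_size (w :: (complex, 'n::{finite,linorder}) vec) powr (- M)) \<partial>lborel) < \<infinity>"
proof -
  define s where "s = M - (real CARD('n) + 1 + a)"
  have s: "s > 0" "real CARD('n) + 1 + a + s = M" using M by (auto simp: s_def)
  obtain C where C: "C \<ge> 0" "\<And>z :: (complex, 'n) vec. z \<in> tube \<Longrightarrow>
     (\<integral>\<^sup>+w. ennreal (pos_powr (rho w) a * cmod (rho2 z w) powr (- (real CARD('n) + 1 + a + s))) \<partial>lborel) \<le> ennreal (C * rho z powr (- s))"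
    by (rule tube_integral_bound[OF a s(1), where 'n = 'n]) blast
  have "(\<integral>\<^sup>+w. ennreal (pos_powr (rho w) a * tube_size (w :: (complex, 'n) vec) powr (- M)) \<partial>lborel)
     \<le> (\<integral>\<^sup>+w. ennreal (pos_powr (rho w) a * cmod (rho2 (base_pt :: (complex, 'n) vec) w) powr (- M)) \<partial>lborel)"
  proof (intro nn_integral_mono ennreal_leI)
    fix w :: "(complex, 'n) vec"
    show "pos_powr (rho w) a * tube_size w powr (- M) \<le> pos_powr (rho w) a * cmod (rho2 base_pt w) powr (- M)"
    proof (cases "w \<in> tube")
      case True
      hence "rho2 base_pt w \<noteq> 0" using Re_rho2_pos[OF base_pt_tube True] by auto
      thus ?thesis using a M by (intro mult_left_mono powr_mono2' rho2_base_le_tube_size) auto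
    qed (simp add: tube_iff pos_powr_def)
  qed
  also have "\<dots> < \<infinity>" using le_less_trans[OF C(2)[OF base_pt_tube] ennreal_less_top] unfolding s(2) by simp
  finally show ?thesis .
qed

section \<open>The derivative of the kernel in its first argument\<close>

definition drho2 :: "complex^'n::{finite,linorder} \<Rightarrow> complex^'n::{finite,linorder} \<Rightarrow> complex^'n::{finite,linorder} \<Rightarrow> complex" where
  "drho2 z w h = 1 / 2 * (\<Sum>j\<in>{..<last_idx}. (z $ j - cnj (w $ j)) * h $ j) - \<i> / 2 * h $ last_idx"

lemma has_derivative_vec_nth' [derivative_intros]: "((\<lambda>z::complex^'n::finite. z $ j) has_derivative (\<lambda>h. h $ j)) F"
  by (rule bounded_linear_imp_has_derivative[OF bounded_linear_vec_nth])

lemma rho2_has_derivative: "((\<lambda>z. rho2 z w) has_derivative drho2 z w) (at z)"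
proof -
  have d: "((\<lambda>z. z $ j - cnj (w $ j)) has_derivative (\<lambda>h. h $ j)) (at z)" for j
    using has_derivative_diff[OF has_derivative_vec_nth' has_derivative_const] by simp
  have "((\<lambda>z. (z $ j - cnj (w $ j))\<^sup>2) has_derivative (\<lambda>h. 2 * ((z $ j - cnj (w $ j)) * h $ j))) (at z)" for j
    using has_derivative_mult[OF d[of j] d[of j]] by (simp add: power2_eq_square mult_ac)
  hence "((\<lambda>z. \<Sum>j\<in>{..<last_idx}. (z $ j - cnj (w $ j))\<^sup>2) has_derivative (\<lambda>h. 2 * (\<Sum>j\<in>{..<last_idx}. (z $ j - cnj (w $ j)) * h $ j))) (at z)"
    unfolding sum_distrib_left by (intro has_derivative_sum)
  from has_derivative_mult_right[OF has_derivative_diff[OF this has_derivative_mult_right[OF d, of "2 * \<i>"]], of "1 / 4"]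
  show ?thesis unfolding rho2_def[abs_def]
    by (rule has_derivative_eq_rhs) (simp add: drho2_def fun_eq_iff right_diff_distrib)
qed

text \<open>The dimension is a property of the type, passed as \<open>TYPE('n)\<close>.\<close>

definition kernel_const :: "real \<Rightarrow> 'n::{finite,linorder} itself \<Rightarrow> real" where
  "kernel_const \<alpha> _ = Gamma (real CARD('n) + 1 + \<alpha>) / (2 ^ (CARD('n) + 1) * pi ^ CARD('n) * Gamma (\<alpha> + 1))"

lemma bergman_kernel_alt:
  "bergman_kernel \<alpha> z (w :: complex^'n::{finite,linorder}) = of_real (kernel_const \<alpha> TYPE('n)) * rho2 z w powr of_real (- (real CARD('n) + 1 + \<alpha>))"
  by (simp only: bergman_kernel_def kernel_const_def)

definition dkernel :: "real \<Rightarrow> complex^'n::{finite,linorder} \<Rightarrow> complex^'n::{finite,linorder} \<Rightarrow> complex^'n::{finite,linorder} \<Rightarrow> complex" where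
  "dkernel \<alpha> z w h = of_real (kernel_const \<alpha> TYPE('n) * (- (real CARD('n) + 1 + \<alpha>))) * rho2 z w powr of_real (- (real CARD('n) + 2 + \<alpha>)) * drho2 z w h"

lemma bergman_kernel_has_derivative:
  assumes "z \<in> tube" "w \<in> tube"
  shows "((\<lambda>z. bergman_kernel \<alpha> z w) has_derivative dkernel \<alpha> z w) (at (z :: complex^'n::{finite,linorder}))"
proof -
  define N where "N = real CARD('n) + 1 + \<alpha>"
  have "((\<lambda>u. u powr of_real (- N)) has_field_derivative of_real (- N) * rho2 z w powr (of_real (- N) - 1)) (at (rho2 z w))"
    by (rule has_field_derivative_powr[OF Re_pos_not_nonpos_Reals[OF Re_rho2_pos[OF assms]]])
  hence "((\<lambda>u. u powr of_real (- N)) has_derivative (\<lambda>h. of_real (- N) * rho2 z w powr (of_real (- N) - 1) * h)) (at (rho2 z w))"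
    by (simp only: has_field_derivative_def)
  from diff_chain_at[OF rho2_has_derivative this]
  have "((\<lambda>z. rho2 z w powr of_real (- N)) has_derivative (\<lambda>h. of_real (- N) * rho2 z w powr (of_real (- N) - 1) * drho2 z w h)) (at z)"
    by (simp add: o_def)
  from has_derivative_mult_right[OF this, of "of_real (kernel_const \<alpha> TYPE('n))"]
  show ?thesis
    unfolding bergman_kernel_alt[abs_def] N_def[symmetric]
  proof (rule has_derivative_eq_rhs)
    have e: "complex_of_real (- N) - 1 = of_real (- (real CARD('n) + 2 + \<alpha>))" by (simp add: N_def)
    show "(\<lambda>h. of_real (kernel_const \<alpha> TYPE('n)) * (of_real (- N) * rho2 z w powr (of_real (- N) - 1) * drho2 z w h)) = dkernel \<alpha> z w"
      unfolding e by (rule ext) (simp only: dkernel_def N_def of_real_mult mult.assoc)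
  qed
qed

lemma dkernel_linear: "dkernel \<alpha> z w (c *s h) = c * dkernel \<alpha> z w h"
  by (simp add: dkernel_def drho2_def sum_distrib_left algebra_simps)

text \<open>w_n does not occur in \<open>drho2\<close>, and each w_j is of order sqrt (tube_size w).
  So the derivative of \<open>rho2\<close> costs half a power only.\<close>

lemma drho2_bound:
  fixes z w h :: "complex^'n::{finite,linorder}"
  assumes "norm z \<le> R"
  shows "cmod (drho2 z w h) \<le> (real CARD('n) * (R + 1) + 1) * norm h * sqrt (tube_size w)"
proof -
  have R: "R \<ge> 0" using assms norm_ge_zero order_trans by blast
  have t: "sqrt (tube_size w) \<ge> 1" using tube_size_ge_1[of w] by simp
  have "cmod (drho2 z w h) \<le> cmod (1 / 2 * (\<Sum>j\<in>{..<last_idx}. (z $ j - cnj (w $ j)) * h $ j)) + cmod (\<i> / 2 * h $ last_idx)"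
    unfolding drho2_def by (rule norm_triangle_ineq4)
  also have "\<dots> \<le> (\<Sum>j\<in>{..<last_idx::'n}. (R + 1) * norm h * sqrt (tube_size w)) + norm h * sqrt (tube_size w)"
  proof (rule add_mono)
    have "cmod (1 / 2 * (\<Sum>j\<in>{..<last_idx}. (z $ j - cnj (w $ j)) * h $ j)) \<le> cmod (\<Sum>j\<in>{..<last_idx}. (z $ j - cnj (w $ j)) * h $ j)"
      by (simp add: norm_mult)
    also have "\<dots> \<le> (\<Sum>j\<in>{..<last_idx::'n}. (R + 1) * norm h * sqrt (tube_size w))"
    proof (intro order_trans[OF norm_sum] sum_mono)
      fix j :: 'n assume "j \<in> {..<last_idx}"
      hence "cmod (w $ j) \<le> sqrt (tube_size w)" by (intro norm_nth_le_tube_size) simp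
      moreover have "cmod (z $ j) \<le> R" using Finite_Cartesian_Product.norm_nth_le[of z j] assms by linarith
      moreover have "R * 1 \<le> R * sqrt (tube_size w)" using R t by (intro mult_left_mono) auto
      ultimately have "cmod (z $ j - cnj (w $ j)) \<le> (R + 1) * sqrt (tube_size w)"
        using norm_triangle_ineq4[of "z $ j" "cnj (w $ j)"] by (simp add: algebra_simps)
      hence "cmod (z $ j - cnj (w $ j)) * cmod (h $ j) \<le> ((R + 1) * sqrt (tube_size w)) * norm h"
        using R t by (intro mult_mono Finite_Cartesian_Product.norm_nth_le) auto
      thus "cmod ((z $ j - cnj (w $ j)) * h $ j) \<le> (R + 1) * norm h * sqrt (tube_size w)" by (simp add: norm_mult mult_ac)
    qed
    finally show "cmod (1 / 2 * (\<Sum>j\<in>{..<last_idx}. (z $ j - cnj (w $ j)) * h $ j)) \<le> (\<Sum>j\<in>{..<last_idx::'n}. (R + 1) * norm h * sqrt (tube_size w))" .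
    have "cmod (\<i> / 2 * h $ last_idx) = cmod (h $ last_idx) / 2" by (simp add: norm_mult norm_divide)
    hence "cmod (\<i> / 2 * h $ last_idx) \<le> norm h"
      using Finite_Cartesian_Product.norm_nth_le[of h last_idx] norm_ge_zero[of h] by linarith
    also have "norm h * 1 \<le> norm h * sqrt (tube_size w)" using t by (intro mult_left_mono) auto
    finally show "cmod (\<i> / 2 * h $ last_idx) \<le> norm h * sqrt (tube_size w)" by simp
  qed
  also have "\<dots> \<le> real CARD('n) * ((R + 1) * norm h * sqrt (tube_size w)) + norm h * sqrt (tube_size w)"
    using R t by (simp add: mult_right_mono card_mono)
  finally show ?thesis by (simp add: algebra_simps)
qed

text \<open>Differentiation raises the exponent to n + 2 + \<alpha>, of which \<open>drho2\<close>
  takes back 1/2. The result is above the critical exponent n + 1 + \<alpha> by 1/2. Compactness of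
  S provides the R and r of the comparison with \<open>tube_size\<close>.\<close>

lemma dkernel_bound:
  fixes S :: "(complex, 'n::{finite,linorder}) vec set"
  assumes S: "compact S" "S \<subseteq> tube" and \<alpha>: "\<alpha> > -1"
  obtains C where "C \<ge> 0" "\<And>z w h. z \<in> S \<Longrightarrow> w \<in> tube \<Longrightarrow>
     cmod (dkernel \<alpha> z w h) \<le> C * tube_size w powr (- (real CARD('n) + 3 / 2 + \<alpha>)) * norm h"
proof (cases "S = {}")
  case True
  thus ?thesis using that[of 0] by simp
next
  case False
  define N where "N = real CARD('n) + 2 + \<alpha>"
  have N: "N > 0" using \<alpha> by (simp add: N_def)
  obtain R where R: "\<And>z. z \<in> S \<Longrightarrow> norm z \<le> R" using compact_imp_bounded[OF S(1)] bounded_iff by blast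
  have "continuous_on S rho" unfolding rho_def[abs_def] by (intro continuous_intros)
  from continuous_attains_inf[OF S(1) False this] obtain z0 where z0: "z0 \<in> S" "\<And>z. z \<in> S \<Longrightarrow> rho z0 \<le> rho z" by blast
  define r where "r = rho z0"
  have r: "r > 0" using z0 S(2) by (auto simp: r_def tube_iff)
  have R0: "R \<ge> 0" using R[OF z0(1)] norm_ge_zero order_trans by blast
  define k where "k = 2 * (1 + R + 7 * R\<^sup>2) / r + 30"
  have k: "k > 0" using R0 r unfolding k_def by (intro add_nonneg_pos divide_nonneg_pos) auto
  define C where "C = \<bar>kernel_const \<alpha> TYPE('n) * (- (real CARD('n) + 1 + \<alpha>))\<bar> * k powr N * (real CARD('n) * (R + 1) + 1)"
  show ?thesis
  proof (rule that)
    show "C \<ge> 0" using R0 by (simp add: C_def)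
    fix z w h :: "(complex, 'n) vec" assume z: "z \<in> S" and w: "w \<in> tube"
    have t: "tube_size w \<ge> 1" by (rule tube_size_ge_1)
    have "tube_size w \<le> k * cmod (rho2 z w)"
      unfolding k_def by (rule tube_size_le_rho2) (use z w S R z0 r in \<open>auto simp: r_def\<close>)
    hence "tube_size w / k \<le> cmod (rho2 z w)" using k by (simp add: field_simps)
    hence "cmod (rho2 z w) powr (- N) \<le> (tube_size w / k) powr (- N)" using t k N by (intro powr_mono2') auto
    also have "\<dots> = k powr N * tube_size w powr (- N)" using t k by (simp add: powr_divide powr_minus field_simps)
    finally have 1: "cmod (rho2 z w) powr (- N) \<le> k powr N * tube_size w powr (- N)" .
    have "cmod (dkernel \<alpha> z w h) = \<bar>kernel_const \<alpha> TYPE('n) * (- (real CARD('n) + 1 + \<alpha>))\<bar> * cmod (rho2 z w) powr (- N) * cmod (drho2 z w h)"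
      unfolding dkernel_def N_def[symmetric] norm_mult norm_powr_of_real norm_of_real ..
    also have "\<dots> \<le> \<bar>kernel_const \<alpha> TYPE('n) * (- (real CARD('n) + 1 + \<alpha>))\<bar> * (k powr N * tube_size w powr (- N)) * ((real CARD('n) * (R + 1) + 1) * norm h * sqrt (tube_size w))"
      using 1 R0 by (intro mult_mono drho2_bound R z) (auto intro!: mult_nonneg_nonneg)
    also have "\<dots> = C * (tube_size w powr (- N) * tube_size w powr (1 / 2)) * norm h"
      using t by (simp add: C_def powr_half_sqrt mult_ac)
    also have "tube_size w powr (- N) * tube_size w powr (1 / 2) = tube_size w powr (- (real CARD('n) + 3 / 2 + \<alpha>))"
      by (simp add: powr_add[symmetric] N_def algebra_simps)
    finally show "cmod (dkernel \<alpha> z w h) \<le> C * tube_size w powr (- (real CARD('n) + 3 / 2 + \<alpha>)) * norm h" .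
  qed
qed

lemma kernel_difference_bound:
  assumes S: "convex S" "S \<subseteq> tube" and w: "w \<in> tube"
    and B: "\<And>z h. z \<in> S \<Longrightarrow> cmod (dkernel \<alpha> z w h) \<le> B * norm h" and xy: "x \<in> S" "y \<in> S"
  shows "cmod (bergman_kernel \<alpha> x w - bergman_kernel \<alpha> y w) \<le> B * norm (x - y)"
proof (rule differentiable_bound[OF S(1) _ _ xy, where f' = "\<lambda>z. dkernel \<alpha> z w"])
  fix u assume u: "u \<in> S"
  show "((\<lambda>z. bergman_kernel \<alpha> z w) has_derivative dkernel \<alpha> u w) (at u within S)"
    by (rule has_derivative_at_withinI[OF bergman_kernel_has_derivative]) (use u S w in auto)
  show "onorm (dkernel \<alpha> u w) \<le> B" by (rule onorm_le) (rule B[OF u])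
qed

text \<open>By the mean value inequality on the segment from the base point to z, which lies in the
  convex tube, the modified kernel decays like the derivative of the kernel. This is what makes the
  integral converge for bounded functions.\<close>

lemma mod_kernel_bound:
  fixes z :: "(complex, 'n::{finite,linorder}) vec"
  assumes z: "z \<in> tube" and \<alpha>: "\<alpha> > -1"
  obtains C where "C \<ge> 0" "\<And>w. w \<in> tube \<Longrightarrow>
     cmod (mod_kernel \<alpha> z w) \<le> C * tube_size w powr (- (real CARD('n) + 3 / 2 + \<alpha>))"
proof -
  let ?S = "closed_segment base_pt z"
  have S: "compact ?S" "convex ?S" "?S \<subseteq> tube"
    using closed_segment_subset[OF base_pt_tube z convex_tube] by auto
  obtain C where C: "C \<ge> 0" "\<And>x w h. x \<in> ?S \<Longrightarrow> w \<in> tube \<Longrightarrow>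
     cmod (dkernel \<alpha> x w h) \<le> C * tube_size w powr (- (real CARD('n) + 3 / 2 + \<alpha>)) * norm h"
    using dkernel_bound[OF S(1,3) \<alpha>] by blast
  show ?thesis
  proof (rule that[of "C * norm (z - base_pt)"])
    fix w :: "(complex, 'n) vec" assume w: "w \<in> tube"
    have "cmod (mod_kernel \<alpha> z w) \<le> C * tube_size w powr (- (real CARD('n) + 3 / 2 + \<alpha>)) * norm (z - base_pt)"
      unfolding mod_kernel_def by (rule kernel_difference_bound[OF S(2,3) w C(2)]) (use w in auto)
    thus "cmod (mod_kernel \<alpha> z w) \<le> C * norm (z - base_pt) * tube_size w powr (- (real CARD('n) + 3 / 2 + \<alpha>))"
      by (simp add: mult_ac)
  qed (use C in auto)
qed

subsection \<open>The modified projection of bounded functions\<close>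

lemma tube_sets [measurable]:
  "(tube :: (complex, 'n::{finite,linorder}) vec set) \<in> sets borel" "(tube :: (complex, 'n) vec set) \<in> sets lebesgue"
proof -
  show b: "(tube :: (complex, 'n) vec set) \<in> sets borel" by (rule borel_open[OF open_tube])
  thus "(tube :: (complex, 'n) vec set) \<in> sets lebesgue" by (intro sets_completionI_sets) simp
qed

lemma borel_imp_lebesgue_on: "f \<in> borel_measurable borel \<Longrightarrow> f \<in> borel_measurable (lebesgue_on S)"
  by (intro measurable_restrict_space1 measurable_completion) simp

lemma sets_vol: "sets (vol \<alpha>) = sets (lebesgue_on tube)"
  by (simp add: vol_def)

lemma measurable_vol [simp]: "measurable (vol \<alpha>) N = measurable (lebesgue_on tube) N"
  by (rule measurable_cong_sets) (auto simp: sets_vol)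

lemma rho_powr_measurable: "(\<lambda>z. ennreal (rho z powr \<alpha>)) \<in> borel_measurable (lebesgue_on tube)"
  by (rule borel_imp_lebesgue_on) measurable

lemma AE_vol: "AE w in lebesgue_on tube. P w \<Longrightarrow> AE w in vol \<alpha>. P w"
  unfolding vol_def by (subst AE_density[OF rho_powr_measurable]) auto

lemma AE_vol_tube: "(\<And>w. w \<in> tube \<Longrightarrow> P w) \<Longrightarrow> AE w in vol \<alpha>. P w"
  by (intro AE_vol AE_I2) auto

text \<open>\<open>vol\<close> is a density on the completed measure restricted to the tube, while
  the estimates are on \<open>lborel\<close> with the weight extended by 0; this passes from the one
  to the other.\<close>

lemma nn_integral_vol:
  fixes g :: "complex^'n::{finite,linorder} \<Rightarrow> real"
  assumes [measurable]: "g \<in> borel_measurable borel"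
  shows "(\<integral>\<^sup>+w. ennreal (g w) \<partial>vol \<alpha>) = (\<integral>\<^sup>+w. ennreal (pos_powr (rho w) \<alpha> * g w) \<partial>lborel)"
proof -
  have "(\<integral>\<^sup>+w. ennreal (g w) \<partial>vol \<alpha>) = (\<integral>\<^sup>+w. ennreal (rho w powr \<alpha>) * ennreal (g w) \<partial>lebesgue_on tube)"
    unfolding vol_def by (rule nn_integral_density[OF rho_powr_measurable]) (rule borel_imp_lebesgue_on, measurable)
  also have "\<dots> = (\<integral>\<^sup>+w. ennreal (rho w powr \<alpha>) * ennreal (g w) * indicator tube w \<partial>lborel)"
    by (subst nn_integral_restrict_space) (auto simp: nn_integral_completion tube_sets)
  also have "\<dots> = (\<integral>\<^sup>+w. ennreal (pos_powr (rho w) \<alpha> * g w) \<partial>lborel)"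
    by (intro nn_integral_cong) (auto simp: pos_powr_def tube_iff ennreal_mult' split: split_indicator)
  finally show ?thesis .
qed

lemma integral_vol:
  fixes h :: "complex^'n::{finite,linorder} \<Rightarrow> complex"
  assumes "h \<in> borel_measurable (lebesgue_on tube)"
  shows "(LINT w|vol \<alpha>. h w) = (LINT w|lebesgue_on tube. rho w powr \<alpha> *\<^sub>R h w)"
  unfolding vol_def
  by (rule integral_density[OF assms]) (auto intro: borel_imp_lebesgue_on)

lemma integral_vol_lborel:
  fixes h :: "complex^'n::{finite,linorder} \<Rightarrow> complex"
  assumes h: "h \<in> borel_measurable (lebesgue_on tube)"
    and m: "(\<lambda>w. of_real (pos_powr (rho w) \<alpha>) * h w) \<in> borel_measurable borel"
  shows "(LINT w|vol \<alpha>. h w) = (LINT w|lborel. of_real (pos_powr (rho w) \<alpha>) * h w)"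
proof -
  have "(LINT w|vol \<alpha>. h w) = (LINT w|lebesgue. indicator tube w *\<^sub>R (rho w powr \<alpha> *\<^sub>R h w))"
    unfolding integral_vol[OF h] by (rule integral_restrict_space) (simp add: tube_sets)
  also have "(\<lambda>w. indicator tube w *\<^sub>R (rho w powr \<alpha> *\<^sub>R h w)) = (\<lambda>w. of_real (pos_powr (rho w) \<alpha>) * h w)"
    by (auto simp: fun_eq_iff pos_powr_def tube_iff scaleR_conv_of_real split: split_indicator)
  finally show ?thesis using integral_completion[of _ lborel] m by simp
qed

text \<open>h is Lebesgue measurable but perhaps not Borel, so it is compared with a Borel majorant,
  for which the weighted integral on \<open>lborel\<close> is available.\<close>

lemma vol_dominated:
  fixes h :: "complex^'n::{finite,linorder} \<Rightarrow> complex" and g :: "complex^'n::{finite,linorder} \<Rightarrow> real"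
  assumes h: "h \<in> borel_measurable (lebesgue_on tube)" and g[measurable]: "g \<in> borel_measurable borel"
    and le: "AE w in lebesgue_on tube. cmod (h w) \<le> g w"
    and E: "(\<integral>\<^sup>+w. ennreal (pos_powr (rho w) \<alpha> * g w) \<partial>lborel) \<le> ennreal E" "E \<ge> 0"
  shows "integrable (vol \<alpha>) h" "cmod (LINT w|vol \<alpha>. h w) \<le> E"
proof -
  have "(\<integral>\<^sup>+w. ennreal (cmod (h w)) \<partial>vol \<alpha>) \<le> (\<integral>\<^sup>+w. ennreal (g w) \<partial>vol \<alpha>)"
  proof (rule nn_integral_mono_AE)
    show "AE w in vol \<alpha>. ennreal (cmod (h w)) \<le> ennreal (g w)"
      using AE_vol[OF le] by eventually_elim (rule ennreal_leI)
  qed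
  also have "\<dots> \<le> ennreal E" unfolding nn_integral_vol[OF g] by (rule E)
  finally have b: "(\<integral>\<^sup>+w. ennreal (cmod (h w)) \<partial>vol \<alpha>) \<le> ennreal E" .
  show i: "integrable (vol \<alpha>) h"
    by (rule integrableI_bounded) (use h le_less_trans[OF b ennreal_less_top] in auto)
  have "ennreal (cmod (LINT w|vol \<alpha>. h w)) \<le> ennreal E"
    using order_trans[OF integral_norm_bound_ennreal[OF i] b] .
  thus "cmod (LINT w|vol \<alpha>. h w) \<le> E" using E(2) by (simp add: ennreal_le_iff)
qed

lemma vol_dominated_finite:
  fixes h :: "complex^'n::{finite,linorder} \<Rightarrow> complex" and g :: "complex^'n::{finite,linorder} \<Rightarrow> real"
  assumes "h \<in> borel_measurable (lebesgue_on tube)" "g \<in> borel_measurable borel"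
    and "AE w in lebesgue_on tube. cmod (h w) \<le> g w"
    and fin: "(\<integral>\<^sup>+w. ennreal (pos_powr (rho w) \<alpha> * g w) \<partial>lborel) < \<infinity>"
  shows "integrable (vol \<alpha>) h"
proof -
  obtain E where "E \<ge> 0" "(\<integral>\<^sup>+w. ennreal (pos_powr (rho w) \<alpha> * g w) \<partial>lborel) = ennreal E"
    using fin by (cases "\<integral>\<^sup>+w. ennreal (pos_powr (rho w) \<alpha> * g w) \<partial>lborel") auto
  thus ?thesis using vol_dominated(1)[OF assms(1-3), of \<alpha> E] by simp
qed

text \<open>Over a null space the essential supremum would be -\<infinity>, and the norm would lose
  its meaning.\<close>

lemma tube_not_null: "\<not> (AE w in lebesgue_on (tube :: (complex, 'n::{finite,linorder}) vec set). False)"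
proof
  assume "AE w in lebesgue_on (tube :: (complex, 'n) vec set). False"
  hence "emeasure (lebesgue_on (tube :: (complex, 'n) vec set)) tube = 0"
    using ae_filter_eq_bot_iff[of "lebesgue_on (tube :: (complex, 'n) vec set)"] by (simp add: trivial_limit_def)
  hence "emeasure lebesgue (tube :: (complex, 'n) vec set) = 0"
    by (subst (asm) emeasure_restrict_space) (auto simp: tube_sets)
  hence "negligible (tube :: (complex, 'n) vec set)"
    by (simp add: negligible_iff_null_sets null_sets_def tube_sets)
  thus False using open_not_negligible[OF open_tube] base_pt_tube by blast
qed

lemma Linf_AE:
  fixes f :: "complex^'n::{finite,linorder} \<Rightarrow> complex"
  assumes f: "f \<in> Linf"
  shows "AE w in lebesgue_on tube. cmod (f w) \<le> Linf_norm f"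
proof -
  let ?E = "esssup (lebesgue_on tube) (\<lambda>z. ereal (cmod (f z)))"
  have E: "AE w in lebesgue_on tube. ereal (cmod (f w)) \<le> ?E" by (rule esssup_AE)
  \<comment> \<open>\<open>real_of_ereal\<close> sends both infinite values to 0, so both have to be
    excluded before \<open>Linf_norm\<close> is an almost everywhere bound.\<close>
  have "?E \<noteq> - \<infinity>"
  proof
    assume "?E = - \<infinity>"
    with E have "AE w in lebesgue_on (tube :: (complex, 'n) vec set). False" by simp
    thus False using tube_not_null by blast
  qed
  moreover have "?E < \<infinity>" using f by (simp add: Linf_def)
  ultimately have "ereal (Linf_norm f) = ?E" unfolding Linf_norm_def by (intro ereal_real') (cases ?E, auto)
  with E show ?thesis by (metis (mono_tags, lifting) AE_cong ereal_less_eq(3))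
qed

lemma Linf_norm_nonneg:
  fixes f :: "complex^'n::{finite,linorder} \<Rightarrow> complex"
  assumes f: "f \<in> Linf"
  shows "Linf_norm f \<ge> 0"
proof (rule ccontr)
  assume "\<not> Linf_norm f \<ge> 0"
  hence "AE w in lebesgue_on (tube :: (complex, 'n) vec set). False"
    using Linf_AE[OF f] by (auto elim!: eventually_mono) (metis norm_ge_zero order_trans)
  thus False using tube_not_null by blast
qed

lemma Linf_measurable: "f \<in> Linf \<Longrightarrow> f \<in> borel_measurable (lebesgue_on tube)"
  by (simp add: Linf_def)

lemma bergman_kernel_measurable [measurable]: "bergman_kernel \<alpha> z \<in> borel_measurable borel"
  unfolding bergman_kernel_def[abs_def] by measurable

lemma mod_kernel_measurable [measurable]: "mod_kernel \<alpha> z \<in> borel_measurable borel"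
  unfolding mod_kernel_def[abs_def] by measurable

lemma dkernel_measurable [measurable]: "(\<lambda>w. dkernel \<alpha> z w h) \<in> borel_measurable borel"
proof -
  have "continuous_on UNIV (\<lambda>w. drho2 z w h)" unfolding drho2_def by (intro continuous_intros)
  hence [measurable]: "(\<lambda>w. drho2 z w h) \<in> borel_measurable borel" by (rule borel_measurable_continuous_onI)
  show ?thesis unfolding dkernel_def by measurable
qed

lemma Linf_kernel_bound:
  fixes f :: "complex^'n::{finite,linorder} \<Rightarrow> complex"
  assumes f: "f \<in> Linf" and k[measurable]: "k \<in> borel_measurable borel" and g[measurable]: "g \<in> borel_measurable borel"
    and le: "\<And>w. w \<in> tube \<Longrightarrow> cmod (k w) \<le> g w" and g0: "\<And>w. g w \<ge> 0"
    and E: "(\<integral>\<^sup>+w. ennreal (pos_powr (rho w) \<alpha> * g w) \<partial>lborel) \<le> ennreal E" "E \<ge> 0"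
  shows "integrable (vol \<alpha>) (\<lambda>w. k w * f w)" "cmod (LINT w|vol \<alpha>. k w * f w) \<le> E * Linf_norm f"
proof -
  have m: "(\<lambda>w. k w * f w) \<in> borel_measurable (lebesgue_on tube)"
    by (intro borel_measurable_times borel_imp_lebesgue_on k Linf_measurable f)
  have "AE w in lebesgue_on tube. cmod (k w) \<le> g w" using le by (intro AE_I2) auto
  with Linf_AE[OF f] have ae: "AE w in lebesgue_on tube. cmod (k w * f w) \<le> g w * Linf_norm f"
    by eventually_elim (simp add: norm_mult mult_mono g0)
  have "(\<integral>\<^sup>+w. ennreal (pos_powr (rho w) \<alpha> * (g w * Linf_norm f)) \<partial>lborel) = (\<integral>\<^sup>+w. ennreal (pos_powr (rho w) \<alpha> * g w) * ennreal (Linf_norm f) \<partial>lborel)"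
    using g0 Linf_norm_nonneg[OF f] by (intro nn_integral_cong) (simp add: ennreal_mult'[symmetric] mult_ac)
  also have "\<dots> = (\<integral>\<^sup>+w. ennreal (pos_powr (rho w) \<alpha> * g w) \<partial>lborel) * ennreal (Linf_norm f)"
    by (rule nn_integral_multc) measurable
  also have "\<dots> \<le> ennreal (E * Linf_norm f)"
    using E Linf_norm_nonneg[OF f] by (simp add: ennreal_mult' mult_right_mono)
  finally have fin: "(\<integral>\<^sup>+w. ennreal (pos_powr (rho w) \<alpha> * (g w * Linf_norm f)) \<partial>lborel) \<le> ennreal (E * Linf_norm f)" .
  have g': "(\<lambda>w. g w * Linf_norm f) \<in> borel_measurable borel" by measurable
  have E': "E * Linf_norm f \<ge> 0" using E Linf_norm_nonneg[OF f] by simp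
  show "integrable (vol \<alpha>) (\<lambda>w. k w * f w)" "cmod (LINT w|vol \<alpha>. k w * f w) \<le> E * Linf_norm f"
    by (rule vol_dominated[OF m g' ae fin E'])+
qed

lemma tube_size_bound_obtain:
  assumes \<alpha>: "\<alpha> > -1"
  obtains E where "E \<ge> 0" "(\<integral>\<^sup>+w. ennreal (pos_powr (rho w) \<alpha> * (C * tube_size (w :: (complex, 'n::{finite,linorder}) vec) powr (- (real CARD('n) + 3 / 2 + \<alpha>)))) \<partial>lborel) \<le> ennreal E"
proof -
  have "(\<integral>\<^sup>+w. ennreal (pos_powr (rho w) \<alpha> * tube_size (w :: (complex, 'n) vec) powr (- (real CARD('n) + 3 / 2 + \<alpha>))) \<partial>lborel) < \<infinity>"
    by (rule tube_size_integral[OF \<alpha>]) simp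
  hence "(\<integral>\<^sup>+w. ennreal \<bar>C\<bar> * ennreal (pos_powr (rho w) \<alpha> * tube_size (w :: (complex, 'n) vec) powr (- (real CARD('n) + 3 / 2 + \<alpha>))) \<partial>lborel) < \<infinity>"
    by (subst nn_integral_cmult) (auto simp: ennreal_mult_less_top)
  moreover have "(\<integral>\<^sup>+w. ennreal (pos_powr (rho w) \<alpha> * (C * tube_size (w :: (complex, 'n) vec) powr (- (real CARD('n) + 3 / 2 + \<alpha>)))) \<partial>lborel)
     \<le> (\<integral>\<^sup>+w. ennreal \<bar>C\<bar> * ennreal (pos_powr (rho w) \<alpha> * tube_size (w :: (complex, 'n) vec) powr (- (real CARD('n) + 3 / 2 + \<alpha>))) \<partial>lborel)"
  proof (rule nn_integral_mono)
    fix w :: "(complex, 'n) vec"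
    have "C * (pos_powr (rho w) \<alpha> * tube_size w powr (- (real CARD('n) + 3 / 2 + \<alpha>))) \<le> \<bar>C\<bar> * (pos_powr (rho w) \<alpha> * tube_size w powr (- (real CARD('n) + 3 / 2 + \<alpha>)))"
      by (intro mult_right_mono) auto
    thus "ennreal (pos_powr (rho w) \<alpha> * (C * tube_size w powr (- (real CARD('n) + 3 / 2 + \<alpha>)))) \<le> ennreal \<bar>C\<bar> * ennreal (pos_powr (rho w) \<alpha> * tube_size w powr (- (real CARD('n) + 3 / 2 + \<alpha>)))"
      by (simp add: ennreal_mult'[symmetric] mult_ac ennreal_leI)
  qed
  ultimately have "(\<integral>\<^sup>+w. ennreal (pos_powr (rho w) \<alpha> * (C * tube_size (w :: (complex, 'n) vec) powr (- (real CARD('n) + 3 / 2 + \<alpha>)))) \<partial>lborel) < \<infinity>"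
    by (rule le_less_trans[rotated])
  thus ?thesis using that
    by (cases "\<integral>\<^sup>+w. ennreal (pos_powr (rho w) \<alpha> * (C * tube_size (w :: (complex, 'n) vec) powr (- (real CARD('n) + 3 / 2 + \<alpha>)))) \<partial>lborel") auto
qed

section \<open>Convergence and differentiation of the projection\<close>

lemma mod_proj_integrable:
  fixes f :: "complex^'n::{finite,linorder} \<Rightarrow> complex"
  assumes \<alpha>: "\<alpha> > -1" and f: "f \<in> Linf" and z: "z \<in> tube"
  shows "integrable (vol \<alpha>) (\<lambda>w. mod_kernel \<alpha> z w * f w)"
proof -
  obtain C where C: "C \<ge> 0" "\<And>w. w \<in> tube \<Longrightarrow> cmod (mod_kernel \<alpha> z w) \<le> C * tube_size w powr (- (real CARD('n) + 3 / 2 + \<alpha>))"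
    by (rule mod_kernel_bound[OF z \<alpha>]) blast
  obtain E where E: "E \<ge> 0" "(\<integral>\<^sup>+w. ennreal (pos_powr (rho w) \<alpha> * (C * tube_size (w :: (complex, 'n) vec) powr (- (real CARD('n) + 3 / 2 + \<alpha>)))) \<partial>lborel) \<le> ennreal E"
    by (rule tube_size_bound_obtain[OF \<alpha>, of C, where 'n = 'n]) blast
  show ?thesis
    by (rule Linf_kernel_bound(1)[OF f _ _ C(2) _ E(2,1)]) (use C(1) in auto)
qed

lemma drho2_add: "drho2 z w (h + h') = drho2 z w h + drho2 z w h'"
  by (simp only: drho2_def vector_add_component distrib_left sum.distrib) simp

lemma dkernel_add: "dkernel \<alpha> z w (h + h') = dkernel \<alpha> z w h + dkernel \<alpha> z w h'"
  by (simp only: dkernel_def drho2_add distrib_left)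

lemma pd_eq:
  fixes F :: "complex^'n::finite \<Rightarrow> complex"
  assumes D: "(F has_derivative D) (at z)" "\<And>a v. D (a *s v) = a * D v"
  shows "pd j F z = D (axis j 1)"
proof -
  have "((\<lambda>t. F (z + axis j t)) has_field_derivative D (axis j 1)) (at 0)"
  proof (rule holomorphic_several_curve[where c = "\<lambda>t. z + axis j t"])
    have e: "z + axis j 0 = z" by (simp add: vec_eq_iff axis_def)
    show "(F has_derivative D) (at (z + axis j 0))" unfolding e by (rule D(1))
    show "((\<lambda>t. (z + axis j t) $ i) has_field_derivative axis j 1 $ i) (at 0)" for i
      by (cases "i = j") (auto simp: axis_def intro!: derivative_eq_intros)
  qed (rule D(2))
  thus ?thesis unfolding pd_def by (rule DERIV_imp_deriv)
qed

text \<open>By dominated convergence of the difference quotients.\<close>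

lemma mod_proj_has_derivative:
  fixes f :: "complex^'n::{finite,linorder} \<Rightarrow> complex"
  assumes \<alpha>: "\<alpha> > -1" and f: "f \<in> Linf" and z: "z \<in> tube"
  shows "(mod_proj \<alpha> f has_derivative (\<lambda>h. LINT w|vol \<alpha>. dkernel \<alpha> z w h * f w)) (at z)"
    and "integrable (vol \<alpha>) (\<lambda>w. dkernel \<alpha> z w h * f w)"
    and "(LINT w|vol \<alpha>. dkernel \<alpha> z w (c *s h) * f w) = c * (LINT w|vol \<alpha>. dkernel \<alpha> z w h * f w)"
proof -
  let ?t = "\<lambda>w :: (complex, 'n) vec. tube_size w powr (- (real CARD('n) + 3 / 2 + \<alpha>))"
  obtain e where e: "e > 0" "cball z e \<subseteq> tube" using open_contains_cball[of tube] open_tube z by blast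
  obtain C where C: "C \<ge> 0" "\<And>x w h. x \<in> cball z e \<Longrightarrow> w \<in> tube \<Longrightarrow> cmod (dkernel \<alpha> x w h) \<le> C * ?t w * norm h"
    by (rule dkernel_bound[OF compact_cball e(2) \<alpha>]) blast
  obtain E where E: "E \<ge> 0" "(\<integral>\<^sup>+w. ennreal (pos_powr (rho w) \<alpha> * (1 * ?t w)) \<partial>lborel) \<le> ennreal E"
    by (rule tube_size_bound_obtain[OF \<alpha>, of 1, where 'n = 'n]) blast
  have bnd: "integrable (vol \<alpha>) (\<lambda>w. k w * f w)" "cmod (LINT w|vol \<alpha>. k w * f w) \<le> B * E * Linf_norm f"
    if k: "k \<in> borel_measurable borel" "\<And>w. w \<in> tube \<Longrightarrow> cmod (k w) \<le> B * ?t w" "B \<ge> 0" for k B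
  proof -
    have "(\<integral>\<^sup>+w. ennreal (pos_powr (rho w) \<alpha> * (B * ?t w)) \<partial>lborel) = (\<integral>\<^sup>+w. ennreal B * ennreal (pos_powr (rho w) \<alpha> * (1 * ?t w)) \<partial>lborel)"
      using that by (intro nn_integral_cong) (simp add: ennreal_mult'[symmetric] mult_ac)
    also have "\<dots> = ennreal B * (\<integral>\<^sup>+w. ennreal (pos_powr (rho w) \<alpha> * (1 * ?t w)) \<partial>lborel)" by (rule nn_integral_cmult) measurable
    also have "\<dots> \<le> ennreal (B * E)" using E that by (simp add: ennreal_mult' mult_left_mono)
    finally have b: "(\<integral>\<^sup>+w. ennreal (pos_powr (rho w) \<alpha> * (B * ?t w)) \<partial>lborel) \<le> ennreal (B * E)" .
    show "integrable (vol \<alpha>) (\<lambda>w. k w * f w)" "cmod (LINT w|vol \<alpha>. k w * f w) \<le> B * E * Linf_norm f"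
      by (rule Linf_kernel_bound[OF f k(1) _ k(2) _ b]; use k(3) E(1) in simp)+
  qed
  have dint: "integrable (vol \<alpha>) (\<lambda>w. dkernel \<alpha> z w h * f w)" for h
    by (rule bnd(1)[where B = "C * norm h"]) (use C e in \<open>auto simp: mult_ac\<close>)
  show "integrable (vol \<alpha>) (\<lambda>w. dkernel \<alpha> z w h * f w)" by (rule dint)
  define D where "D h = (LINT w|vol \<alpha>. dkernel \<alpha> z w h * f w)" for h
  show sc: "(LINT w|vol \<alpha>. dkernel \<alpha> z w (c *s h) * f w) = c * (LINT w|vol \<alpha>. dkernel \<alpha> z w h * f w)" for c h
    unfolding dkernel_linear mult.assoc by (rule integral_mult_right_zero)
  have scR: "r *\<^sub>R h = of_real r *s h" for r and h :: "(complex, 'n) vec"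
    by (simp add: vec_eq_iff) (simp add: scaleR_conv_of_real)
  have "bounded_linear D"
  proof (rule bounded_linear_intro[where K = "C * E * Linf_norm f"])
    show "D (h + h') = D h + D h'" for h h'
      unfolding D_def dkernel_add distrib_right by (rule Bochner_Integration.integral_add[OF dint dint])
    show "D (r *\<^sub>R h) = r *\<^sub>R D h" for r h
      unfolding D_def scR sc by (simp add: scaleR_conv_of_real)
    fix h
    have "cmod (D h) \<le> (C * norm h) * E * Linf_norm f"
      unfolding D_def by (rule bnd(2)[where B = "C * norm h"]) (use C e in \<open>auto simp: mult_ac\<close>)
    thus "norm (D h) \<le> norm h * (C * E * Linf_norm f)" by (simp add: mult_ac)
  qed
  moreover have "((\<lambda>h. norm (mod_proj \<alpha> f (z + h) - mod_proj \<alpha> f z - D h) / norm h) \<longlongrightarrow> 0) (at 0)"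
    unfolding tendsto_at_iff_sequentially
  proof (intro allI impI)
    fix X :: "nat \<Rightarrow> (complex, 'n) vec" assume X: "\<forall>i. X i \<in> UNIV - {0}" "X \<longlonglongrightarrow> 0"
    have "(\<lambda>i. norm (X i)) \<longlonglongrightarrow> 0" using X(2) by (rule tendsto_norm_zero)
    hence "eventually (\<lambda>i. norm (X i) < e) sequentially" using e(1) by (rule order_tendstoD)
    then obtain n0 where n0: "\<And>i. i \<ge> n0 \<Longrightarrow> norm (X i) < e" unfolding eventually_sequentially by blast
    \<comment> \<open>The tail of the sequence keeps z + Y i in the ball on which the bound C is
      uniform.\<close>
    define Y where "Y i = X (i + n0)" for i
    have Y: "Y i \<noteq> 0" "norm (Y i) < e" "z + Y i \<in> cball z e" for i
      using X(1) n0[of "i + n0"] by (auto simp: Y_def dist_norm)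
    have Ylim: "Y \<longlonglongrightarrow> 0" unfolding Y_def using X(2) by (rule LIMSEQ_ignore_initial_segment)
    define q where "q i w = (bergman_kernel \<alpha> (z + Y i) w - bergman_kernel \<alpha> z w - dkernel \<alpha> z w (Y i)) / of_real (norm (Y i))" for i w
    have qm: "q i \<in> borel_measurable borel" for i unfolding q_def[abs_def] by measurable
    have qb: "cmod (q i w) \<le> (2 * C) * ?t w" if w: "w \<in> tube" for i w
    proof -
      have "cmod (bergman_kernel \<alpha> (z + Y i) w - bergman_kernel \<alpha> z w) \<le> C * ?t w * norm (z + Y i - z)"
        by (rule kernel_difference_bound[OF convex_cball e(2) w C(2)]) (use w Y e in auto)
      moreover have "cmod (dkernel \<alpha> z w (Y i)) \<le> C * ?t w * norm (Y i)" using C(2) w e by simp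
      ultimately have "cmod (bergman_kernel \<alpha> (z + Y i) w - bergman_kernel \<alpha> z w - dkernel \<alpha> z w (Y i)) \<le> 2 * C * ?t w * norm (Y i)"
        using norm_triangle_ineq4[of "bergman_kernel \<alpha> (z + Y i) w - bergman_kernel \<alpha> z w" "dkernel \<alpha> z w (Y i)"] by simp
      thus ?thesis using Y(1)[of i] by (simp add: q_def norm_divide divide_le_eq mult_ac)
    qed
    have "(\<lambda>i. LINT w|vol \<alpha>. q i w * f w) \<longlonglongrightarrow> integral\<^sup>L (vol \<alpha>) (\<lambda>w :: (complex, 'n) vec. 0 :: complex)"
    proof (rule integral_dominated_convergence[where w = "\<lambda>w. cmod (of_real (2 * C * tube_size w powr (- (real CARD('n) + 3 / 2 + \<alpha>))) * f w)"])
      show "integrable (vol \<alpha>) (\<lambda>w. cmod (of_real (2 * C * ?t w) * f w))"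
        by (intro integrable_norm bnd(1)[where B = "2 * C"]) (use C(1) in \<open>auto simp: norm_mult\<close>)
      show "(\<lambda>w. q i w * f w) \<in> borel_measurable (vol \<alpha>)" for i
        unfolding measurable_vol by (intro borel_measurable_times borel_imp_lebesgue_on qm Linf_measurable f)
      show "AE w in vol \<alpha>. cmod (q i w * f w) \<le> cmod (of_real (2 * C * ?t w) * f w)" for i
        using qb[of _ i] C(1) by (intro AE_vol_tube) (simp add: norm_mult mult_right_mono)
      show "AE w in vol \<alpha>. (\<lambda>i. q i w * f w) \<longlonglongrightarrow> 0"
      proof (rule AE_vol_tube)
        fix w :: "(complex, 'n) vec" assume w: "w \<in> tube"
        have "((\<lambda>h. norm (bergman_kernel \<alpha> (z + h) w - bergman_kernel \<alpha> z w - dkernel \<alpha> z w h) / norm h) \<longlongrightarrow> 0) (at 0)"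
          using bergman_kernel_has_derivative[OF z w, of \<alpha>] unfolding has_derivative_at by blast
        hence "((\<lambda>h. norm (bergman_kernel \<alpha> (z + h) w - bergman_kernel \<alpha> z w - dkernel \<alpha> z w h) / norm h) \<circ> Y) \<longlonglongrightarrow> 0"
          using Ylim Y(1) unfolding tendsto_at_iff_sequentially by blast
        hence "(\<lambda>i. norm (q i w)) \<longlonglongrightarrow> 0" by (simp add: o_def q_def norm_divide)
        hence "(\<lambda>i. q i w) \<longlonglongrightarrow> 0" by (rule tendsto_norm_zero_cancel)
        thus "(\<lambda>i. q i w * f w) \<longlonglongrightarrow> 0" by (rule tendsto_mult_left_zero)
      qed
    qed auto
    hence "(\<lambda>i. norm (LINT w|vol \<alpha>. q i w * f w)) \<longlonglongrightarrow> 0" by (simp add: tendsto_norm_zero)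
    moreover have "norm (LINT w|vol \<alpha>. q i w * f w) = norm (mod_proj \<alpha> f (z + Y i) - mod_proj \<alpha> f z - D (Y i)) / norm (Y i)" for i
    proof -
      have zY: "z + Y i \<in> tube" using Y(3) e(2) by blast
      \<comment> \<open>The values at the base point cancel in the difference, so plain and modified
        kernels give the same quotient. The integral is split with the modified ones, for which
        integrability against f is known.\<close>
      have q_eq: "q i w * f w = 1 / of_real (norm (Y i)) * ((mod_kernel \<alpha> (z + Y i) w * f w - mod_kernel \<alpha> z w * f w) - dkernel \<alpha> z w (Y i) * f w)" for w
        using Y(1)[of i] by (simp add: q_def mod_kernel_def field_simps)
      note dd = mod_proj_integrable[OF \<alpha> f zY] mod_proj_integrable[OF \<alpha> f z]
      have "(LINT w|vol \<alpha>. (mod_kernel \<alpha> (z + Y i) w * f w - mod_kernel \<alpha> z w * f w) - dkernel \<alpha> z w (Y i) * f w)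
          = mod_proj \<alpha> f (z + Y i) - mod_proj \<alpha> f z - D (Y i)"
        unfolding mod_proj_def D_def
        by (subst Bochner_Integration.integral_diff[OF Bochner_Integration.integrable_diff[OF dd] dint])
           (subst Bochner_Integration.integral_diff[OF dd], rule refl)
      with q_eq have "(LINT w|vol \<alpha>. q i w * f w) = 1 / of_real (norm (Y i)) * (mod_proj \<alpha> f (z + Y i) - mod_proj \<alpha> f z - D (Y i))"
        by (simp only: integral_mult_right_zero)
      thus ?thesis by (simp add: norm_mult norm_divide)
    qed
    ultimately have "(\<lambda>i. norm (mod_proj \<alpha> f (z + Y i) - mod_proj \<alpha> f z - D (Y i)) / norm (Y i)) \<longlonglongrightarrow> 0" by simp
    thus "((\<lambda>h. norm (mod_proj \<alpha> f (z + h) - mod_proj \<alpha> f z - D h) / norm h) \<circ> X) \<longlonglongrightarrow> 0"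
      unfolding Y_def o_def by (rule LIMSEQ_offset[where k = n0])
  qed
  ultimately show "(mod_proj \<alpha> f has_derivative (\<lambda>h. LINT w|vol \<alpha>. dkernel \<alpha> z w h * f w)) (at z)"
    unfolding has_derivative_at D_def by blast
qed

text \<open>The derivative in the direction e_j + 2 y_j e_n, which is complex tangential:
  (\<partial>_j + 2 y_j \<partial>_n) annihilates \<open>rho\<close>. It is therefore weighted by
  sqrt rho only, against rho for the z_n-derivative.\<close>

definition grad_comp :: "'n::{finite,linorder} \<Rightarrow> (complex^'n::{finite,linorder} \<Rightarrow> complex) \<Rightarrow> complex^'n::{finite,linorder} \<Rightarrow> complex" where
  "grad_comp j f z = pd j f z + 2 * complex_of_real (Im (z $ j)) * pd last_idx f z"

text \<open>The squared invariant gradient is 8 times the square of the weighted z_n-derivative plus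
  4 times the squares of the weighted tangential ones, of which there are at most n. Together with
  \<open>inv_grad_ge\<close> this replaces the gradient by its separate components.\<close>

lemma inv_grad_le:
  fixes z :: "complex^'n::{finite,linorder}"
  assumes z: "z \<in> tube" and n: "rho z * cmod (pd last_idx f z) \<le> a"
    and j: "\<And>j. j < last_idx \<Longrightarrow> sqrt (rho z) * cmod (grad_comp j f z) \<le> a"
  shows "inv_grad f z \<le> sqrt (8 + 4 * real CARD('n)) * a"
proof -
  have r: "rho z > 0" using z by (simp add: tube_iff)
  have a: "a \<ge> 0" using n r by (smt (verit) mult_nonneg_nonneg norm_ge_zero)
  have "4 * rho z * (2 * rho z * (cmod (pd last_idx f z))\<^sup>2 + (\<Sum>j\<in>{..<last_idx}. (cmod (grad_comp j f z))\<^sup>2))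
     = 8 * (rho z * cmod (pd last_idx f z))\<^sup>2 + 4 * (\<Sum>j\<in>{..<last_idx}. (sqrt (rho z) * cmod (grad_comp j f z))\<^sup>2)"
    using r by (simp add: power_mult_distrib power2_eq_square[of "rho z"] sum_distrib_left algebra_simps)
  also have "\<dots> \<le> 8 * a\<^sup>2 + 4 * (\<Sum>j\<in>{..<last_idx::'n}. a\<^sup>2)"
    using n j r by (intro add_mono mult_left_mono sum_mono power_mono) auto
  also have "\<dots> \<le> 8 * a\<^sup>2 + 4 * (real CARD('n) * a\<^sup>2)"
    by (intro add_mono mult_left_mono) (auto intro!: mult_right_mono card_mono)
  also have "\<dots> = (8 + 4 * real CARD('n)) * a\<^sup>2" by (simp add: algebra_simps)
  finally have "inv_grad f z \<le> sqrt ((8 + 4 * real CARD('n)) * a\<^sup>2)"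
    unfolding inv_grad_def grad_comp_def[symmetric] by (rule real_sqrt_le_mono)
  thus ?thesis using a by (simp add: real_sqrt_mult)
qed

lemma inv_grad_ge:
  fixes z :: "complex^'n::{finite,linorder}"
  assumes z: "z \<in> tube" and A: "inv_grad f z \<le> A"
  shows "rho z * cmod (pd last_idx f z) \<le> A" "j < last_idx \<Longrightarrow> sqrt (rho z) * cmod (grad_comp j f z) \<le> A"
proof -
  have r: "rho z > 0" using z by (simp add: tube_iff)
  have s0: "(\<Sum>j\<in>{..<last_idx}. (cmod (grad_comp j f z))\<^sup>2) \<ge> 0" by (intro sum_nonneg) auto
  have ig: "inv_grad f z = sqrt (4 * rho z * (2 * rho z * (cmod (pd last_idx f z))\<^sup>2 + (\<Sum>j\<in>{..<last_idx}. (cmod (grad_comp j f z))\<^sup>2)))"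
    by (simp add: inv_grad_def grad_comp_def)
  show "rho z * cmod (pd last_idx f z) \<le> A"
  proof (rule order_trans[OF _ A], unfold ig, rule real_le_rsqrt)
    have "(rho z * cmod (pd last_idx f z))\<^sup>2 \<le> 8 * (rho z * cmod (pd last_idx f z))\<^sup>2" by simp
    also have "\<dots> = 4 * rho z * (2 * rho z * (cmod (pd last_idx f z))\<^sup>2)" by (simp add: power2_eq_square)
    also have "\<dots> \<le> 4 * rho z * (2 * rho z * (cmod (pd last_idx f z))\<^sup>2 + (\<Sum>j\<in>{..<last_idx}. (cmod (grad_comp j f z))\<^sup>2))"
      using r s0 by (intro mult_left_mono) auto
    finally show "(rho z * cmod (pd last_idx f z))\<^sup>2 \<le> 4 * rho z * (2 * rho z * (cmod (pd last_idx f z))\<^sup>2 + (\<Sum>j\<in>{..<last_idx}. (cmod (grad_comp j f z))\<^sup>2))" .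
  qed
  show "sqrt (rho z) * cmod (grad_comp j f z) \<le> A" if j: "j < last_idx"
  proof (rule order_trans[OF _ A], unfold ig, rule real_le_rsqrt)
    have "(cmod (grad_comp j f z))\<^sup>2 \<le> (\<Sum>j\<in>{..<last_idx}. (cmod (grad_comp j f z))\<^sup>2)"
      using j by (intro member_le_sum) auto
    hence "rho z * (cmod (grad_comp j f z))\<^sup>2 \<le> rho z * (2 * rho z * (cmod (pd last_idx f z))\<^sup>2 + (\<Sum>j\<in>{..<last_idx}. (cmod (grad_comp j f z))\<^sup>2))"
      using r by (intro mult_left_mono add_increasing) auto
    also have "\<dots> \<le> 4 * (rho z * (2 * rho z * (cmod (pd last_idx f z))\<^sup>2 + (\<Sum>j\<in>{..<last_idx}. (cmod (grad_comp j f z))\<^sup>2)))"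
      using r s0 by (simp add: add_nonneg_nonneg)
    finally show "(sqrt (rho z) * cmod (grad_comp j f z))\<^sup>2 \<le> 4 * rho z * (2 * rho z * (cmod (pd last_idx f z))\<^sup>2 + (\<Sum>j\<in>{..<last_idx}. (cmod (grad_comp j f z))\<^sup>2))"
      using r by (simp add: power_mult_distrib)
  qed
qed

text \<open>The invariant gradient of the kernel is controlled since
  \<open>(\<partial>\<^sub>j + 2 y\<^sub>j \<partial>\<^sub>n) \<rho>(z,w) = cnj (z\<^sub>j - w\<^sub>j) / 2\<close> and \<open>|z\<^sub>j - w\<^sub>j|\<^sup>2 \<le> 4 |\<rho>(z,w)|\<close>.\<close>

lemma mod_proj_gradient_bound:
  assumes \<alpha>: "\<alpha> > -1"
  obtains C where "C \<ge> 0" "\<And>f z. f \<in> Linf \<Longrightarrow> z \<in> (tube :: (complex, 'n::{finite,linorder}) vec set) \<Longrightarrow> inv_grad (mod_proj \<alpha> f) z \<le> C * Linf_norm f"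
proof -
  define N where "N = real CARD('n) + 1 + \<alpha>"
  define k where "k = \<bar>kernel_const \<alpha> TYPE('n) * (- N)\<bar>"
  \<comment> \<open>The excess is 1 for the z_n-derivative, and 1/2 for the tangential ones because
    of the factor |z_j - w_j|. The resulting powers of \<open>rho\<close> are exactly compensated by
    the weights in the gradient.\<close>
  obtain C1 where C1: "C1 \<ge> 0" "\<And>z :: (complex, 'n) vec. z \<in> tube \<Longrightarrow>
     (\<integral>\<^sup>+w. ennreal (pos_powr (rho w) \<alpha> * cmod (rho2 z w) powr (- (real CARD('n) + 1 + \<alpha> + 1))) \<partial>lborel) \<le> ennreal (C1 * rho z powr (- 1))"
    by (rule tube_integral_bound[OF \<alpha>, of 1, where 'n = 'n]) auto
  obtain C2 where C2: "C2 \<ge> 0" "\<And>z :: (complex, 'n) vec. z \<in> tube \<Longrightarrow>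
     (\<integral>\<^sup>+w. ennreal (pos_powr (rho w) \<alpha> * cmod (rho2 z w) powr (- (real CARD('n) + 1 + \<alpha> + 1 / 2))) \<partial>lborel) \<le> ennreal (C2 * rho z powr (- (1 / 2)))"
    by (rule tube_integral_bound[OF \<alpha>, of "1 / 2", where 'n = 'n]) auto
  define a where "a = k * (C1 + C2)"
  have k0: "k \<ge> 0" by (simp add: k_def)
  show ?thesis
  proof (rule that[of "sqrt (8 + 4 * real CARD('n)) * a"])
    show "sqrt (8 + 4 * real CARD('n)) * a \<ge> 0" using k0 C1 C2 by (simp add: a_def)
    fix f :: "(complex, 'n) vec \<Rightarrow> complex" and z :: "(complex, 'n) vec" assume f: "f \<in> Linf" and z: "z \<in> tube"
    have r: "rho z > 0" using z by (simp add: tube_iff)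
    have L: "Linf_norm f \<ge> 0" by (rule Linf_norm_nonneg[OF f])
    note D = mod_proj_has_derivative[OF \<alpha> f z]
    have pd: "pd j (mod_proj \<alpha> f) z = (LINT w|vol \<alpha>. dkernel \<alpha> z w (axis j 1) * f w)" for j
      by (rule pd_eq[OF D(1) D(3)])
    have dk_norm: "cmod (dkernel \<alpha> z w h) = k * cmod (rho2 z w) powr (- (N + 1)) * cmod (drho2 z w h)" for w h
      unfolding dkernel_def norm_mult norm_powr_of_real norm_of_real k_def N_def by (simp add: add_ac)
    have kint: "(\<integral>\<^sup>+w. ennreal (pos_powr (rho w) \<alpha> * (k * cmod (rho2 z w) powr (- M))) \<partial>lborel) \<le> ennreal (k * B)"
      if "(\<integral>\<^sup>+w. ennreal (pos_powr (rho w) \<alpha> * cmod (rho2 z w) powr (- M)) \<partial>lborel) \<le> ennreal B" for M B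
    proof -
      have "(\<integral>\<^sup>+w. ennreal (pos_powr (rho w) \<alpha> * (k * cmod (rho2 z w) powr (- M))) \<partial>lborel) = (\<integral>\<^sup>+w. ennreal k * ennreal (pos_powr (rho w) \<alpha> * cmod (rho2 z w) powr (- M)) \<partial>lborel)"
        using k0 by (intro nn_integral_cong) (simp add: ennreal_mult'[symmetric] mult_ac)
      also have "\<dots> = ennreal k * (\<integral>\<^sup>+w. ennreal (pos_powr (rho w) \<alpha> * cmod (rho2 z w) powr (- M)) \<partial>lborel)" by (rule nn_integral_cmult) measurable
      also have "\<dots> \<le> ennreal (k * B)" using that k0 by (simp add: ennreal_mult' mult_left_mono)
      finally show ?thesis .
    qed
    have "inv_grad (mod_proj \<alpha> f) z \<le> sqrt (8 + 4 * real CARD('n)) * (a * Linf_norm f)"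
    proof (rule inv_grad_le[OF z])
      have "cmod (pd last_idx (mod_proj \<alpha> f) z) \<le> k * (C1 * rho z powr (- 1)) * Linf_norm f"
        unfolding pd
      proof (rule Linf_kernel_bound(2)[OF f dkernel_measurable _ _ _ kint[OF C1(2)[OF z]]])
        fix w :: "(complex, 'n) vec" assume w: "w \<in> tube"
        have "drho2 z w (axis last_idx 1) = - \<i> / 2" by (simp add: drho2_def axis_last_nth cong: sum.cong_simp)
        hence "cmod (dkernel \<alpha> z w (axis last_idx 1)) = k * cmod (rho2 z w) powr (- (N + 1)) * (1 / 2)"
          unfolding dk_norm by (simp add: norm_divide)
        also have "\<dots> \<le> k * cmod (rho2 z w) powr (- (N + 1)) * 1" using k0 by (intro mult_left_mono) auto
        finally show "cmod (dkernel \<alpha> z w (axis last_idx 1)) \<le> k * cmod (rho2 z w) powr (- (real CARD('n) + 1 + \<alpha> + 1))"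
          by (simp add: N_def)
      qed (use k0 C1 in auto)
      hence "rho z * cmod (pd last_idx (mod_proj \<alpha> f) z) \<le> rho z * (k * (C1 * rho z powr (- 1)) * Linf_norm f)"
        using r by (intro mult_left_mono) auto
      also have "\<dots> = k * C1 * Linf_norm f" using r by (simp add: powr_minus powr_one field_simps)
      also have "\<dots> \<le> a * Linf_norm f" using k0 C2 L by (intro mult_right_mono) (auto simp: a_def algebra_simps)
      finally show "rho z * cmod (pd last_idx (mod_proj \<alpha> f) z) \<le> a * Linf_norm f" .
      fix j :: 'n assume j: "j < last_idx"
      define v :: "(complex, 'n) vec" where "v = axis j 1 + (2 * of_real (Im (z $ j))) *s axis last_idx 1"
      have gc: "grad_comp j (mod_proj \<alpha> f) z = (LINT w|vol \<alpha>. dkernel \<alpha> z w v * f w)"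
      proof -
        have "(LINT w|vol \<alpha>. dkernel \<alpha> z w v * f w) = (LINT w|vol \<alpha>. dkernel \<alpha> z w (axis j 1) * f w + dkernel \<alpha> z w ((2 * of_real (Im (z $ j))) *s axis last_idx 1) * f w)"
          unfolding v_def dkernel_add distrib_right ..
        also have "\<dots> = (LINT w|vol \<alpha>. dkernel \<alpha> z w (axis j 1) * f w) + (LINT w|vol \<alpha>. dkernel \<alpha> z w ((2 * of_real (Im (z $ j))) *s axis last_idx 1) * f w)"
          by (rule Bochner_Integration.integral_add[OF D(2) D(2)])
        finally show ?thesis unfolding grad_comp_def pd D(3) by simp
      qed
      have "cmod (grad_comp j (mod_proj \<alpha> f) z) \<le> k * (C2 * rho z powr (- (1 / 2))) * Linf_norm f"
        unfolding gc
      proof (rule Linf_kernel_bound(2)[OF f dkernel_measurable _ _ _ kint[OF C2(2)[OF z]]])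
        fix w :: "(complex, 'n) vec" assume w: "w \<in> tube"
        define X where "X = cmod (rho2 z w)"
        have X: "X > 0" using Re_rho2_pos[OF z w] unfolding X_def by auto
        have jl: "j \<noteq> last_idx" using j by auto
        have "(\<Sum>i\<in>{..<last_idx}. (z $ i - cnj (w $ i)) * v $ i) = (\<Sum>i\<in>{..<last_idx}. if i = j then z $ j - cnj (w $ j) else 0)"
          using jl by (intro sum.cong) (auto simp: v_def axis_def)
        also have "\<dots> = z $ j - cnj (w $ j)" using j by simp
        finally have "drho2 z w v = 1 / 2 * (z $ j - cnj (w $ j)) - \<i> / 2 * (2 * of_real (Im (z $ j)))"
          using jl by (simp add: drho2_def v_def axis_def)
        also have "\<dots> = cnj (z $ j - w $ j) / 2" by (simp add: complex_eq_iff field_simps)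
        finally have e: "drho2 z w v = cnj (z $ j - w $ j) / 2" .
        have "cmod (drho2 z w v) = cmod (z $ j - w $ j) / 2" unfolding e norm_divide complex_mod_cnj by simp
        moreover have "cmod (z $ j - w $ j) \<le> 2 * sqrt X"
        proof (rule power2_le_imp_le)
          have "(rho z + (cmod (z $ j - w $ j))\<^sup>2) / 4 \<le> X" unfolding X_def by (rule rho2_bounds(2)[OF z w j])
          thus "(cmod (z $ j - w $ j))\<^sup>2 \<le> (2 * sqrt X)\<^sup>2" using r X by (simp add: power_mult_distrib field_simps)
        qed (use X in simp)
        ultimately have "cmod (drho2 z w v) \<le> X powr (1 / 2)" using X by (simp add: powr_half_sqrt)
        hence "cmod (dkernel \<alpha> z w v) \<le> k * X powr (- (N + 1)) * X powr (1 / 2)"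
          unfolding dk_norm X_def[symmetric] using k0 by (intro mult_left_mono) auto
        also have "\<dots> = k * X powr (- (real CARD('n) + 1 + \<alpha> + 1 / 2))"
          by (simp add: mult.assoc powr_add[symmetric] N_def algebra_simps)
        finally show "cmod (dkernel \<alpha> z w v) \<le> k * cmod (rho2 z w) powr (- (real CARD('n) + 1 + \<alpha> + 1 / 2))"
          by (simp only: X_def)
      qed (use k0 C2 in auto)
      hence "sqrt (rho z) * cmod (grad_comp j (mod_proj \<alpha> f) z) \<le> sqrt (rho z) * (k * (C2 * rho z powr (- (1 / 2))) * Linf_norm f)"
        using r by (intro mult_left_mono) auto
      also have "\<dots> = k * C2 * Linf_norm f" using r by (simp add: powr_minus powr_half_sqrt field_simps)
      also have "\<dots> \<le> a * Linf_norm f" using k0 C1 L by (intro mult_right_mono) (auto simp: a_def algebra_simps)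
      finally show "sqrt (rho z) * cmod (grad_comp j (mod_proj \<alpha> f) z) \<le> a * Linf_norm f" .
    qed
    thus "inv_grad (mod_proj \<alpha> f) z \<le> sqrt (8 + 4 * real CARD('n)) * a * Linf_norm f" by (simp add: mult.assoc)
  qed
qed

subsection \<open>Growth of Bloch functions\<close>

text \<open>The Bloch condition with the components separated, as it is used when h is integrated
  along paths.\<close>

definition grad_bounded :: "real \<Rightarrow> (complex^'n::{finite,linorder} \<Rightarrow> complex) \<Rightarrow> bool" where
  "grad_bounded A h \<longleftrightarrow> (\<forall>z\<in>tube. rho z * cmod (pd last_idx h z) \<le> A \<and> (\<forall>j<last_idx. sqrt (rho z) * cmod (grad_comp j h z) \<le> A))"

lemma grad_boundedD:
  fixes z :: "complex^'n::{finite,linorder}"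
  assumes "grad_bounded A h" "z \<in> tube"
  shows "cmod (pd last_idx h z) \<le> A / rho z" "j < last_idx \<Longrightarrow> cmod (grad_comp j h z) \<le> A / sqrt (rho z)" "A \<ge> 0"
proof -
  have r: "rho z > 0" using assms by (simp add: tube_iff)
  have a: "rho z * cmod (pd last_idx h z) \<le> A" using assms by (simp add: grad_bounded_def)
  thus "cmod (pd last_idx h z) \<le> A / rho z" using r by (simp add: field_simps)
  show "A \<ge> 0" by (rule order_trans[OF mult_nonneg_nonneg a]) (use r in auto)
  show "cmod (grad_comp j h z) \<le> A / sqrt (rho z)" if "j < last_idx"
    using assms that r by (simp add: grad_bounded_def field_simps)
qed

lemma rho_axis_last: "rho (w + axis last_idx t) = rho w + Im t"
  by (simp add: rho_def axis_last_nth cong: sum.cong_simp)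

lemma holomorphic_severalD:
  assumes "holomorphic_several F T" "z \<in> T"
  obtains D where "(F has_derivative D) (at z)" "\<And>a v. D (a *s v) = a * D v"
  using assms unfolding holomorphic_several_def by blast

lemma holomorphic_several_pd_last:
  fixes h :: "complex^'n::{finite,linorder} \<Rightarrow> complex"
  assumes "holomorphic_several h tube" "w + axis last_idx t \<in> tube"
  shows "((\<lambda>s. h (w + axis last_idx s)) has_field_derivative pd last_idx h (w + axis last_idx t)) (at t)"
proof -
  obtain D where D: "(h has_derivative D) (at (w + axis last_idx t))" "\<And>a v. D (a *s v) = a * D v"
    by (rule holomorphic_severalD[OF assms]) blast
  have "((\<lambda>s. h (w + axis last_idx s)) has_field_derivative D (axis last_idx 1)) (at t)"
  proof (rule holomorphic_several_curve[where c = "\<lambda>s. w + axis last_idx s", OF D])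
    show "((\<lambda>s. (w + axis last_idx s) $ i) has_field_derivative axis last_idx 1 $ i) (at t)" for i
      by (cases "i = last_idx") (auto simp: axis_def intro!: derivative_eq_intros)
  qed
  thus ?thesis by (simp only: pd_eq[OF D])
qed

text \<open>v is expanded in the frame formed by the tangential directions e_j + 2 y_j e_n and by
  e_n; the coefficient of e_n is then v_n - 2 sum of y_j v_j.\<close>

lemma derivative_grad_comp:
  fixes h :: "complex^'n::{finite,linorder} \<Rightarrow> complex"
  assumes D: "(h has_derivative D) (at z)" "\<And>a v. D (a *s v) = a * D v"
  shows "D v = (\<Sum>j\<in>{..<last_idx}. v $ j * grad_comp j h z)
     + (v $ last_idx - 2 * (\<Sum>j\<in>{..<last_idx}. of_real (Im (z $ j)) * v $ j)) * pd last_idx h z"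
proof -
  have lin: "linear D" using D(1) by (rule has_derivative_linear)
  have "D v = D (\<Sum>j\<in>UNIV. (v $ j) *s axis j 1)" by (simp only: basis_expansion)
  also have "\<dots> = (\<Sum>j\<in>UNIV. v $ j * pd j h z)"
    by (simp add: linear_sum[OF lin] D(2) pd_eq[OF D])
  also have "(UNIV :: 'n set) = insert last_idx {..<last_idx}" using UNIV_minus_last by auto
  also have "(\<Sum>j\<in>insert last_idx {..<last_idx}. v $ j * pd j h z) = v $ last_idx * pd last_idx h z + (\<Sum>j\<in>{..<last_idx}. v $ j * pd j h z)"
    by simp
  also have "(\<Sum>j\<in>{..<last_idx}. v $ j * pd j h z) = (\<Sum>j\<in>{..<last_idx}. v $ j * grad_comp j h z - 2 * (of_real (Im (z $ j)) * v $ j) * pd last_idx h z)"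
    by (intro sum.cong refl) (simp add: grad_comp_def algebra_simps)
  also have "\<dots> = (\<Sum>j\<in>{..<last_idx}. v $ j * grad_comp j h z) - 2 * (\<Sum>j\<in>{..<last_idx}. of_real (Im (z $ j)) * v $ j) * pd last_idx h z"
    by (simp only: sum_subtractf sum_distrib_left sum_distrib_right)
  finally show ?thesis by (simp add: algebra_simps)
qed

lemma rho_segment_ge:
  fixes w :: "complex^'n::{finite,linorder}"
  assumes w: "w \<in> tube" and t: "0 \<le> t" "t \<le> 1"
  shows "rho (base_pt + axis last_idx (\<i> * of_real T) + of_real t *s (w - base_pt)) \<ge> T"
proof -
  have "(1 - t) *\<^sub>R base_pt + t *\<^sub>R w \<in> tube"
    using convexD[OF convex_tube base_pt_tube w, of "1 - t" t] t by simp
  hence "rho ((1 - t) *\<^sub>R base_pt + t *\<^sub>R w) > 0" by (simp add: tube_iff)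
  moreover have "base_pt + axis last_idx (\<i> * of_real T) + of_real t *s (w - base_pt) = ((1 - t) *\<^sub>R base_pt + t *\<^sub>R w) + axis last_idx (\<i> * of_real T)"
    unfolding vec_eq_iff vector_add_component vector_scaleR_component vector_smult_component vector_minus_component
    by (simp add: scaleR_conv_of_real algebra_simps)
  ultimately show ?thesis by (simp only: rho_axis_last) simp
qed

text \<open>At height T the whole segment has rho >= T, so the tangential derivatives are at most A
  / sqrt T and the z_n-derivative at most A / T; the displacement is of size sqrt (tube_size w) and
  2 tube_size w in these directions. With T = \<open>tube_size w\<close> the bound is a constant,
  with T tending to infinity it tends to 0; both are used.\<close>

lemma high_segment_bound:
  fixes h :: "complex^'n::{finite,linorder} \<Rightarrow> complex"
  assumes hol: "holomorphic_several h tube" and A: "grad_bounded A h" and w: "w \<in> tube" and T: "T > 0"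
  shows "cmod (h (w + axis last_idx (\<i> * of_real T)) - h (base_pt + axis last_idx (\<i> * of_real T)))
     \<le> A * (real CARD('n) * sqrt (tube_size w) / sqrt T + 2 * tube_size w / T)"
proof -
  define p :: "(complex, 'n) vec" where "p = base_pt + axis last_idx (\<i> * of_real T)"
  define v where "v = w - base_pt"
  define \<tau> where "\<tau> = tube_size w"
  have A0: "A \<ge> 0" by (rule grad_boundedD(3)[OF A w])
  define c where "c t = p + t *s v" for t
  \<comment> \<open>The mean value inequality wants the derivative as a function; at each point one
    is chosen that also satisfies the bound.\<close>
  define f' where "f' t = (SOME d. ((\<lambda>t. h (c t)) has_field_derivative d) (at t) \<and> cmod d \<le> A * (real CARD('n) * sqrt \<tau> / sqrt T + 2 * \<tau> / T))" for t
  have f': "((\<lambda>t. h (c t)) has_field_derivative f' t) (at t) \<and> cmod (f' t) \<le> A * (real CARD('n) * sqrt \<tau> / sqrt T + 2 * \<tau> / T)"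
    if "t \<in> closed_segment 0 1" for t :: complex
  proof -
    have "\<exists>s. 0 \<le> s \<and> s \<le> 1 \<and> t = of_real s" using that by (auto simp: in_segment scaleR_conv_of_real)
    then obtain s where s: "0 \<le> s" "s \<le> 1" "t = of_real s" by blast
    have rc: "rho (c t) \<ge> T" unfolding c_def p_def v_def s(3) by (rule rho_segment_ge[OF w s(1,2)])
    hence ct: "c t \<in> tube" using T by (simp add: tube_iff)
    obtain D where D: "(h has_derivative D) (at (c t))" "\<And>a v. D (a *s v) = a * D v"
      by (rule holomorphic_severalD[OF hol ct]) blast
    have "((\<lambda>t. c t $ i) has_field_derivative v $ i) (at t)" for i
      unfolding c_def by (auto intro!: derivative_eq_intros)
    from holomorphic_several_curve[OF D this] have der: "((\<lambda>t. h (c t)) has_field_derivative D v) (at t)" .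
    have vj: "v $ j = w $ j" "Im (c t $ j) = s * Im (w $ j)" if "j < last_idx" for j
      using that by (auto simp: v_def c_def p_def base_pt_nth axis_last_nth s)
    have "cmod (D v) \<le> cmod (\<Sum>j\<in>{..<last_idx}. v $ j * grad_comp j h (c t)) + cmod ((v $ last_idx - 2 * (\<Sum>j\<in>{..<last_idx}. of_real (Im (c t $ j)) * v $ j)) * pd last_idx h (c t))"
      unfolding derivative_grad_comp[OF D] by (rule norm_triangle_ineq)
    also have "\<dots> \<le> A * (real CARD('n) * sqrt \<tau> / sqrt T) + A * (2 * \<tau> / T)"
    proof (rule add_mono)
      have "cmod (\<Sum>j\<in>{..<last_idx}. v $ j * grad_comp j h (c t)) \<le> (\<Sum>j\<in>{..<last_idx::'n}. sqrt \<tau> * (A / sqrt T))"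
      proof (intro order_trans[OF norm_sum] sum_mono)
        fix j :: 'n assume "j \<in> {..<last_idx}"
        hence j: "j < last_idx" by simp
        have "cmod (grad_comp j h (c t)) \<le> A / sqrt (rho (c t))" by (rule grad_boundedD(2)[OF A ct j])
        also have "\<dots> \<le> A / sqrt T" using rc T A0 by (intro divide_left_mono) auto
        finally show "cmod (v $ j * grad_comp j h (c t)) \<le> sqrt \<tau> * (A / sqrt T)"
          unfolding norm_mult vj(1)[OF j] \<tau>_def using norm_nth_le_tube_size[OF j] tube_size_ge_1[of w]
          by (intro mult_mono) auto
      qed
      also have "\<dots> \<le> real CARD('n) * (sqrt \<tau> * (A / sqrt T))"
      proof -
        have "real (card {..<last_idx::'n}) \<le> real CARD('n)" by (simp add: card_mono)
        moreover have "0 \<le> sqrt \<tau> * (A / sqrt T)" using A0 T tube_size_ge_1[of w] by (simp add: \<tau>_def)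
        ultimately show ?thesis unfolding sum_constant by (rule mult_right_mono)
      qed
      finally show "cmod (\<Sum>j\<in>{..<last_idx}. v $ j * grad_comp j h (c t)) \<le> A * (real CARD('n) * sqrt \<tau> / sqrt T)" by (simp add: mult_ac)
      have "cmod (\<Sum>j\<in>{..<last_idx}. of_real (Im (c t $ j)) * v $ j) \<le> (\<Sum>j\<in>{..<last_idx}. (cmod (w $ j))\<^sup>2)"
      proof (intro order_trans[OF norm_sum] sum_mono)
        fix j :: 'n assume "j \<in> {..<last_idx}"
        hence j: "j < last_idx" by simp
        have "\<bar>s * Im (w $ j)\<bar> \<le> 1 * cmod (w $ j)" unfolding abs_mult using s abs_Im_le_cmod[of "w $ j"] by (intro mult_mono) auto
        thus "cmod (of_real (Im (c t $ j)) * v $ j) \<le> (cmod (w $ j))\<^sup>2"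
          unfolding norm_mult vj[OF j] norm_of_real power2_eq_square by (intro mult_right_mono) auto
      qed
      moreover have "cmod (v $ last_idx) \<le> cmod (w $ last_idx) + 1"
        using norm_triangle_ineq4[of "w $ last_idx" \<i>] by (simp add: v_def base_pt_nth)
      moreover have "cmod (v $ last_idx - 2 * (\<Sum>j\<in>{..<last_idx}. of_real (Im (c t $ j)) * v $ j)) \<le> cmod (v $ last_idx) + 2 * cmod (\<Sum>j\<in>{..<last_idx}. of_real (Im (c t $ j)) * v $ j)"
        by (rule order_trans[OF norm_triangle_ineq4]) (simp add: norm_mult)
      ultimately have "cmod (v $ last_idx - 2 * (\<Sum>j\<in>{..<last_idx}. of_real (Im (c t $ j)) * v $ j)) \<le> 2 * \<tau>"
      proof -
        have arith: "c \<le> 2 * (1 + Q + cw)" if "c \<le> cv + 2 * S" "cv \<le> cw + 1" "S \<le> Q" "0 \<le> cw" for c cv S Q cw :: real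
          using that by argo
        assume "cmod (\<Sum>j\<in>{..<last_idx}. of_real (Im (c t $ j)) * v $ j) \<le> (\<Sum>j\<in>{..<last_idx}. (cmod (w $ j))\<^sup>2)"
          "cmod (v $ last_idx) \<le> cmod (w $ last_idx) + 1"
          "cmod (v $ last_idx - 2 * (\<Sum>j\<in>{..<last_idx}. of_real (Im (c t $ j)) * v $ j)) \<le> cmod (v $ last_idx) + 2 * cmod (\<Sum>j\<in>{..<last_idx}. of_real (Im (c t $ j)) * v $ j)"
        from arith[OF this(3) this(2) this(1) norm_ge_zero] show ?thesis unfolding \<tau>_def tube_size_def .
      qed
      moreover have "cmod (pd last_idx h (c t)) \<le> A / T"
      proof -
        have "cmod (pd last_idx h (c t)) \<le> A / rho (c t)" by (rule grad_boundedD(1)[OF A ct])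
        also have "\<dots> \<le> A / T" using rc T A0 by (intro divide_left_mono) auto
        finally show ?thesis .
      qed
      ultimately have "cmod ((v $ last_idx - 2 * (\<Sum>j\<in>{..<last_idx}. of_real (Im (c t $ j)) * v $ j)) * pd last_idx h (c t)) \<le> (2 * \<tau>) * (A / T)"
        unfolding norm_mult[of _ "pd last_idx h (c t)"] using tube_size_ge_1[of w] by (intro mult_mono) (auto simp: \<tau>_def)
      thus "cmod ((v $ last_idx - 2 * (\<Sum>j\<in>{..<last_idx}. of_real (Im (c t $ j)) * v $ j)) * pd last_idx h (c t)) \<le> A * (2 * \<tau> / T)"
        by (simp add: mult_ac)
    qed
    finally have "cmod (D v) \<le> A * (real CARD('n) * sqrt \<tau> / sqrt T + 2 * \<tau> / T)" by (simp only: distrib_left)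
    with der have "\<exists>d. ((\<lambda>t. h (c t)) has_field_derivative d) (at t) \<and> cmod d \<le> A * (real CARD('n) * sqrt \<tau> / sqrt T + 2 * \<tau> / T)" by blast
    thus ?thesis unfolding f'_def by (rule someI_ex)
  qed
  have "cmod (h (c 1) - h (c 0)) \<le> A * (real CARD('n) * sqrt \<tau> / sqrt T + 2 * \<tau> / T) * cmod (1 - 0)"
  proof (rule field_differentiable_bound[where S = "closed_segment 0 1" and f' = f'])
    fix t :: complex assume t: "t \<in> closed_segment 0 1"
    show "((\<lambda>t. h (c t)) has_field_derivative f' t) (at t within closed_segment 0 1)"
      using f'[OF t] by (blast intro: has_field_derivative_at_within)
    show "cmod (f' t) \<le> A * (real CARD('n) * sqrt \<tau> / sqrt T + 2 * \<tau> / T)" using f'[OF t] by blast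
  qed auto
  moreover have "c 1 = w + axis last_idx (\<i> * of_real T)" "c 0 = p"
    by (auto simp: c_def p_def v_def vec_eq_iff)
  ultimately show ?thesis by (simp add: p_def \<tau>_def)
qed

text \<open>Along the vertical path the derivative is at most A / (rho w + t), whose integral is a
  logarithm. It is replaced by a power with small exponent e, which combines directly with the
  weights.\<close>

lemma vertical_bound:
  fixes h :: "complex^'n::{finite,linorder} \<Rightarrow> complex"
  assumes hol: "holomorphic_several h tube" and A: "grad_bounded A h" and w: "w \<in> tube" and T: "T > 0" and e: "e > 0"
  shows "cmod (h (w + axis last_idx (\<i> * of_real T)) - h w) \<le> A / e * rho w powr (- e) * (rho w + T) powr e"
proof -
  have r: "rho w > 0" using w by (simp add: tube_iff)
  have A0: "A \<ge> 0" by (rule grad_boundedD(3)[OF A w])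
  define c where "c t = w + axis last_idx (\<i> * of_real t)" for t
  have ct: "c t \<in> tube" "rho (c t) = rho w + t" if "t \<ge> 0" for t
    using that r by (auto simp: tube_iff c_def rho_axis_last)
  \<comment> \<open>Its derivative dominates A / (rho w + t), because (rho w + t)^(-e) <= rho
    w^(-e).\<close>
  define \<phi> where "\<phi> t = A / e * rho w powr (- e) * (rho w + t) powr e" for t
  have hd: "((\<lambda>t. h (c t)) has_vector_derivative (\<i> * pd last_idx h (c t))) (at t)" if t: "t \<ge> 0" for t
  proof -
    have "((\<lambda>s. h (w + axis last_idx s)) has_field_derivative pd last_idx h (c t)) (at (\<i> * of_real t))"
      using holomorphic_several_pd_last[OF hol ct(1)[OF t, unfolded c_def]] by (simp add: c_def)
    moreover have "((\<lambda>t. \<i> * of_real t) has_vector_derivative \<i>) (at t)"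
      by (auto intro!: derivative_eq_intros simp: has_vector_derivative_def scaleR_conv_of_real mult.commute)
    ultimately have "((\<lambda>s. h (w + axis last_idx s)) \<circ> (\<lambda>t. \<i> * of_real t) has_vector_derivative \<i> * pd last_idx h (c t)) (at t)"
      by (rule field_vector_diff_chain_at[rotated])
    thus ?thesis by (simp add: o_def c_def)
  qed
  have pd': "(\<phi> has_vector_derivative A * rho w powr (- e) * (rho w + t) powr (e - 1)) (at t)" if t: "t \<ge> 0" for t
  proof -
    have "((\<lambda>t. (rho w + t) powr e) has_real_derivative e * (rho w + t) powr (e - 1)) (at t)"
      using r t by (auto intro!: derivative_eq_intros)
    from DERIV_cmult[OF this, of "A / e * rho w powr (- e)"] e
    have "(\<phi> has_real_derivative A * rho w powr (- e) * (rho w + t) powr (e - 1)) (at t)"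
      by (simp add: \<phi>_def[abs_def] mult_ac)
    thus ?thesis by (simp add: has_real_derivative_iff_has_vector_derivative)
  qed
  have "cmod (h (c T) - h (c 0)) \<le> \<phi> T - \<phi> 0"
  proof (rule differentiable_bound_general[OF T])
    show "continuous_on {0..T} (\<lambda>t. h (c t))"
      using hd by (intro continuous_at_imp_continuous_on ballI has_vector_derivative_continuous) auto
    show "continuous_on {0..T} \<phi>"
      using pd' by (intro continuous_at_imp_continuous_on ballI has_vector_derivative_continuous) auto
    fix t assume t: "0 < t" "t < T"
    show "((\<lambda>t. h (c t)) has_vector_derivative \<i> * pd last_idx h (c t)) (at t)" using hd t by simp
    show "(\<phi> has_vector_derivative A * rho w powr (- e) * (rho w + t) powr (e - 1)) (at t)" using pd' t by simp
    have "cmod (\<i> * pd last_idx h (c t)) \<le> A / (rho w + t)"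
      using grad_boundedD(1)[OF A ct(1)] ct(2) t by (simp add: norm_mult)
    also have "\<dots> = A * (rho w + t) powr (- e) * (rho w + t) powr (e - 1)"
    proof -
      have "(rho w + t) powr (- e) * (rho w + t) powr (e - 1) = 1 / (rho w + t)"
        unfolding powr_add[symmetric] using r t by (simp add: powr_minus_divide)
      thus ?thesis by (simp add: mult.assoc)
    qed
    also have "\<dots> \<le> A * rho w powr (- e) * (rho w + t) powr (e - 1)"
      using r t e A0 by (intro mult_right_mono mult_left_mono powr_mono2') auto
    finally show "cmod (\<i> * pd last_idx h (c t)) \<le> A * rho w powr (- e) * (rho w + t) powr (e - 1)" .
  qed
  also have "\<dots> \<le> \<phi> T" using A0 e by (simp add: \<phi>_def)
  finally show ?thesis by (simp add: c_def \<phi>_def vec_eq_iff axis_def zero_vec_def[symmetric] cong: if_cong)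
qed

text \<open>The path goes from w up by \<open>tube_size w\<close>, across at that height, and down
  to the base point. The horizontal piece costs a constant, the vertical ones a small power
  each.\<close>

lemma bloch_growth:
  fixes h :: "complex^'n::{finite,linorder} \<Rightarrow> complex"
  assumes hol: "holomorphic_several h tube" and A: "grad_bounded A h" and h0: "h base_pt = 0" and e: "e > 0"
  obtains C where "C \<ge> 0" "\<And>w. w \<in> tube \<Longrightarrow> cmod (h w) \<le> C * tube_size w powr (2 * e) * rho w powr (- e)"
proof -
  have A0: "A \<ge> 0" by (rule grad_boundedD(3)[OF A base_pt_tube])
  define C where "C = A * (real CARD('n) + 2) + A / e * 2 powr e + A / e * 2 powr e"
  show ?thesis
  proof (rule that[of C])
    show "C \<ge> 0" using A0 e by (simp add: C_def)
    fix w :: "(complex, 'n) vec" assume w: "w \<in> tube"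
    define T where "T = tube_size w"
    have T: "T \<ge> 1" by (simp add: T_def tube_size_ge_1)
    have r: "rho w > 0" "rho w \<le> T" using w rho_le_tube_size[of w] by (auto simp: tube_iff T_def)
    \<comment> \<open>Since rho w <= T and T >= 1, K dominates each of the three contributions 1,
      T^e and T^e * rho w^(-e).\<close>
    define K where "K = T powr (2 * e) * rho w powr (- e)"
    have Te: "T powr e * rho w powr (- e) \<ge> 1"
    proof -
      have "1 = T powr e * T powr (- e)" using T by (simp add: powr_add[symmetric])
      also have "\<dots> \<le> T powr e * rho w powr (- e)" using r e by (intro mult_left_mono powr_mono2') auto
      finally show ?thesis .
    qed
    have K2: "K = T powr e * (T powr e * rho w powr (- e))" by (simp add: K_def powr_add[symmetric] mult.assoc[symmetric])
    have T1: "T powr e \<ge> 1" using T e by (simp add: ge_one_powr_ge_zero)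
    have K: "K \<ge> 1" "K \<ge> T powr e" "K \<ge> T powr e * rho w powr (- e)"
    proof -
      show "K \<ge> T powr e" unfolding K2 using mult_left_mono[OF Te, of "T powr e"] by simp
      thus "K \<ge> 1" using T1 by linarith
      show "K \<ge> T powr e * rho w powr (- e)" unfolding K2 using mult_right_mono[OF T1, of "T powr e * rho w powr (- e)"] by simp
    qed
    have "cmod (h (w + axis last_idx (\<i> * of_real T)) - h (base_pt + axis last_idx (\<i> * of_real T))) \<le> A * (real CARD('n) * sqrt T / sqrt T + 2 * T / T)"
      unfolding T_def by (rule high_segment_bound[OF hol A w]) (use T in \<open>simp add: T_def\<close>)
    also have "\<dots> = A * (real CARD('n) + 2)" using T by simp
    also have "\<dots> \<le> A * (real CARD('n) + 2) * K" using mult_left_mono[OF K(1), of "A * (real CARD('n) + 2)"] A0 by simp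
    finally have 1: "cmod (h (w + axis last_idx (\<i> * of_real T)) - h (base_pt + axis last_idx (\<i> * of_real T))) \<le> A * (real CARD('n) + 2) * K" .
    have "cmod (h (w + axis last_idx (\<i> * of_real T)) - h w) \<le> A / e * rho w powr (- e) * (rho w + T) powr e"
      by (rule vertical_bound[OF hol A w _ e]) (use T in simp)
    also have "\<dots> \<le> A / e * rho w powr (- e) * (2 * T) powr e"
      using r T e A0 by (intro mult_left_mono powr_mono2) auto
    also have "\<dots> = A / e * 2 powr e * (T powr e * rho w powr (- e))" using T by (simp add: powr_mult mult_ac)
    also have "\<dots> \<le> A / e * 2 powr e * K" using K(3) A0 e by (intro mult_left_mono) auto
    finally have 2: "cmod (h (w + axis last_idx (\<i> * of_real T)) - h w) \<le> A / e * 2 powr e * K" .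
    have "cmod (h (base_pt + axis last_idx (\<i> * of_real T)) - h base_pt) \<le> A / e * rho (base_pt :: (complex, 'n) vec) powr (- e) * (rho (base_pt :: (complex, 'n) vec) + T) powr e"
      by (rule vertical_bound[OF hol A base_pt_tube _ e]) (use T in simp)
    also have "\<dots> \<le> A / e * (2 * T) powr e"
      unfolding rho_base_pt using T e A0 by (simp add: mult_left_mono powr_mono2 divide_right_mono)
    also have "\<dots> = A / e * 2 powr e * T powr e" using T by (simp add: powr_mult mult_ac)
    also have "\<dots> \<le> A / e * 2 powr e * K" using K(2) A0 e by (intro mult_left_mono) auto
    finally have 3: "cmod (h (base_pt + axis last_idx (\<i> * of_real T))) \<le> A / e * 2 powr e * K" by (simp add: h0)
    have "cmod (h w) \<le> cmod (h (w + axis last_idx (\<i> * of_real T)) - h w) + cmod (h (w + axis last_idx (\<i> * of_real T)) - h (base_pt + axis last_idx (\<i> * of_real T)))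
       + cmod (h (base_pt + axis last_idx (\<i> * of_real T)))"
      by norm
    also have "\<dots> \<le> C * K"
    proof -
      have "C * K = A * (real CARD('n) + 2) * K + A / e * 2 powr e * K + A / e * 2 powr e * K" by (simp only: C_def distrib_right)
      thus ?thesis using 1 2 3 by linarith
    qed
    finally show "cmod (h w) \<le> C * tube_size w powr (2 * e) * rho w powr (- e)" by (simp add: K_def T_def mult.assoc)
  qed
qed

lemma grad_bounded_const:
  fixes h :: "complex^'n::{finite,linorder} \<Rightarrow> complex"
  assumes hol: "holomorphic_several h tube" and A: "grad_bounded A h"
    and pd0: "\<And>z. z \<in> tube \<Longrightarrow> pd last_idx h z = 0" and w: "w \<in> tube"
  shows "h w = h base_pt"
proof -
  have vert: "h (z + axis last_idx (\<i> * of_real T)) = h z" if z: "z \<in> tube" and T: "T \<ge> 0" for z and T :: real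
  proof -
    have r: "rho z > 0" using z by (simp add: tube_iff)
    have "\<exists>c. \<forall>t\<in>{t. Im t \<ge> 0}. h (z + axis last_idx t) = c"
    proof (rule has_field_derivative_zero_constant)
      show "convex {t. Im t \<ge> 0}" by (rule convex_halfspace_Im_ge)
      fix t assume "t \<in> {t. Im t \<ge> 0}"
      hence t: "z + axis last_idx t \<in> tube" using r by (simp add: tube_iff rho_axis_last)
      show "((\<lambda>t. h (z + axis last_idx t)) has_field_derivative 0) (at t within {t. Im t \<ge> 0})"
        using holomorphic_several_pd_last[OF hol t] pd0[OF t] by (auto intro: has_field_derivative_at_within)
    qed
    then obtain c where c: "\<And>t. Im t \<ge> 0 \<Longrightarrow> h (z + axis last_idx t) = c" by blast
    have e: "z + axis last_idx 0 = z" by (simp add: vec_eq_iff axis_def)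
    have "h z = c" using c[of 0] unfolding e by simp
    thus ?thesis using c[of "\<i> * of_real T"] T by simp
  qed
  have "cmod (h w - h base_pt) \<le> A * (real CARD('n) * sqrt (tube_size w) / sqrt (real k + 1) + 2 * tube_size w / (real k + 1))" for k
    using high_segment_bound[OF hol A w, of "real k + 1"] vert[OF w, of "real k + 1"] vert[OF base_pt_tube, of "real k + 1"] by simp
  moreover have "(\<lambda>k. A * (real CARD('n) * sqrt (tube_size w) / sqrt (real k + 1) + 2 * tube_size w / (real k + 1))) \<longlonglongrightarrow> A * (0 + 0)"
  proof (intro tendsto_mult_left tendsto_add tendsto_divide_0[OF tendsto_const] filterlim_at_top_imp_at_infinity)
    have l: "filterlim (\<lambda>k. real k + 1) at_top sequentially"
      by (rule filterlim_tendsto_add_at_top[OF tendsto_const filterlim_real_sequentially, of 1, unfolded add.commute[of 1]])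
    show "filterlim (\<lambda>k. real k + 1) at_top sequentially" by (rule l)
    show "filterlim (\<lambda>k. sqrt (real k + 1)) at_top sequentially" by (rule filterlim_compose[OF sqrt_at_top l])
  qed
  ultimately have "cmod (h w - h base_pt) \<le> A * (0 + 0)"
    by (intro LIMSEQ_le_const[rotated]) auto
  thus ?thesis by simp
qed

subsection \<open>Projection onto the Bloch space\<close>

lemma bergman_reproducing_vol:
  fixes F :: "complex^'n::{finite,linorder} \<Rightarrow> complex"
  assumes b: "b > -1" and a: "0 < a" "a < b + 1" and hol: "holomorphic_several F tube"
    and bd: "\<And>w. w \<in> tube \<Longrightarrow> cmod (F w) \<le> C * rho w powr (- a)" and z: "z \<in> tube"
  shows "integrable (vol b) (\<lambda>w. bergman_kernel b z w * F w)" "(LINT w|vol b. bergman_kernel b z w * F w) = F z"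
proof -
  note rep = bergman_reproducing[OF b a hol bd z]
  have cF: "continuous_on tube F" by (rule holomorphic_several_imp_continuous_on[OF hol])
  have m: "(\<lambda>w. bergman_kernel b z w * F w) \<in> borel_measurable (lebesgue_on tube)"
    by (intro borel_measurable_times borel_imp_lebesgue_on bergman_kernel_measurable continuous_imp_measurable_on_sets_lebesgue[OF cF] tube_sets)
  \<comment> \<open>F is arbitrary outside the tube, so the Borel majorant is formed with the
    indicator of the tube.\<close>
  have g: "(\<lambda>w. (indicator tube w * bergman_kernel b z w) * F w) \<in> borel_measurable borel"
  proof (rule borel_measurable_mult_vanishing[OF _ open_tube cF])
    show "(\<lambda>w. indicator tube w * bergman_kernel b z w) \<in> borel_measurable borel"
      using tube_sets(1) by measurable
  qed simp
  have "(\<integral>\<^sup>+w. ennreal (pos_powr (rho w) b * cmod ((indicator tube w * bergman_kernel b z w) * F w)) \<partial>lborel)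
     = (\<integral>\<^sup>+w. ennreal (norm (of_real (pos_powr (rho w) b) * (bergman_kernel b z w * F w))) \<partial>lborel)"
    by (intro nn_integral_cong) (auto simp: norm_mult pos_powr_def tube_iff split: split_indicator)
  also have "\<dots> < \<infinity>" using rep(1) by (simp add: integrable_iff_bounded)
  finally have fin: "(\<integral>\<^sup>+w. ennreal (pos_powr (rho w) b * cmod ((indicator tube w * bergman_kernel b z w) * F w)) \<partial>lborel) < \<infinity>" .
  have gm: "(\<lambda>w. cmod ((indicator tube w * bergman_kernel b z w) * F w)) \<in> borel_measurable borel"
    by (rule measurable_compose[OF g]) measurable
  show "integrable (vol b) (\<lambda>w. bergman_kernel b z w * F w)"
    by (rule vol_dominated_finite[OF m gm _ fin], rule AE_I2) simp
  have "(LINT w|vol b. bergman_kernel b z w * F w) = (LINT w|lborel. of_real (pos_powr (rho w) b) * (bergman_kernel b z w * F w))"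
    by (rule integral_vol_lborel[OF m]) (use rep(1) in auto)
  thus "(LINT w|vol b. bergman_kernel b z w * F w) = F z" using rep(2) by simp
qed

lemma bloch_grad_bounded:
  assumes "h \<in> bloch"
  obtains A where "grad_bounded A h"
proof -
  obtain A where A: "\<And>z. z \<in> tube \<Longrightarrow> inv_grad h z \<le> A"
    using assms unfolding bloch_def bdd_above_def by auto
  have "grad_bounded A h"
    unfolding grad_bounded_def using inv_grad_ge[OF _ A] by blast
  thus ?thesis by (rule that)
qed

lemma bloch_holomorphic: "h \<in> bloch \<Longrightarrow> holomorphic_several h tube"
  by (simp add: bloch_def)

lemma rho2_commute: "rho2 w z = cnj (rho2 z w)"
  unfolding rho2_def by (simp add: power2_commute) (simp add: algebra_simps)

lemma bloch0_kernel_integrable: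
  fixes g :: "complex^'n::{finite,linorder} \<Rightarrow> complex"
  assumes \<alpha>: "\<alpha> > -1" and g: "g \<in> bloch0" and z: "z \<in> tube"
  shows "integrable (vol \<alpha>) (\<lambda>w. mod_kernel \<alpha> z w * g w)"
proof -
  have gb: "g \<in> bloch" "g base_pt = 0" using g by (auto simp: bloch0_def)
  obtain A where A: "grad_bounded A g" by (rule bloch_grad_bounded[OF gb(1)])
  \<comment> \<open>The bound (\<alpha> + 1) / 2 keeps \<alpha> - e > -1. The growth raises the
    decay exponent needed by 2 e, while the weight \<alpha> - e lowers it by e; the gain 1/2 of the
    modified kernel must exceed e, and 1/8 is safely below.\<close>
  define e where "e = min (1/8) ((\<alpha> + 1) / 2)"
  have e: "e > 0" "e \<le> 1/8" "\<alpha> - e > -1" using \<alpha> by (auto simp: e_def min_def field_simps)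
  obtain C where C: "C \<ge> 0" "\<And>w. w \<in> tube \<Longrightarrow> cmod (g w) \<le> C * tube_size w powr (2 * e) * rho w powr (- e)"
    by (rule bloch_growth[OF bloch_holomorphic[OF gb(1)] A gb(2) e(1)]) blast
  obtain B where B: "B \<ge> 0" "\<And>w. w \<in> tube \<Longrightarrow> cmod (mod_kernel \<alpha> z w) \<le> B * tube_size w powr (- (real CARD('n) + 3 / 2 + \<alpha>))"
    by (rule mod_kernel_bound[OF z \<alpha>]) blast
  define M where "M = real CARD('n) + 3 / 2 + \<alpha> - 2 * e"
  have m: "(\<lambda>w. mod_kernel \<alpha> z w * g w) \<in> borel_measurable (lebesgue_on tube)"
    by (intro borel_measurable_times borel_imp_lebesgue_on mod_kernel_measurable tube_sets
        continuous_imp_measurable_on_sets_lebesgue[OF holomorphic_several_imp_continuous_on[OF bloch_holomorphic[OF gb(1)]]])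
  have gm: "(\<lambda>w :: (complex, 'n) vec. B * C * (rho w powr (- e) * tube_size w powr (- M))) \<in> borel_measurable borel"
    by measurable
  show ?thesis
  proof (rule vol_dominated_finite[OF m gm])
    show "AE w in lebesgue_on tube. cmod (mod_kernel \<alpha> z w * g w) \<le> B * C * (rho w powr (- e) * tube_size w powr (- M))"
    proof (rule AE_I2)
      fix w :: "(complex, 'n) vec" assume "w \<in> space (lebesgue_on tube)"
      hence w: "w \<in> tube" by simp
      have "cmod (mod_kernel \<alpha> z w * g w) \<le> (B * tube_size w powr (- (real CARD('n) + 3 / 2 + \<alpha>))) * (C * tube_size w powr (2 * e) * rho w powr (- e))"
        unfolding norm_mult using B(1) by (intro mult_mono B(2) C(2) w) auto
      also have "\<dots> = B * C * (rho w powr (- e) * (tube_size w powr (- (real CARD('n) + 3 / 2 + \<alpha>)) * tube_size w powr (2 * e)))"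
        by (simp only: mult_ac)
      also have "tube_size w powr (- (real CARD('n) + 3 / 2 + \<alpha>)) * tube_size w powr (2 * e) = tube_size w powr (- M)"
        unfolding powr_add[symmetric] by (simp add: M_def algebra_simps)
      finally show "cmod (mod_kernel \<alpha> z w * g w) \<le> B * C * (rho w powr (- e) * tube_size w powr (- M))" .
    qed
    have "(\<integral>\<^sup>+w. ennreal (pos_powr (rho w) \<alpha> * (B * C * (rho w powr (- e) * tube_size w powr (- M)))) \<partial>(lborel :: (complex, 'n) vec measure))
      = (\<integral>\<^sup>+w. ennreal (B * C) * ennreal (pos_powr (rho w) (\<alpha> - e) * tube_size w powr (- M)) \<partial>(lborel :: (complex, 'n) vec measure))"
    proof (rule nn_integral_cong)
      fix w :: "(complex, 'n) vec"
      have "pos_powr (rho w) (\<alpha> - e) = pos_powr (rho w) \<alpha> * rho w powr (- e)" by (simp add: pos_powr_def powr_add[symmetric])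
      thus "ennreal (pos_powr (rho w) \<alpha> * (B * C * (rho w powr (- e) * tube_size w powr (- M)))) = ennreal (B * C) * ennreal (pos_powr (rho w) (\<alpha> - e) * tube_size w powr (- M))"
        using B C by (simp add: ennreal_mult'[symmetric] mult_ac)
    qed
    also have "\<dots> = ennreal (B * C) * (\<integral>\<^sup>+w. ennreal (pos_powr (rho w) (\<alpha> - e) * tube_size w powr (- M)) \<partial>(lborel :: (complex, 'n) vec measure))"
      by (rule nn_integral_cmult) measurable
    also have "\<dots> < \<infinity>"
    proof -
      have "(\<integral>\<^sup>+w. ennreal (pos_powr (rho w) (\<alpha> - e) * tube_size w powr (- M)) \<partial>(lborel :: (complex, 'n) vec measure)) < \<infinity>"
        by (rule tube_size_integral[OF e(3)]) (use e in \<open>simp add: M_def\<close>)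
      thus ?thesis by (simp add: ennreal_mult_less_top)
    qed
    finally show "(\<integral>\<^sup>+w. ennreal (pos_powr (rho w) \<alpha> * (B * C * (rho w powr (- e) * tube_size w powr (- M)))) \<partial>(lborel :: (complex, 'n) vec measure)) < \<infinity>" .
  qed
qed

lemma holomorphic_several_divide:
  assumes "holomorphic_several F T" "holomorphic_several G T" "\<And>z. z \<in> T \<Longrightarrow> G z \<noteq> 0"
  shows "holomorphic_several (\<lambda>z. F z / G z) T"
  unfolding holomorphic_several_def
proof
  fix z assume z: "z \<in> T"
  obtain D where D: "(F has_derivative D) (at z)" "\<And>a v. D (a *s v) = a * D v"
    by (rule holomorphic_severalD[OF assms(1) z]) blast
  obtain E where E: "(G has_derivative E) (at z)" "\<And>a v. E (a *s v) = a * E v"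
    by (rule holomorphic_severalD[OF assms(2) z]) blast
  have "((\<lambda>z. F z / G z) has_derivative (\<lambda>h. (D h * G z - F z * E h) / (G z * G z))) (at z)"
    by (rule has_derivative_divide'[OF D(1) E(1) assms(3)[OF z]])
  thus "\<exists>D. ((\<lambda>z. F z / G z) has_derivative D) (at z) \<and> (\<forall>c v. D (c *s v) = c * D v)"
    by (intro exI[of _ "\<lambda>h. (D h * G z - F z * E h) / (G z * G z)"] conjI) (simp_all add: D(2) E(2) algebra_simps diff_divide_distrib)
qed

text \<open>The functions \<open>g / (1 + \<delta> \<rho>(\<cdot>, \<i>))\<close> are reproduced by \<open>K\<^sub>\<alpha>\<close>, and \<open>\<delta>\<close> tends to 0.\<close>

lemma mod_proj_bloch0:
  fixes g :: "complex^'n::{finite,linorder} \<Rightarrow> complex"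
  assumes \<alpha>: "\<alpha> > -1" and g: "g \<in> bloch0" and z: "z \<in> tube"
  shows "mod_proj \<alpha> g z = g z"
proof -
  have gb: "g \<in> bloch" "g base_pt = 0" using g by (auto simp: bloch0_def)
  note hol = bloch_holomorphic[OF gb(1)]
  obtain A where A: "grad_bounded A g" by (rule bloch_grad_bounded[OF gb(1)])
  define e where "e = min (1/8) ((\<alpha> + 1) / 2)"
  have e: "e > 0" "e \<le> 1/8" "e < \<alpha> + 1" using \<alpha> by (auto simp: e_def min_def field_simps)
  obtain C where C: "C \<ge> 0" "\<And>w. w \<in> tube \<Longrightarrow> cmod (g w) \<le> C * tube_size w powr (2 * e) * rho w powr (- e)"
    by (rule bloch_growth[OF hol A gb(2) e(1)]) blast
  define \<sigma> where "\<sigma> w = rho2 w base_pt" for w :: "(complex, 'n) vec"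
  define d where "d k = 1 / (real k + 1)" for k
  have d: "d k > 0" for k by (simp add: d_def)
  \<comment> \<open>The constant of \<open>tube_size_le_rho2\<close> at the base point, with R its
    norm and r = rho = 1.\<close>
  define k0 where "k0 = 2 * (1 + norm (base_pt :: (complex, 'n) vec) + 7 * (norm (base_pt :: (complex, 'n) vec))\<^sup>2) / 1 + 30"
  have k0: "k0 > 0" unfolding k0_def by (intro add_nonneg_pos) auto
  have \<sigma>: "Re (\<sigma> w) > 0" "tube_size w \<le> k0 * cmod (\<sigma> w)" if w: "w \<in> tube" for w
  proof -
    show "Re (\<sigma> w) > 0" unfolding \<sigma>_def by (rule Re_rho2_pos[OF w base_pt_tube])
    have "cmod (\<sigma> w) = cmod (rho2 base_pt w)" unfolding \<sigma>_def by (subst rho2_commute) simp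
    thus "tube_size w \<le> k0 * cmod (\<sigma> w)"
      unfolding k0_def using tube_size_le_rho2[OF base_pt_tube order_refl _ _ w, of 1] by (simp add: rho_base_pt)
  qed
  define G where "G k w = g w / (1 + of_real (d k) * \<sigma> w)" for k w
  \<comment> \<open>Both bounds come from Re (\<sigma> w) > 0: the first makes |g| a majorant for
    all k, the second makes the denominator grow like \<open>tube_size\<close>.\<close>
  have den: "cmod (1 + of_real (d k) * \<sigma> w) \<ge> 1" "cmod (1 + of_real (d k) * \<sigma> w) \<ge> d k * cmod (\<sigma> w)" "1 + of_real (d k) * \<sigma> w \<noteq> 0" if w: "w \<in> tube" for k w
  proof -
    have R: "Re (1 + of_real (d k) * \<sigma> w) \<ge> 1" using \<sigma>(1)[OF w] d[of k] by simp
    thus 1: "cmod (1 + of_real (d k) * \<sigma> w) \<ge> 1" using complex_Re_le_cmod order_trans by blast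
    thus "1 + of_real (d k) * \<sigma> w \<noteq> 0" by auto
    have "(cmod (of_real (d k) * \<sigma> w))\<^sup>2 \<le> (cmod (1 + of_real (d k) * \<sigma> w))\<^sup>2"
      unfolding cmod_power2 using \<sigma>(1)[OF w] d[of k] by (intro add_mono[OF power_mono eq_refl]) auto
    hence "cmod (of_real (d k) * \<sigma> w) \<le> cmod (1 + of_real (d k) * \<sigma> w)" by (rule power2_le_imp_le) simp
    thus "cmod (1 + of_real (d k) * \<sigma> w) \<ge> d k * cmod (\<sigma> w)" using d[of k] by (simp add: norm_mult)
  qed
  have Gle: "cmod (G k w) \<le> cmod (g w)" if "w \<in> tube" for k w
    using mult_left_mono[OF den(1)[OF that, of k] norm_ge_zero[of "g w"]] by (simp add: G_def norm_divide divide_le_eq)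
  have rep: "integrable (vol \<alpha>) (\<lambda>w. bergman_kernel \<alpha> x w * G k w)" "(LINT w|vol \<alpha>. bergman_kernel \<alpha> x w * G k w) = G k x" if x: "x \<in> tube" for x k
  proof -
    have "holomorphic_several (\<lambda>w. 1 + of_real (d k) * \<sigma> w) tube"
      unfolding holomorphic_several_def
    proof
      fix w :: "(complex, 'n) vec"
      have "((\<lambda>w. 1 + of_real (d k) * \<sigma> w) has_derivative (\<lambda>h. of_real (d k) * drho2 w base_pt h)) (at w)"
        unfolding \<sigma>_def using has_derivative_add[OF has_derivative_const has_derivative_mult_right[OF rho2_has_derivative]] by simp
      moreover have "of_real (d k) * drho2 w base_pt (c *s v) = c * (of_real (d k) * drho2 w base_pt v)" for c v
        by (simp add: drho2_def sum_distrib_left algebra_simps)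
      ultimately show "\<exists>D. ((\<lambda>w. 1 + of_real (d k) * \<sigma> w) has_derivative D) (at w) \<and> (\<forall>c v. D (c *s v) = c * D v)" by blast
    qed
    hence hG: "holomorphic_several (G k) tube"
      unfolding G_def[abs_def] by (intro holomorphic_several_divide hol den(3))
    have bG: "cmod (G k w) \<le> (C * (k0 / d k)) * rho w powr (- e)" if w: "w \<in> tube" for w
    proof -
      have t: "tube_size w \<ge> 1" by (rule tube_size_ge_1)
      have "d k * tube_size w / k0 \<le> d k * cmod (\<sigma> w)" using \<sigma>(2)[OF w] d[of k] k0 by (simp add: field_simps)
      hence dl: "d k / k0 * tube_size w \<le> cmod (1 + of_real (d k) * \<sigma> w)" using den(2)[OF w, of k] by simp
      have pos: "d k / k0 * tube_size w > 0" using d[of k] k0 t by (intro mult_pos_pos divide_pos_pos) auto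
      \<comment> \<open>As 2 e <= 1, one factor of order \<open>tube_size\<close> in the denominator
        removes the polynomial growth and leaves \<open>rho w powr (- e)\<close>.\<close>
      have "tube_size w powr (2 * e) \<le> tube_size w powr 1" using t e by (intro powr_mono) auto
      hence "C * tube_size w powr (2 * e) * rho w powr (- e) \<le> C * tube_size w * rho w powr (- e)"
        using C(1) t by (intro mult_right_mono mult_left_mono) auto
      hence "cmod (g w) \<le> C * tube_size w * rho w powr (- e)" using C(2)[OF w] by linarith
      hence "cmod (G k w) \<le> (C * tube_size w * rho w powr (- e)) / (d k / k0 * tube_size w)"
        unfolding G_def norm_divide using dl pos C(1) t by (intro frac_le) auto
      also have "\<dots> = (C * (k0 / d k)) * rho w powr (- e)" using t d[of k] k0 by (simp add: field_simps)
      finally show ?thesis .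
    qed
    show "integrable (vol \<alpha>) (\<lambda>w. bergman_kernel \<alpha> x w * G k w)" "(LINT w|vol \<alpha>. bergman_kernel \<alpha> x w * G k w) = G k x"
      using bergman_reproducing_vol[OF \<alpha> e(1,3) hG bG x] by blast+
  qed
  have eq: "(LINT w|vol \<alpha>. mod_kernel \<alpha> z w * G k w) = G k z" for k
  proof -
    \<comment> \<open>The regularised function still vanishes at the base point, so the subtracted
      part of the kernel reproduces 0.\<close>
    have "G k base_pt = 0" by (simp add: G_def gb(2))
    thus ?thesis unfolding mod_kernel_def left_diff_distrib
      by (subst Bochner_Integration.integral_diff[OF rep(1)[OF z] rep(1)[OF base_pt_tube]]) (simp add: rep z base_pt_tube)
  qed
  have dlim: "d \<longlonglongrightarrow> 0" unfolding d_def[abs_def] using LIMSEQ_inverse_real_of_nat by (simp add: inverse_eq_divide add.commute)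
  have Glim: "(\<lambda>k. G k w) \<longlonglongrightarrow> g w" for w
  proof -
    have "(\<lambda>k. g w / (1 + of_real (d k) * \<sigma> w)) \<longlonglongrightarrow> g w / (1 + of_real 0 * \<sigma> w)"
      by (intro tendsto_intros dlim) simp
    thus ?thesis by (simp add: G_def)
  qed
  have gm: "(\<lambda>w. mod_kernel \<alpha> z w * g w) \<in> borel_measurable (vol \<alpha>)"
    by (rule borel_measurable_integrable[OF bloch0_kernel_integrable[OF \<alpha> g z]])
  have "(\<lambda>k. LINT w|vol \<alpha>. mod_kernel \<alpha> z w * G k w) \<longlonglongrightarrow> (LINT w|vol \<alpha>. mod_kernel \<alpha> z w * g w)"
  proof (rule integral_dominated_convergence[where w = "\<lambda>w. cmod (mod_kernel \<alpha> z w * g w)"])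
    show "integrable (vol \<alpha>) (\<lambda>w. cmod (mod_kernel \<alpha> z w * g w))" by (intro integrable_norm bloch0_kernel_integrable[OF \<alpha> g z])
    show "(\<lambda>w. mod_kernel \<alpha> z w * G k w) \<in> borel_measurable (vol \<alpha>)" for k
    proof -
      have "continuous_on tube (\<lambda>w. \<sigma> w)" unfolding \<sigma>_def rho2_def by (intro continuous_intros)
      hence "continuous_on tube (G k)" unfolding G_def[abs_def]
        using den(3) by (intro continuous_intros holomorphic_several_imp_continuous_on[OF hol]) auto
      thus ?thesis unfolding measurable_vol
        by (intro borel_measurable_times borel_imp_lebesgue_on mod_kernel_measurable continuous_imp_measurable_on_sets_lebesgue tube_sets)
    qed
    show "AE w in vol \<alpha>. cmod (mod_kernel \<alpha> z w * G k w) \<le> cmod (mod_kernel \<alpha> z w * g w)" for k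
      by (rule AE_vol_tube) (simp add: norm_mult mult_left_mono Gle)
    show "AE w in vol \<alpha>. (\<lambda>k. mod_kernel \<alpha> z w * G k w) \<longlonglongrightarrow> mod_kernel \<alpha> z w * g w"
      by (intro AE_I2 tendsto_intros Glim)
  qed (rule gm)
  hence "(\<lambda>k. G k z) \<longlonglongrightarrow> mod_proj \<alpha> g z" by (simp only: eq mod_proj_def)
  from LIMSEQ_unique[OF this Glim] show ?thesis .
qed

section \<open>The range of the projection and surjectivity\<close>

lemma mod_proj_holomorphic:
  fixes f :: "complex^'n::{finite,linorder} \<Rightarrow> complex"
  assumes "\<alpha> > -1" "f \<in> Linf"
  shows "holomorphic_several (mod_proj \<alpha> f) tube"
  unfolding holomorphic_several_def
  using mod_proj_has_derivative(1,3)[OF assms] by blast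

lemma mod_proj_base: "mod_proj \<alpha> f base_pt = 0"
  by (simp add: mod_proj_def mod_kernel_def)

lemma mod_proj_in_bloch0:
  fixes f :: "complex^'n::{finite,linorder} \<Rightarrow> complex"
  assumes \<alpha>: "\<alpha> > -1" and f: "f \<in> Linf"
  shows "mod_proj \<alpha> f \<in> bloch0"
proof -
  obtain C where C: "C \<ge> 0" "\<And>f z. f \<in> Linf \<Longrightarrow> z \<in> (tube :: (complex, 'n) vec set) \<Longrightarrow> inv_grad (mod_proj \<alpha> f) z \<le> C * Linf_norm f"
    by (rule mod_proj_gradient_bound[OF \<alpha>, where 'n = 'n]) blast
  hence "bdd_above (inv_grad (mod_proj \<alpha> f) ` tube)"
    using f by (intro bdd_aboveI2[where M = "C * Linf_norm f"]) blast
  thus ?thesis by (simp add: bloch0_def bloch_def mod_proj_base mod_proj_holomorphic[OF \<alpha> f])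
qed

text \<open>Since \<open>\<partial>\<^sub>n K\<^sub>\<alpha> = (\<i>/2) (\<alpha> + 1) K\<^sub>\<alpha>\<^sub>+\<^sub>1\<close>, this is the function whose projection has the \<open>z\<^sub>n\<close>-derivative of \<open>g\<close>.\<close>

definition bloch_density :: "real \<Rightarrow> (complex^'n::{finite,linorder} \<Rightarrow> complex) \<Rightarrow> complex^'n::{finite,linorder} \<Rightarrow> complex" where
  "bloch_density \<alpha> g w = 2 / (\<i> * of_real (\<alpha> + 1)) * (of_real (rho w) * pd last_idx g w)"

text \<open>Here \<open>drho2\<close> is the constant -\<i> / 2, and the recursion of Gamma in
  numerator and denominator gives N * c(\<alpha>) = (\<alpha> + 1) * c(\<alpha> + 1) for the kernel
  constants, with N = n + 1 + \<alpha>.\<close>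

lemma dkernel_last:
  fixes z w :: "complex^'n::{finite,linorder}"
  assumes \<alpha>: "\<alpha> > -1"
  shows "dkernel \<alpha> z w (axis last_idx 1) = \<i> / 2 * of_real (\<alpha> + 1) * bergman_kernel (\<alpha> + 1) z w"
proof -
  define N where "N = real CARD('n) + 1 + \<alpha>"
  have N: "N > 0" "\<alpha> + 1 > 0" using \<alpha> by (auto simp: N_def)
  have d: "drho2 z w (axis last_idx 1) = - \<i> / 2" by (simp add: drho2_def axis_last_nth cong: sum.cong_simp)
  have ni: "N \<notin> \<int>\<^sub>\<le>\<^sub>0" "\<alpha> + 1 \<notin> \<int>\<^sub>\<le>\<^sub>0" using N by (auto simp: nonpos_Ints_def)
  have G1: "Gamma (real CARD('n) + 1 + (\<alpha> + 1)) = N * Gamma N"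
    using Gamma_plus1[OF ni(1)] by (simp add: N_def add_ac)
  have G2: "Gamma (\<alpha> + 1 + 1) = (\<alpha> + 1) * Gamma (\<alpha> + 1)" by (rule Gamma_plus1[OF ni(2)])
  have g0: "Gamma (\<alpha> + 1) \<noteq> 0" using Gamma_real_pos[OF N(2)] by simp
  define D where "D = 2 ^ (CARD('n) + 1) * pi ^ CARD('n)"
  have D: "D \<noteq> 0" by (simp add: D_def)
  have "(\<alpha> + 1) * kernel_const (\<alpha> + 1) TYPE('n) = (\<alpha> + 1) * (N * Gamma N / (D * ((\<alpha> + 1) * Gamma (\<alpha> + 1))))"
    unfolding kernel_const_def G1 G2 D_def ..
  also have "\<dots> = N * (Gamma N / (D * Gamma (\<alpha> + 1)))" using N by simp
  also have "\<dots> = N * kernel_const \<alpha> TYPE('n)" unfolding kernel_const_def D_def N_def ..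
  finally have k: "complex_of_real (\<alpha> + 1) * of_real (kernel_const (\<alpha> + 1) TYPE('n)) = of_real N * of_real (kernel_const \<alpha> TYPE('n))"
    by (simp only: of_real_mult[symmetric])
  have p: "real CARD('n) + 2 + \<alpha> = real CARD('n) + 1 + (\<alpha> + 1)" by simp
  have "dkernel \<alpha> z w (axis last_idx 1) = \<i> / 2 * (of_real N * of_real (kernel_const \<alpha> TYPE('n))) * rho2 z w powr of_real (- (real CARD('n) + 1 + (\<alpha> + 1)))"
    unfolding dkernel_def d N_def[symmetric] p by simp
  also have "\<dots> = \<i> / 2 * of_real (\<alpha> + 1) * bergman_kernel (\<alpha> + 1) z w"
    unfolding k[symmetric] bergman_kernel_alt by (simp only: mult.assoc)
  finally show ?thesis .
qed

text \<open>Real translations of z_n preserve \<open>rho\<close>, so the difference quotient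
  inherits the bound A / rho of the derivative. The step is taken in the real direction for this
  reason.\<close>

lemma grad_bounded_real_quotient:
  fixes g :: "complex^'n::{finite,linorder} \<Rightarrow> complex"
  assumes hol: "holomorphic_several g tube" and A: "grad_bounded A g" and t: "t > 0" and w: "w \<in> tube"
  shows "cmod ((g (w + axis last_idx (of_real t)) - g w) / of_real t) \<le> A * rho w powr (- 1)"
proof -
  have r: "rho w > 0" using w by (simp add: tube_iff)
  have e: "w + axis last_idx 0 = w" by (simp add: vec_eq_iff axis_def)
  have "cmod (g (w + axis last_idx (of_real t)) - g (w + axis last_idx 0)) \<le> A / rho w * cmod (of_real t - 0)"
  proof (rule field_differentiable_bound[where S = "closed_segment 0 (of_real t)" and f' = "\<lambda>s. pd last_idx g (w + axis last_idx s)"])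
    fix s :: complex assume "s \<in> closed_segment 0 (of_real t)"
    hence "Im s = 0" by (auto simp: closed_segment_def)
    hence s: "w + axis last_idx s \<in> tube" "rho (w + axis last_idx s) = rho w" using r by (auto simp: tube_iff rho_axis_last)
    show "((\<lambda>s. g (w + axis last_idx s)) has_field_derivative pd last_idx g (w + axis last_idx s)) (at s within closed_segment 0 (of_real t))"
      by (rule has_field_derivative_at_within[OF holomorphic_several_pd_last[OF hol s(1)]])
    show "cmod (pd last_idx g (w + axis last_idx s)) \<le> A / rho w"
      using grad_boundedD(1)[OF A s(1)] s(2) by simp
  qed auto
  thus ?thesis unfolding e using t r by (simp add: norm_divide powr_minus_divide field_simps)
qed

text \<open>The derivative \<open>pd last_idx g\<close> enters as the limit of difference quotients,
  which are holomorphic directly by the chain rule. Measurability passes to the limit, and so does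
  the reproducing formula, by dominated convergence with majorant A / rho.\<close>

lemma bloch_density_props:
  fixes g :: "complex^'n::{finite,linorder} \<Rightarrow> complex"
  assumes \<alpha>: "\<alpha> > -1" and g: "g \<in> bloch"
  shows "bloch_density \<alpha> g \<in> Linf"
    and "z \<in> tube \<Longrightarrow> pd last_idx (mod_proj \<alpha> (bloch_density \<alpha> g)) z = pd last_idx g z"
proof -
  note hol = bloch_holomorphic[OF g]
  obtain A where A: "grad_bounded A g" by (rule bloch_grad_bounded[OF g])
  have A0: "A \<ge> 0" by (rule grad_boundedD(3)[OF A base_pt_tube])
  define d where "d k = 1 / (real k + 1)" for k
  have d: "d k > 0" for k by (simp add: d_def)
  have dlim: "d \<longlonglongrightarrow> 0" unfolding d_def[abs_def] using LIMSEQ_inverse_real_of_nat by (simp add: inverse_eq_divide add.commute)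
  define F where "F k w = (g (w + axis last_idx (of_real (d k))) - g w) / of_real (d k)" for k w
  define G where "G w = pd last_idx g w" for w
  have shift: "w + axis last_idx (of_real t) \<in> tube" if "w \<in> tube" for w and t :: real
    using that by (simp add: tube_iff rho_axis_last)
  have Fhol: "holomorphic_several (F k) tube" for k
    unfolding holomorphic_several_def
  proof
    fix w :: "(complex, 'n) vec" assume w: "w \<in> tube"
    obtain D where D: "(g has_derivative D) (at w)" "\<And>a v. D (a *s v) = a * D v"
      by (rule holomorphic_severalD[OF hol w]) blast
    obtain E where E: "(g has_derivative E) (at (w + axis last_idx (of_real (d k))))" "\<And>a v. E (a *s v) = a * E v"
      by (rule holomorphic_severalD[OF hol shift[OF w]]) blast
    have "((\<lambda>w. w + axis last_idx (of_real (d k))) has_derivative (\<lambda>h. h)) (at w)"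
      by (auto intro!: derivative_eq_intros)
    from diff_chain_at[OF this E(1)] have "((\<lambda>w. g (w + axis last_idx (of_real (d k)))) has_derivative E) (at w)"
      by (simp add: o_def)
    from has_derivative_mult_right[OF has_derivative_diff[OF this D(1)], of "1 / of_real (d k)"]
    have "(F k has_derivative (\<lambda>h. 1 / of_real (d k) * (E h - D h))) (at w)"
      by (simp add: F_def[abs_def])
    thus "\<exists>D. (F k has_derivative D) (at w) \<and> (\<forall>c v. D (c *s v) = c * D v)"
      by (intro exI[of _ "\<lambda>h. 1 / of_real (d k) * (E h - D h)"] conjI) (simp_all add: D(2) E(2) right_diff_distrib)
  qed
  have Fb: "cmod (F k w) \<le> A * rho w powr (- 1)" if "w \<in> tube" for k w
    unfolding F_def by (rule grad_bounded_real_quotient[OF hol A d that])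
  have Flim: "(\<lambda>k. F k w) \<longlonglongrightarrow> G w" if w: "w \<in> tube" for w
  proof -
    have e: "w + axis last_idx 0 = w" by (simp add: vec_eq_iff axis_def)
    have "((\<lambda>s. g (w + axis last_idx s)) has_field_derivative G w) (at 0)"
      using holomorphic_several_pd_last[OF hol, of w 0] w unfolding G_def e by simp
    hence "((\<lambda>h. (g (w + axis last_idx h) - g w) / h) \<longlongrightarrow> G w) (at 0)"
      unfolding DERIV_def by (simp add: e)
    moreover have "filterlim (\<lambda>k. complex_of_real (d k)) (at 0) sequentially"
      unfolding filterlim_at using d tendsto_of_real[OF dlim, where 'a = complex] by (auto simp: less_imp_neq[symmetric])
    ultimately show ?thesis unfolding F_def by (rule filterlim_compose)
  qed
  have Gm: "G \<in> borel_measurable (lebesgue_on tube)"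
  proof (rule borel_measurable_LIMSEQ_metric)
    show "F k \<in> borel_measurable (lebesgue_on tube)" for k
      by (intro continuous_imp_measurable_on_sets_lebesgue holomorphic_several_imp_continuous_on Fhol tube_sets)
    show "(\<lambda>k. F k w) \<longlonglongrightarrow> G w" if "w \<in> space (lebesgue_on tube)" for w using that Flim by simp
  qed
  define f where "f = bloch_density \<alpha> g"
  have f_def': "f w = 2 / (\<i> * of_real (\<alpha> + 1)) * (of_real (rho w) * G w)" for w by (simp add: f_def bloch_density_def G_def)
  have fm: "f \<in> borel_measurable (lebesgue_on tube)"
  proof -
    have "(\<lambda>w. complex_of_real (rho w)) \<in> borel_measurable (lebesgue_on tube)"
      by (rule borel_imp_lebesgue_on) measurable
    thus ?thesis unfolding f_def'[abs_def] by (intro borel_measurable_times Gm) auto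
  qed
  have fb: "cmod (f w) \<le> 2 / (\<alpha> + 1) * A" if w: "w \<in> tube" for w
  proof -
    have "cmod (f w) = 2 / (\<alpha> + 1) * (rho w * cmod (G w))"
      using w \<alpha> unfolding f_def' by (simp add: norm_mult norm_divide tube_iff del: of_real_add)
    also have "\<dots> \<le> 2 / (\<alpha> + 1) * A"
      using A w \<alpha> by (intro mult_left_mono) (auto simp: grad_bounded_def G_def)
    finally show ?thesis .
  qed
  have "esssup (lebesgue_on tube) (\<lambda>z. ereal (cmod (f z))) \<le> ereal (2 / (\<alpha> + 1) * A)"
  proof (rule esssup_I)
    show "(\<lambda>z. ereal (cmod (f z))) \<in> borel_measurable (lebesgue_on tube)" using fm by measurable
    show "AE x in lebesgue_on tube. ereal (cmod (f x)) \<le> ereal (2 / (\<alpha> + 1) * A)"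
      by (rule AE_I2) (use fb in simp)
  qed
  hence "esssup (lebesgue_on tube) (\<lambda>z. ereal (cmod (f z))) < \<infinity>" by (rule le_less_trans) simp
  thus fL: "bloch_density \<alpha> g \<in> Linf" using fm unfolding Linf_def f_def by simp
  show "pd last_idx (mod_proj \<alpha> (bloch_density \<alpha> g)) z = pd last_idx g z" if z: "z \<in> tube"
  proof -
    \<comment> \<open>The reproducing formula is applied with weight \<alpha> + 1 and growth
      exponent 1, admissible for every \<alpha> > -1.\<close>
    have \<alpha>1: "\<alpha> + 1 > -1" "(1::real) < \<alpha> + 1 + 1" using \<alpha> by auto
    have km: "(\<lambda>w. bergman_kernel (\<alpha> + 1) z w) \<in> borel_measurable (lebesgue_on tube)"
      by (intro borel_imp_lebesgue_on) measurable
    have "pd last_idx (mod_proj \<alpha> f) z = (LINT w|vol \<alpha>. dkernel \<alpha> z w (axis last_idx 1) * f w)"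
      unfolding f_def by (rule pd_eq[OF mod_proj_has_derivative(1,3)[OF \<alpha> fL z]])
    also have "\<dots> = (LINT w|vol \<alpha>. bergman_kernel (\<alpha> + 1) z w * (of_real (rho w) * G w))"
    proof -
      have "complex_of_real (\<alpha> + 1) \<noteq> 0" using \<alpha> by (simp add: of_real_eq_0_iff del: of_real_add)
      thus ?thesis unfolding dkernel_last[OF \<alpha>] f_def' by (simp add: field_simps del: of_real_add)
    qed
    also have "\<dots> = (LINT w|lebesgue_on tube. rho w powr \<alpha> *\<^sub>R (bergman_kernel (\<alpha> + 1) z w * (of_real (rho w) * G w)))"
    proof (rule integral_vol)
      have "(\<lambda>w. complex_of_real (rho w)) \<in> borel_measurable (lebesgue_on tube)"
        by (rule borel_imp_lebesgue_on) measurable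
      thus "(\<lambda>w. bergman_kernel (\<alpha> + 1) z w * (of_real (rho w) * G w)) \<in> borel_measurable (lebesgue_on tube)"
        by (intro borel_measurable_times Gm km)
    qed
    \<comment> \<open>The factor \<open>rho w\<close> of the density is moved into the weight, which
      now matches the index of the kernel.\<close>
    also have "\<dots> = (LINT w|lebesgue_on tube. rho w powr (\<alpha> + 1) *\<^sub>R (bergman_kernel (\<alpha> + 1) z w * G w))"
    proof (rule Bochner_Integration.integral_cong[OF refl])
      fix w :: "(complex, 'n) vec" assume "w \<in> space (lebesgue_on tube)"
      hence "rho w > 0" by (simp add: tube_iff)
      hence "rho w powr (\<alpha> + 1) = rho w powr \<alpha> * rho w" by (simp add: powr_add)
      thus "rho w powr \<alpha> *\<^sub>R (bergman_kernel (\<alpha> + 1) z w * (of_real (rho w) * G w)) = rho w powr (\<alpha> + 1) *\<^sub>R (bergman_kernel (\<alpha> + 1) z w * G w)"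
        by (simp add: scaleR_conv_of_real mult_ac)
    qed
    also have "\<dots> = (LINT w|vol (\<alpha> + 1). bergman_kernel (\<alpha> + 1) z w * G w)"
      by (rule integral_vol[symmetric]) (intro borel_measurable_times Gm km)
    also have "\<dots> = G z"
    proof -
      have "(\<lambda>k. LINT w|vol (\<alpha> + 1). bergman_kernel (\<alpha> + 1) z w * F k w) \<longlonglongrightarrow> (LINT w|vol (\<alpha> + 1). bergman_kernel (\<alpha> + 1) z w * G w)"
      proof (rule integral_dominated_convergence[where w = "\<lambda>w. cmod (bergman_kernel (\<alpha> + 1) z w * of_real (A * rho w powr (- 1)))"])
        show "(\<lambda>w. bergman_kernel (\<alpha> + 1) z w * G w) \<in> borel_measurable (vol (\<alpha> + 1))"
          unfolding measurable_vol by (intro borel_measurable_times Gm km)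
        show "(\<lambda>w. bergman_kernel (\<alpha> + 1) z w * F k w) \<in> borel_measurable (vol (\<alpha> + 1))" for k
          by (rule borel_measurable_integrable) (rule bergman_reproducing_vol(1)[OF \<alpha>1(1) _ \<alpha>1(2) Fhol Fb z], simp)
        show "AE w in vol (\<alpha> + 1). (\<lambda>k. bergman_kernel (\<alpha> + 1) z w * F k w) \<longlonglongrightarrow> bergman_kernel (\<alpha> + 1) z w * G w"
          by (rule AE_vol_tube) (intro tendsto_intros Flim)
        show "AE w in vol (\<alpha> + 1). cmod (bergman_kernel (\<alpha> + 1) z w * F k w) \<le> cmod (bergman_kernel (\<alpha> + 1) z w * of_real (A * rho w powr (- 1)))" for k
        proof (rule AE_vol_tube)
          fix w :: "(complex, 'n) vec" assume w: "w \<in> tube"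
          have "cmod (of_real (A * rho w powr (- 1))) = A * rho w powr (- 1)" unfolding norm_of_real using A0 by simp
          thus "cmod (bergman_kernel (\<alpha> + 1) z w * F k w) \<le> cmod (bergman_kernel (\<alpha> + 1) z w * of_real (A * rho w powr (- 1)))"
            unfolding norm_mult[of "bergman_kernel (\<alpha> + 1) z w"] using Fb[OF w, of k] by (intro mult_left_mono) auto
        qed
        show "integrable (vol (\<alpha> + 1)) (\<lambda>w. cmod (bergman_kernel (\<alpha> + 1) z w * of_real (A * rho w powr (- 1))))"
        proof (rule integrable_norm, rule vol_dominated_finite)
          let ?B = "\<bar>kernel_const (\<alpha> + 1) TYPE('n)\<bar> * A"
          let ?p = "\<lambda>w. cmod (rho2 z w) powr (- (real CARD('n) + 1 + (\<alpha> + 1)))"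
          show "(\<lambda>w. bergman_kernel (\<alpha> + 1) z w * of_real (A * rho w powr (- 1))) \<in> borel_measurable (lebesgue_on tube)"
            by (intro borel_imp_lebesgue_on) measurable
          show "(\<lambda>w. ?B * (rho w powr (- 1) * ?p w)) \<in> borel_measurable borel" by measurable
          show "AE w in lebesgue_on tube. cmod (bergman_kernel (\<alpha> + 1) z w * of_real (A * rho w powr (- 1))) \<le> ?B * (rho w powr (- 1) * ?p w)"
          proof (rule AE_I2)
            fix w :: "(complex, 'n) vec"
            have "cmod (bergman_kernel (\<alpha> + 1) z w * of_real (A * rho w powr (- 1))) = ?B * (rho w powr (- 1) * ?p w)"
              unfolding bergman_kernel_alt norm_mult norm_powr_of_real norm_of_real using A0 by (simp add: abs_mult)
            thus "cmod (bergman_kernel (\<alpha> + 1) z w * of_real (A * rho w powr (- 1))) \<le> ?B * (rho w powr (- 1) * ?p w)" by simp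
          qed
          have "(\<integral>\<^sup>+w. ennreal (pos_powr (rho w) (\<alpha> + 1) * (?B * (rho w powr (- 1) * ?p w))) \<partial>lborel)
             = (\<integral>\<^sup>+w. ennreal ?B * ennreal (pos_powr (rho w) (\<alpha> + 1 - 1) * ?p w) \<partial>lborel)"
          proof (rule nn_integral_cong)
            fix w :: "(complex, 'n) vec"
            have "pos_powr (rho w) (\<alpha> + 1 - 1) = pos_powr (rho w) (\<alpha> + 1) * rho w powr (- 1)"
              unfolding pos_powr_def by (simp add: powr_add powr_minus_divide)
            thus "ennreal (pos_powr (rho w) (\<alpha> + 1) * (?B * (rho w powr (- 1) * ?p w))) = ennreal ?B * ennreal (pos_powr (rho w) (\<alpha> + 1 - 1) * ?p w)"
              using A0 by (subst ennreal_mult'[symmetric]) (auto simp: mult_ac)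
          qed
          also have "\<dots> = ennreal ?B * (\<integral>\<^sup>+w. ennreal (pos_powr (rho w) (\<alpha> + 1 - 1) * ?p w) \<partial>lborel)"
            by (rule nn_integral_cmult) measurable
          also have "\<dots> < \<infinity>"
            using bergman_integrable_bound[OF \<alpha>1(1) zero_less_one \<alpha>1(2) z] by (simp add: ennreal_mult_less_top)
          finally show "(\<integral>\<^sup>+w. ennreal (pos_powr (rho w) (\<alpha> + 1) * (?B * (rho w powr (- 1) * ?p w))) \<partial>lborel) < \<infinity>" .
        qed
      qed
      moreover have "(LINT w|vol (\<alpha> + 1). bergman_kernel (\<alpha> + 1) z w * F k w) = F k z" for k
        using bergman_reproducing_vol(2)[OF \<alpha>1(1) zero_less_one \<alpha>1(2) Fhol Fb z] .
      ultimately show ?thesis using LIMSEQ_unique[OF _ Flim[OF z]] by simp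
    qed
    finally show ?thesis by (simp add: f_def G_def)
  qed
qed

lemma mod_proj_surjective:
  fixes g :: "complex^'n::{finite,linorder} \<Rightarrow> complex"
  assumes \<alpha>: "\<alpha> > -1" and g: "g \<in> bloch0" and w: "w \<in> tube"
  shows "mod_proj \<alpha> (bloch_density \<alpha> g) w = g w"
proof -
  have gb: "g \<in> bloch" "g base_pt = 0" using g by (auto simp: bloch0_def)
  define P where "P = mod_proj \<alpha> (bloch_density \<alpha> g)"
  note fL = bloch_density_props(1)[OF \<alpha> gb(1)]
  have P: "P \<in> bloch" "P base_pt = 0"
    using mod_proj_in_bloch0[OF \<alpha> fL] by (auto simp: P_def bloch0_def)
  obtain A where A: "grad_bounded A g" by (rule bloch_grad_bounded[OF gb(1)])
  obtain B where B: "grad_bounded B P" by (rule bloch_grad_bounded[OF P(1)])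
  define h where "h z = P z - g z" for z
  have der: "\<exists>D. (h has_derivative D) (at z) \<and> (\<forall>c v. D (c *s v) = c * D v)" "pd j h z = pd j P z - pd j g z" if z: "z \<in> tube" for z j
  proof -
    obtain D where D: "(P has_derivative D) (at z)" "\<And>a v. D (a *s v) = a * D v"
      by (rule holomorphic_severalD[OF bloch_holomorphic[OF P(1)] z]) blast
    obtain E where E: "(g has_derivative E) (at z)" "\<And>a v. E (a *s v) = a * E v"
      by (rule holomorphic_severalD[OF bloch_holomorphic[OF gb(1)] z]) blast
    have h: "(h has_derivative (\<lambda>v. D v - E v)) (at z)" unfolding h_def[abs_def] by (rule has_derivative_diff[OF D(1) E(1)])
    have l: "D (a *s v) - E (a *s v) = a * (D v - E v)" for a v by (simp add: D(2) E(2) algebra_simps)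
    show "\<exists>D. (h has_derivative D) (at z) \<and> (\<forall>c v. D (c *s v) = c * D v)" using h l by blast
    show "pd j h z = pd j P z - pd j g z" by (simp add: pd_eq[OF h l] pd_eq[OF D] pd_eq[OF E])
  qed
  have hol: "holomorphic_several h tube" unfolding holomorphic_several_def using der(1) by blast
  have gr: "grad_bounded (B + A) h"
    unfolding grad_bounded_def
  proof (intro ballI conjI allI impI)
    fix z :: "(complex, 'n) vec" assume z: "z \<in> tube"
    hence r: "rho z > 0" by (simp add: tube_iff)
    have "rho z * cmod (pd last_idx h z) \<le> rho z * (cmod (pd last_idx P z) + cmod (pd last_idx g z))"
      unfolding der(2)[OF z] using r by (intro mult_left_mono norm_triangle_ineq4) auto
    thus "rho z * cmod (pd last_idx h z) \<le> B + A"
      using A B z unfolding grad_bounded_def distrib_left by fastforce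
    fix j :: 'n assume j: "j < last_idx"
    have "grad_comp j h z = grad_comp j P z - grad_comp j g z" by (simp add: grad_comp_def der(2)[OF z] algebra_simps)
    hence "sqrt (rho z) * cmod (grad_comp j h z) \<le> sqrt (rho z) * (cmod (grad_comp j P z) + cmod (grad_comp j g z))"
      using r by (simp add: norm_triangle_ineq4 mult_left_mono)
    moreover have "sqrt (rho z) * cmod (grad_comp j P z) \<le> B" "sqrt (rho z) * cmod (grad_comp j g z) \<le> A"
      using A B z j unfolding grad_bounded_def by auto
    ultimately show "sqrt (rho z) * cmod (grad_comp j h z) \<le> B + A" unfolding distrib_left by linarith
  qed
  have "h w = h base_pt"
    by (rule grad_bounded_const[OF hol gr _ w]) (simp add: der(2) P_def bloch_density_props(2)[OF \<alpha> gb(1)])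
  thus ?thesis using P(2) gb(2) by (simp add: h_def P_def)
qed

text \<open>Functions are total, so equalities are asserted on the tube only. Integrability is a
  separate clause because the integral of a non-integrable function is 0 by convention; it covers
  \<open>bloch0\<close> as well as \<open>Linf\<close>, since a Bloch function need not be bounded
  and the identity on \<open>bloch0\<close> is thus not a statement about the operator on
  \<open>Linf\<close>. The last clause says that the image of \<open>Linf\<close> is the whole
  space.\<close>

theorem theoremC:
  fixes \<alpha> :: real
  assumes "\<alpha> > -1"
  shows "(\<forall>f \<in> Linf \<union> bloch0. \<forall>z \<in> (tube :: (complex ^ 'n::{finite,linorder}) set).
             integrable (vol \<alpha>) (\<lambda>w. mod_kernel \<alpha> z w * f w))
       \<and> (\<forall>f \<in> Linf. \<forall>g \<in> Linf. \<forall>a b. \<forall>z \<in> (tube :: (complex ^ 'n::{finite,linorder}) set).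
             mod_proj \<alpha> (\<lambda>w. a * f w + b * g w) z = a * mod_proj \<alpha> f z + b * mod_proj \<alpha> g z)
       \<and> (\<forall>f \<in> Linf. mod_proj \<alpha> f \<in> (bloch0 :: (complex ^ 'n::{finite,linorder} \<Rightarrow> complex) set))
       \<and> (\<exists>C. \<forall>f \<in> (Linf :: (complex ^ 'n::{finite,linorder} \<Rightarrow> complex) set).
             bloch_norm (mod_proj \<alpha> f) \<le> C * Linf_norm f)
       \<and> (\<forall>g \<in> bloch0. \<forall>z \<in> (tube :: (complex ^ 'n::{finite,linorder}) set). mod_proj \<alpha> g z = g z)
       \<and> (\<forall>g \<in> bloch0. \<exists>f \<in> Linf. \<forall>z \<in> (tube :: (complex ^ 'n::{finite,linorder}) set). mod_proj \<alpha> f z = g z)"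
proof (intro conjI ballI allI)
  fix f :: "(complex, 'n) vec \<Rightarrow> complex" and z :: "(complex, 'n) vec" assume "f \<in> Linf \<union> bloch0" and z: "z \<in> tube"
  thus "integrable (vol \<alpha>) (\<lambda>w. mod_kernel \<alpha> z w * f w)"
    using mod_proj_integrable[OF assms _ z] bloch0_kernel_integrable[OF assms _ z] by blast
next
  fix f g :: "(complex, 'n) vec \<Rightarrow> complex" and a b and z :: "(complex, 'n) vec"
  assume f: "f \<in> Linf" and g: "g \<in> Linf" and z: "z \<in> tube"
  note i = mod_proj_integrable[OF assms f z] mod_proj_integrable[OF assms g z]
  have "mod_proj \<alpha> (\<lambda>w. a * f w + b * g w) z = (LINT w|vol \<alpha>. a * (mod_kernel \<alpha> z w * f w) + b * (mod_kernel \<alpha> z w * g w))"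
    unfolding mod_proj_def by (intro Bochner_Integration.integral_cong refl) (simp add: algebra_simps)
  also have "\<dots> = a * mod_proj \<alpha> f z + b * mod_proj \<alpha> g z"
    unfolding mod_proj_def
    by (subst Bochner_Integration.integral_add[OF integrable_mult_right[OF i(1)] integrable_mult_right[OF i(2)]])
       (simp only: integral_mult_right_zero)
  finally show "mod_proj \<alpha> (\<lambda>w. a * f w + b * g w) z = a * mod_proj \<alpha> f z + b * mod_proj \<alpha> g z" .
next
  fix f :: "(complex, 'n) vec \<Rightarrow> complex" assume "f \<in> Linf"
  thus "mod_proj \<alpha> f \<in> bloch0" by (rule mod_proj_in_bloch0[OF assms])
next
  obtain C where C: "C \<ge> 0" "\<And>f z. f \<in> Linf \<Longrightarrow> z \<in> (tube :: (complex, 'n) vec set) \<Longrightarrow> inv_grad (mod_proj \<alpha> f) z \<le> C * Linf_norm f"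
    by (rule mod_proj_gradient_bound[OF assms, where 'n = 'n]) blast
  show "\<exists>C. \<forall>f \<in> (Linf :: ((complex, 'n) vec \<Rightarrow> complex) set). bloch_norm (mod_proj \<alpha> f) \<le> C * Linf_norm f"
    unfolding bloch_norm_def using C(2) base_pt_tube by (intro exI[of _ C] ballI cSUP_least) auto
next
  fix g :: "(complex, 'n) vec \<Rightarrow> complex" and z :: "(complex, 'n) vec" assume "g \<in> bloch0" "z \<in> tube"
  thus "mod_proj \<alpha> g z = g z" by (rule mod_proj_bloch0[OF assms])
next
  fix g :: "(complex, 'n) vec \<Rightarrow> complex" assume g: "g \<in> bloch0"
  hence "g \<in> bloch" by (simp add: bloch0_def)
  from bloch_density_props(1)[OF assms this] mod_proj_surjective[OF assms g]
  show "\<exists>f \<in> Linf. \<forall>z \<in> tube. mod_proj \<alpha> f z = g z" by blast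
qed

end
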